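(* Let $d\ge1$, let $g\in\mathbb{U}(d)$ and let $\theta_1,\dots,\theta_d$ be the eigenvalues of $g$, listed with multiplicity. Let $\mu$ be the metaplectic representation restricted to $\mathbb{U}(d)$, so that $\mu(g)$ is a unitary operator on $L^2(\mathbb{R}^d)$. Then the point spectrum of $\mu(g)$ is $$\sigma_p(\mu(g))=\det(g)^{-1/2}\cdot\{\overline{\theta}_1^{\,n_1}\cdots\overline{\theta}_d^{\,n_d}\mid (n_1,\dots,n_d)\in\mathbb{N}_0^d\}.$$ Let $\{v_j\}_{j=1}^d$ be a basis of $\mathbb{C}^d$ with $gv_j=\theta_jv_j$, let $\{e_j\}$ be the canonical basis of $\mathbb{C}^d$ and $\langle\cdot,\cdot\rangle$ its canonical inner product. For each $(n_1,\dots,n_d)\in\mathbb{N}_0^d$ let $q$ be the polynomial on $\mathbb{C}^d$ $$q(z)=\Big(\sum_j\langle v_1,e_j\rangle z_j\Big)^{n_1}\cdots\Big(\sum_j\langle v_d,e_j\rangle z_j\Big)^{n_d}.$$ Then $u=\hat B^{*}q$ is an eigenvector of $\mu(g)$ with eigenvalue $\det(g)^{-1/2}\cdot\overline{\theta_1}^{\,n_1}\cdots\overline{\theta_d}^{\,n_d}$, where $\hat B$ is the Bargmann transform. For any $g\in\mathbb{U}(d)$, $g$ has an irrational rotation eigenvalue (i.e. an eigenvalue $e^{2\pi i\alpha}$ with $\alpha\in\mathbb{R}\setminus\mathbb{Q}$) if and only if $\sigma(\mu(g))=\mathbb{S}^1$. Moreover, if $\theta_j=\exp\big(\frac{2\pi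 i p_j}{q_j}\big)$ with $p_j\in\mathbb{Z}$ and $q_j\in\mathbb{N}$ for every $j$, then $$\sigma_p(\mu(g))=\sigma(\mu(g))=\det(g)^{-1/2}\cdot\Big\{\exp\Big(\frac{2\pi i n p}{q}\Big)\;\Big|\; n\in\mathbb{N}\Big\},$$ where $q$ is the least common multiple of the denominators $q_1,\dots,q_d$ and $p$ is the greatest common divisor of $\frac{q|p_1|}{q_1},\dots,\frac{q|p_d|}{q_d}$. In particular, $\sigma(\mu(g))$ is a rotation of a finite subgroup of $\mathbb{S}^1$.
   Context: $\mathbb{N}_0=\{0,1,2,\dots\}$, $\mathbb{S}^1=\{z\in\mathbb{C}:|z|=1\}$; $\sigma$ and $\sigma_p$ denote the spectrum and the point spectrum (set of eigenvalues). The inner product $\langle\cdot,\cdot\rangle$ on $\mathbb{C}^d$ is conjugate-linear in the first argument and linear in the second, so $\sum_j\langle v,e_j\rangle z_j=\langle v,z\rangle$. The Segal-Bargmann space $\mathfrak{F}^d$ is the Hilbert space of holomorphic functions $F:\mathbb{C}^d\to\mathbb{C}$ with $\int_{\mathbb{C}^d}|F(z)|^2e^{-\pi|z|^2}\,dz<\infty$. The Bargmann transform $\hat B:L^2(\mathbb{R}^d)\to\mathfrak{F}^d$ is the unitary operator $$(\hat Bu)(z)=\pi^{-d/4}\int_{\mathbb{R}^d}u(y)\,\exp\Big(\sqrt{2\pi}\,\sum_j y_jz_j-\tfrac12\sum_j y_j^2-\tfrac{\pi}{2}\sum_j z_j^2\Big)\,dy .$$ Under the identification of $\mathbb{R}^{2d}$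 with $\mathbb{C}^d$, $(x,\xi)\mapsto x+i\xi$, one has $\mathbb{U}(d)=\mathbb{O}(2d)\cap Sp(d)$, and the restriction of the metaplectic representation to $\mathbb{U}(d)$ is given by $\mu(g)=\hat B^{*}\nu(g)\hat B$, where $$[\nu(g)F](z)=\det(g)^{-1/2}F(g^{-1}z),\qquad F\in\mathfrak{F}^d,\ z\in\mathbb{C}^d.$$ Here $\det(g)^{-1/2}$ denotes a choice of square root of $\det(g)^{-1}$ (so $\mu(g)$ is determined up to sign), and the same choice is used throughout the statement. *)

theory Defs
  imports "HOL-Analysis.Analysis" "HOL-Algebra.Group"
begin

definition square_integrable :: "('a::euclidean_space \<Rightarrow> complex) \<Rightarrow> bool" where
  "square_integrable u \<longleftrightarrow> u \<in> borel_measurable lborel \<and> integrable lborel (\<lambda>x. (cmod (u x))\<^sup>2)"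

lemma square_integrable_measurable [measurable_dest]:
  "square_integrable u \<Longrightarrow> u \<in> borel_measurable lborel"
  by (simp add: square_integrable_def)

lemma square_integrable_zero: "square_integrable (\<lambda>x. 0)"
  by (simp add: square_integrable_def)

lemma square_integrable_scale:
  assumes "square_integrable u"
  shows "square_integrable (\<lambda>x. c * u x)"
  using assms by (auto simp: square_integrable_def norm_mult power_mult_distrib)

lemma square_integrable_add:
  assumes u: "square_integrable u" and v: "square_integrable v"
  shows "square_integrable (\<lambda>x. u x + v x)"
  unfolding square_integrable_def
proof
  have [measurable]: "u \<in> borel_measurable lborel" "v \<in> borel_measurable lborel"
    using u v by (auto simp: square_integrable_def)
  show "(\<lambda>x. u x + v x) \<in> borel_measurable lborel" by measurable
  have "integrable lborel (\<lambda>x. 2 * (cmod (u x))\<^sup>2 + 2 * (cmod (v x))\<^sup>2)"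
    using u v by (auto simp: square_integrable_def)
  then show "integrable lborel (\<lambda>x. (cmod (u x + v x))\<^sup>2)"
  proof (rule Bochner_Integration.integrable_bound)
    have "(cmod (u x + v x))\<^sup>2 \<le> 2 * (cmod (u x))\<^sup>2 + 2 * (cmod (v x))\<^sup>2" for x
    proof -
      have "(cmod (u x + v x))\<^sup>2 \<le> (cmod (u x) + cmod (v x))\<^sup>2"
        by (intro power_mono norm_triangle_ineq) auto
      also have "\<dots> \<le> 2 * (cmod (u x))\<^sup>2 + 2 * (cmod (v x))\<^sup>2"
        using sum_squares_bound[of "cmod (u x)" "cmod (v x)"] by (simp add: power2_sum)
      finally show ?thesis .
    qed
    then show "AE x in lborel. norm ((cmod (u x + v x))\<^sup>2)
        \<le> norm (2 * (cmod (u x))\<^sup>2 + 2 * (cmod (v x))\<^sup>2)"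
      by (auto intro!: AE_I2 order_trans[OF _ abs_ge_self])
  qed measurable
qed

lemma borel_measurable_cnj_comp [measurable]:
  "f \<in> borel_measurable M \<Longrightarrow> (\<lambda>x. cnj (f x)) \<in> borel_measurable M"
  by (rule measurable_compose[OF _ borel_measurable_continuous_onI[OF continuous_on_cnj[OF continuous_on_id]]])

lemma integrable_cnj_mult:
  assumes u: "square_integrable u" and v: "square_integrable v"
  shows "integrable lborel (\<lambda>x. cnj (u x) * v x)"
proof -
  have [measurable]: "u \<in> borel_measurable lborel" "v \<in> borel_measurable lborel"
    using u v by (auto simp: square_integrable_def)
  have "integrable lborel (\<lambda>x. (cmod (u x))\<^sup>2 + (cmod (v x))\<^sup>2)"
    using u v by (auto simp: square_integrable_def)
  then show ?thesis
  proof (rule Bochner_Integration.integrable_bound)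
    have "cmod (cnj (u x) * v x) \<le> (cmod (u x))\<^sup>2 + (cmod (v x))\<^sup>2" for x
    proof -
      have "cmod (cnj (u x) * v x) \<le> 2 * cmod (u x) * cmod (v x)"
        by (simp add: norm_mult)
      also have "\<dots> \<le> (cmod (u x))\<^sup>2 + (cmod (v x))\<^sup>2"
        by (rule sum_squares_bound)
      finally show ?thesis .
    qed
    then show "AE x in lborel. norm (cnj (u x) * v x) \<le> norm ((cmod (u x))\<^sup>2 + (cmod (v x))\<^sup>2)"
      by (auto intro!: AE_I2 order_trans[OF _ abs_ge_self])
  qed measurable
qed

definition l2_eq :: "('a::euclidean_space \<Rightarrow> complex) \<Rightarrow> ('a \<Rightarrow> complex) \<Rightarrow> bool" where
  "l2_eq u v \<longleftrightarrow> square_integrable u \<and> square_integrable v \<and> (AE x in lborel. u x = v x)"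

quotient_type (overloaded) 'a l2 = "'a::euclidean_space \<Rightarrow> complex" / partial: l2_eq
proof (rule part_equivpI)
  show "\<exists>u::'a \<Rightarrow> complex. l2_eq u u"
    using square_integrable_zero by (auto simp: l2_eq_def)
  show "symp (l2_eq :: ('a \<Rightarrow> complex) \<Rightarrow> _)"
    by (rule sympI) (auto simp: l2_eq_def eq_commute)
  show "transp (l2_eq :: ('a \<Rightarrow> complex) \<Rightarrow> _)"
    by (rule transpI) (auto simp: l2_eq_def elim: AE_mp)
qed

lift_definition scaleC :: "complex \<Rightarrow> 'a::euclidean_space l2 \<Rightarrow> 'a l2" (infixr \<open>*\<^sub>C\<close> 75)
  is "\<lambda>c u x. c * u x"
  by (auto simp: l2_eq_def square_integrable_scale)

lift_definition l2_cinner :: "'a::euclidean_space l2 \<Rightarrow> 'a l2 \<Rightarrow> complex"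
  is "\<lambda>u v. \<integral>x. cnj (u x) * v x \<partial>lborel"
proof -
  fix u u' v v' :: "'a \<Rightarrow> complex"
  assume a: "l2_eq u u'" "l2_eq v v'"
  then have [measurable]: "u \<in> borel_measurable lborel" "v \<in> borel_measurable lborel"
      "u' \<in> borel_measurable lborel" "v' \<in> borel_measurable lborel"
    by (auto simp: l2_eq_def square_integrable_def)
  show "(\<integral>x. cnj (u x) * v x \<partial>lborel) = (\<integral>x. cnj (u' x) * v' x \<partial>lborel)"
  proof (rule integral_cong_AE)
    show "AE x in lborel. cnj (u x) * v x = cnj (u' x) * v' x"
      using a by (auto simp: l2_eq_def)
  qed measurable
qed

instantiation l2 :: (euclidean_space) real_inner
begin

lift_definition zero_l2 :: "'a l2" is "\<lambda>x. 0"
  by (auto simp: l2_eq_def square_integrable_zero)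

lift_definition plus_l2 :: "'a l2 \<Rightarrow> 'a l2 \<Rightarrow> 'a l2" is "\<lambda>u v x. u x + v x"
  by (auto simp: l2_eq_def square_integrable_add)

definition uminus_l2 :: "'a l2 \<Rightarrow> 'a l2" where
  "uminus_l2 u = (-1) *\<^sub>C u"

definition minus_l2 :: "'a l2 \<Rightarrow> 'a l2 \<Rightarrow> 'a l2" where
  "minus_l2 u v = u + (-1) *\<^sub>C v"

definition scaleR_l2 :: "real \<Rightarrow> 'a l2 \<Rightarrow> 'a l2" where
  "scaleR_l2 r u = complex_of_real r *\<^sub>C u"

definition inner_l2 :: "'a l2 \<Rightarrow> 'a l2 \<Rightarrow> real" where
  "inner_l2 u v = Re (l2_cinner u v)"

definition norm_l2 :: "'a l2 \<Rightarrow> real" where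
  "norm_l2 u = sqrt (inner u u)"

definition sgn_l2 :: "'a l2 \<Rightarrow> 'a l2" where
  "sgn_l2 u = inverse (norm u) *\<^sub>R u"

definition dist_l2 :: "'a l2 \<Rightarrow> 'a l2 \<Rightarrow> real" where
  "dist_l2 u v = norm (u - v)"

definition uniformity_l2 :: "('a l2 \<times> 'a l2) filter" where
  "uniformity_l2 = (INF e\<in>{0<..}. principal {(u, v). dist u v < e})"

definition open_l2 :: "'a l2 set \<Rightarrow> bool" where
  "open_l2 U \<longleftrightarrow> (\<forall>u\<in>U. \<forall>\<^sub>F (u', v) in uniformity. u' = u \<longrightarrow> v \<in> U)"

instance
proof
  fix u v w :: "'a l2" and a b :: real
  show "u + v + w = u + (v + w)"
    by transfer (auto simp: l2_eq_def add.assoc intro!: square_integrable_add)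
  show "u + v = v + u"
    by transfer (auto simp: l2_eq_def add.commute intro!: square_integrable_add)
  show "0 + u = u"
    by transfer (auto simp: l2_eq_def)
  show "- u + u = 0"
    unfolding uminus_l2_def
    by transfer (auto simp: l2_eq_def square_integrable_zero)
  show "u - v = u + - v"
    by (simp add: minus_l2_def uminus_l2_def)
  show "a *\<^sub>R (u + v) = a *\<^sub>R u + a *\<^sub>R v"
    unfolding scaleR_l2_def
    by transfer
      (auto simp: l2_eq_def distrib_left intro!: square_integrable_add square_integrable_scale)
  show "(a + b) *\<^sub>R u = a *\<^sub>R u + b *\<^sub>R u"
    unfolding scaleR_l2_def
    by transfer
      (auto simp: l2_eq_def distrib_right intro!: square_integrable_add square_integrable_scale)
  show "a *\<^sub>R b *\<^sub>R u = (a * b) *\<^sub>R u"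
    unfolding scaleR_l2_def
    by transfer (auto simp: l2_eq_def mult.assoc intro!: square_integrable_scale)
  show "1 *\<^sub>R u = u"
    unfolding scaleR_l2_def by transfer (auto simp: l2_eq_def)
  show "dist u v = norm (u - v)"
    by (rule dist_l2_def)
  show "sgn u = inverse (norm u) *\<^sub>R u"
    by (rule sgn_l2_def)
  show "norm u = sqrt (inner u u)"
    by (rule norm_l2_def)
  show "inner u v = inner v u"
    unfolding inner_l2_def
  proof transfer
    fix u v :: "'a \<Rightarrow> complex"
    have "cnj (\<integral>x. cnj (u x) * v x \<partial>lborel) = (\<integral>x. cnj (v x) * u x \<partial>lborel)"
      by (subst Bochner_Integration.integral_cnj[symmetric]) (simp add: mult.commute)
    then show "Re (\<integral>x. cnj (u x) * v x \<partial>lborel) = Re (\<integral>x. cnj (v x) * u x \<partial>lborel)"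
      by (metis cnj.sel(1))
  qed
  show "inner (u + v) w = inner u w + inner v w"
    unfolding inner_l2_def
    by transfer (auto simp: l2_eq_def distrib_right integrable_cnj_mult)
  show "inner (a *\<^sub>R u) v = a * inner u v"
    unfolding inner_l2_def scaleR_l2_def
    by transfer (simp add: mult.assoc)
  have self: "(\<integral>x. cnj (f x) * f x \<partial>lborel) = complex_of_real (\<integral>x. (cmod (f x))\<^sup>2 \<partial>lborel)"
    for f :: "'a \<Rightarrow> complex"
    by (subst integral_complex_of_real[symmetric], rule Bochner_Integration.integral_cong)
      (simp_all only: complex_norm_square mult.commute)
  show "0 \<le> inner u u"
    unfolding inner_l2_def by transfer (simp add: self)
  show "inner u u = 0 \<longleftrightarrow> u = 0"
    unfolding inner_l2_def
  proof transfer
    fix f :: "'a \<Rightarrow> complex"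
    assume "l2_eq f f"
    then have f: "square_integrable f" by (simp add: l2_eq_def)
    then have "(\<integral>x. (cmod (f x))\<^sup>2 \<partial>lborel) = 0 \<longleftrightarrow> (AE x in lborel. (cmod (f x))\<^sup>2 = 0)"
      by (intro integral_nonneg_eq_0_iff_AE) (auto simp: square_integrable_def)
    then show "(Re (\<integral>x. cnj (f x) * f x \<partial>lborel) = 0) = l2_eq f (\<lambda>x. 0)"
      using f square_integrable_zero by (auto simp: l2_eq_def self)
  qed
qed (simp_all add: uniformity_l2_def open_l2_def)

end

definition clinear_op :: "('a::euclidean_space l2 \<Rightarrow> 'a l2) \<Rightarrow> bool" where
  "clinear_op T \<longleftrightarrow> (\<forall>u v. T (u + v) = T u + T v) \<and> (\<forall>c u. T (c *\<^sub>C u) = c *\<^sub>C T u)"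

definition unitary_op :: "('a::euclidean_space l2 \<Rightarrow> 'a l2) \<Rightarrow> bool" where
  "unitary_op T \<longleftrightarrow> clinear_op T \<and> surj T \<and> (\<forall>u v. l2_cinner (T u) (T v) = l2_cinner u v)"

definition is_eigenvector :: "('a::euclidean_space l2 \<Rightarrow> 'a l2) \<Rightarrow> complex \<Rightarrow> 'a l2 \<Rightarrow> bool" where
  "is_eigenvector T \<kappa> u \<longleftrightarrow> u \<noteq> 0 \<and> T u = \<kappa> *\<^sub>C u"

definition point_spectrum :: "('a::euclidean_space l2 \<Rightarrow> 'a l2) \<Rightarrow> complex set" where
  "point_spectrum T = {\<kappa>. \<exists>u. is_eigenvector T \<kappa> u}"

definition resolvent_set :: "('a::euclidean_space l2 \<Rightarrow> 'a l2) \<Rightarrow> complex set" where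
  "resolvent_set T = {\<kappa>. \<exists>R. clinear_op R \<and> bounded_linear R \<and>
     (\<forall>u. R (T u - \<kappa> *\<^sub>C u) = u) \<and> (\<forall>u. T (R u) - \<kappa> *\<^sub>C R u = u)}"

definition spectrum :: "('a::euclidean_space l2 \<Rightarrow> 'a l2) \<Rightarrow> complex set" where
  "spectrum T = - resolvent_set T"

definition vec_cinner :: "complex^'n \<Rightarrow> complex^'n \<Rightarrow> complex" where
  "vec_cinner v z = (\<Sum>j\<in>UNIV. cnj (v $ j) * z $ j)"

definition unitary_matrix :: "complex^'n^'n \<Rightarrow> bool" where
  "unitary_matrix g \<longleftrightarrow>
     map_matrix cnj (transpose g) ** g = mat 1 \<and> g ** map_matrix cnj (transpose g) = mat 1"

definition matrix_eigenvector :: "complex^'n^'n \<Rightarrow> complex \<Rightarrow> complex^'n \<Rightarrow> bool" where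
  "matrix_eigenvector g \<kappa> v \<longleftrightarrow> v \<noteq> 0 \<and> g *v v = \<kappa> *s v"

text \<open>\<open>\<theta>\<close> lists the roots of the characteristic polynomial with their multiplicities.\<close>

definition eigenvalues_with_multiplicity :: "complex^'n^'n \<Rightarrow> ('n \<Rightarrow> complex) \<Rightarrow> bool" where
  "eigenvalues_with_multiplicity g \<theta> \<longleftrightarrow> (\<forall>x. det (mat x - g) = (\<Prod>j\<in>UNIV. x - \<theta> j))"

definition is_basis :: "('n \<Rightarrow> complex^'n) \<Rightarrow> bool" where
  "is_basis v \<longleftrightarrow> inj v \<and> vec.independent (range v) \<and> vec.span (range v) = UNIV"

definition has_irrational_rotation_eigenvalue :: "complex^'n^'n \<Rightarrow> bool" where
  "has_irrational_rotation_eigenvalue g \<longleftrightarrow>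
     (\<exists>\<alpha>::real. \<alpha> \<notin> \<rat> \<and> (\<exists>v. matrix_eigenvector g (exp (2 * of_real pi * \<i> * of_real \<alpha>)) v))"

definition circle_group :: "complex monoid" where
  "circle_group = \<lparr>carrier = sphere 0 1, mult = (*), one = 1\<rparr>"

definition entire_holomorphic :: "(complex^'n \<Rightarrow> complex) \<Rightarrow> bool" where
  "entire_holomorphic F \<longleftrightarrow>
     (\<forall>z. \<exists>D. (F has_derivative D) (at z) \<and> (\<forall>c h. D (c *s h) = c * D h))"

definition segal_bargmann :: "(complex^'n \<Rightarrow> complex) set" where
  "segal_bargmann = {F. entire_holomorphic F \<and>
     integrable lborel (\<lambda>z. (cmod (F z))\<^sup>2 * exp (- pi * (norm z)\<^sup>2))}"

definition segal_bargmann_cinner :: "(complex^'n \<Rightarrow> complex) \<Rightarrow> (complex^'n \<Rightarrow> complex) \<Rightarrow> complex" where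
  "segal_bargmann_cinner F G =
     (\<integral>z. cnj (F z) * G z * of_real (exp (- pi * (norm z)\<^sup>2)) \<partial>lborel)"

lift_definition bargmann :: "(real^'n) l2 \<Rightarrow> complex^'n \<Rightarrow> complex" is
  "\<lambda>u z. of_real (pi powr (- real CARD('n) / 4)) *
     (\<integral>y. u y * exp (of_real (sqrt (2 * pi)) * (\<Sum>j\<in>UNIV. of_real (y $ j) * z $ j)
        - 1 / 2 * of_real (\<Sum>j\<in>UNIV. (y $ j)\<^sup>2)
        - of_real (pi / 2) * (\<Sum>j\<in>UNIV. (z $ j)\<^sup>2)) \<partial>lborel)"
proof -
  fix u v :: "real^'n \<Rightarrow> complex"
  assume a: "l2_eq u v"
  then have [measurable]: "u \<in> borel_measurable borel" "v \<in> borel_measurable borel"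
    by (auto simp: l2_eq_def square_integrable_def)
  have k: "(\<lambda>y. exp (of_real (sqrt (2 * pi)) * (\<Sum>j\<in>UNIV. of_real (y $ j) * z $ j)
        - 1 / 2 * of_real (\<Sum>j\<in>UNIV. (y $ j)\<^sup>2)
        - of_real (pi / 2) * (\<Sum>j\<in>UNIV. (z $ j)\<^sup>2))) \<in> borel_measurable borel"
    for z :: "complex^'n"
    by (intro borel_measurable_continuous_onI continuous_intros)
  show "(\<lambda>z::complex^'n. of_real (pi powr (- real CARD('n) / 4)) *
     (\<integral>y. u y * exp (of_real (sqrt (2 * pi)) * (\<Sum>j\<in>UNIV. of_real (y $ j) * z $ j)
        - 1 / 2 * of_real (\<Sum>j\<in>UNIV. (y $ j)\<^sup>2)
        - of_real (pi / 2) * (\<Sum>j\<in>UNIV. (z $ j)\<^sup>2)) \<partial>lborel)) =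
    (\<lambda>z. of_real (pi powr (- real CARD('n) / 4)) *
     (\<integral>y. v y * exp (of_real (sqrt (2 * pi)) * (\<Sum>j\<in>UNIV. of_real (y $ j) * z $ j)
        - 1 / 2 * of_real (\<Sum>j\<in>UNIV. (y $ j)\<^sup>2)
        - of_real (pi / 2) * (\<Sum>j\<in>UNIV. (z $ j)\<^sup>2)) \<partial>lborel))"
    using a
    by (intro ext arg_cong[where f = "\<lambda>t. _ * t"] integral_cong_AE)
      (auto simp: l2_eq_def intro!: borel_measurable_times k)
qed

text \<open>
  Hilbert space adjoint of \<^const>\<open>bargmann\<close>, as a map from the Segal-Bargmann space to
  \<^typ>\<open>(real^'n) l2\<close>; the value \<open>0\<close> outside \<^const>\<open>segal_bargmann\<close> is a dummy.
\<close>

definition bargmann_adjoint :: "(complex^'n \<Rightarrow> complex) \<Rightarrow> (real^'n) l2" where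
  "bargmann_adjoint F =
     (if F \<in> segal_bargmann
      then THE u. \<forall>w. l2_cinner u w = segal_bargmann_cinner F (bargmann w)
      else 0)"

text \<open>
  In the next two definitions the parameter \<open>s\<close> is the chosen square root of the inverse
  determinant of \<open>g\<close>.
\<close>

definition nu :: "complex \<Rightarrow> complex^'n^'n \<Rightarrow> (complex^'n \<Rightarrow> complex) \<Rightarrow> complex^'n \<Rightarrow> complex" where
  "nu s g F = (\<lambda>z. s * F (matrix_inv g *v z))"

definition metaplectic :: "complex \<Rightarrow> complex^'n^'n \<Rightarrow> (real^'n) l2 \<Rightarrow> (real^'n) l2" where
  "metaplectic s g u = bargmann_adjoint (nu s g (bargmann u))"

end

theory Submission
  imports Defs "HOL-Probability.Characteristic_Functions"
    "HOL-Complex_Analysis.Cauchy_Integral_Formula"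
    "HOL-Computational_Algebra.Fundamental_Theorem_Algebra"
begin

text \<open>
  The Bargmann transform \<open>B\<close> conjugates the metaplectic operator to \<open>\<nu>(g)\<close>, which acts by
  substituting \<open>g\<^sup>-\<^sup>1\<close>. Unitarity of \<open>B\<close> comes from coherent states: they are mapped to the
  reproducing kernels of the Segal-Bargmann space, so \<open>B\<close> is isometric on their span, which is
  dense because a function orthogonal to all of them has vanishing Fourier transform. The
  reproducing property itself is the mean value property, averaged over the rotations \<open>z \<mapsto> e\<^sup>i\<^sup>t z\<close>.

  If \<open>v\<close> is an eigenvector of \<open>g\<close> for \<open>\<theta>\<close>, the linear form \<open>\<langle>v, z\<rangle>\<close> is multiplied by the conjugate of
  \<open>\<theta>\<close>, so products of such forms are eigenfunctions of \<open>\<nu>(g)\<close>. Eigenvectors of \<open>g\<close> span, hence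
  an eigenfunction for any other eigenvalue is orthogonal to all polynomials, and expanding the
  reproducing kernel \<open>exp (\<pi> \<langle>w, z\<rangle>)\<close> in powers of \<open>\<langle>w, z\<rangle>\<close> shows that it vanishes.

  For an irrational rotation the eigenvalues are dense in the circle, and the spectrum is closed.
  If all \<open>\<theta>\<^sub>j\<close> are roots of unity, their products form the group of \<open>r\<close>-th roots of unity for some
  \<open>r\<close>; then \<open>g\<^sup>r = 1\<close>, so the \<open>r\<close>-th power of the operator is scalar and every spectral value is
  an eigenvalue.
\<close>

section \<open>The Hilbert space of square integrable functions\<close>

text \<open>\<open>bargmann_adjoint\<close> is a definite description: it has a meaning at F only if
  some \<open>u\<close> represents the functional w \<mapsto> <F, B w>. The proof therefore hinges
  on B being onto the Segal-Bargmann space. Once it is, \<open>bargmann_adjoint\<close> is the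
  inverse of B, and an identity about \<open>metaplectic\<close> can be checked after applying the
  injective map B, where it is a pointwise identity between functions.

  Surjectivity rests on completeness of \<open>'a l2\<close>, which makes the range closed and
  yields orthogonal projections. The Segal-Bargmann space gets no Hilbert space structure of its
  own: multiplying by exp(-\<pi>|z|^2/2), half of the exponent of the weight, embeds it
  isometrically into the square integrable functions on complex^'n, and all projections happen
  there.

  The spectral part uses no functional calculus. That the spectrum lies on the circle comes from
  Banach's fixed point theorem, the finite case from factoring T^r - \<kappa>^r, and limits of
  eigenvalues are spectral because eigenvectors for nearby eigenvalues contradict a bounded
  resolvent.\<close>

lemma l2_cases:
  obtains f where "square_integrable f" "u = abs_l2 f"
  using Quotient_abs_rep[OF Quotient_l2] Quotient_rep_reflp[OF Quotient_l2]
  by (metis l2_eq_def)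

lemma l2_eq_refl: "square_integrable f \<Longrightarrow> l2_eq f f"
  by (simp add: l2_eq_def)

lemma abs_l2_eq_iff:
  "square_integrable f \<Longrightarrow> square_integrable g \<Longrightarrow>
    abs_l2 f = abs_l2 g \<longleftrightarrow> (AE x in lborel. f x = g x)"
  using Quotient_rel[OF Quotient_l2, of f g] by (auto simp: l2_eq_def)

lemma abs_l2_add:
  "square_integrable f \<Longrightarrow> square_integrable g \<Longrightarrow> abs_l2 f + abs_l2 g = abs_l2 (\<lambda>x. f x + g x)"
  by (simp add: plus_l2.abs_eq l2_eq_refl)

lemma abs_l2_scaleC: "square_integrable f \<Longrightarrow> c *\<^sub>C abs_l2 f = abs_l2 (\<lambda>x. c * f x)"
  by (simp add: scaleC.abs_eq l2_eq_refl)

lemma square_integrable_diff: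
  "square_integrable f \<Longrightarrow> square_integrable g \<Longrightarrow> square_integrable (\<lambda>x. f x - g x)"
  using square_integrable_add[of f "\<lambda>x. (-1) * g x"] square_integrable_scale[of g "-1"] by simp

lemma abs_l2_diff:
  "square_integrable f \<Longrightarrow> square_integrable g \<Longrightarrow> abs_l2 f - abs_l2 g = abs_l2 (\<lambda>x. f x - g x)"
  using square_integrable_scale[of g "-1"]
  by (simp add: minus_l2_def abs_l2_scaleC abs_l2_add)

lemma abs_l2_cinner:
  "square_integrable f \<Longrightarrow> square_integrable g \<Longrightarrow>
    l2_cinner (abs_l2 f) (abs_l2 g) = (\<integral>x. cnj (f x) * g x \<partial>lborel)"
  by (simp add: l2_cinner.abs_eq l2_eq_refl)

lemma integral_cnj_mult_self:
  "(\<integral>x. cnj (f x) * f x \<partial>M) = complex_of_real (\<integral>x. (cmod (f x))\<^sup>2 \<partial>M)"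
  by (subst integral_complex_of_real[symmetric], rule Bochner_Integration.integral_cong)
    (simp_all only: complex_norm_square mult.commute)

lemma norm_abs_l2: "square_integrable f \<Longrightarrow> (norm (abs_l2 f))\<^sup>2 = (\<integral>x. (cmod (f x))\<^sup>2 \<partial>lborel)"
  by (simp add: power2_norm_eq_inner inner_l2_def abs_l2_cinner integral_cnj_mult_self)

lemma nn_integral_abs_l2:
  assumes "square_integrable f"
  shows "(\<integral>\<^sup>+x. ennreal ((cmod (f x))\<^sup>2) \<partial>lborel) = ennreal ((norm (abs_l2 f))\<^sup>2)"
  using assms by (simp add: norm_abs_l2 nn_integral_eq_integral square_integrable_def)

lemma square_integrableI_bounded:
  assumes "f \<in> borel_measurable lborel" "(\<integral>\<^sup>+x. ennreal ((cmod (f x))\<^sup>2) \<partial>lborel) < \<infinity>"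
  shows "square_integrable f"
  using assms by (auto simp: square_integrable_def integrable_iff_bounded)

lemma l2_cinner_add_left: "l2_cinner (u + v) w = l2_cinner u w + l2_cinner v w"
  by (cases u rule: l2_cases, cases v rule: l2_cases, cases w rule: l2_cases)
    (simp add: abs_l2_add abs_l2_cinner square_integrable_add distrib_right integrable_cnj_mult)

lemma l2_cinner_add_right: "l2_cinner w (u + v) = l2_cinner w u + l2_cinner w v"
  by (cases u rule: l2_cases, cases v rule: l2_cases, cases w rule: l2_cases)
    (simp add: abs_l2_add abs_l2_cinner square_integrable_add distrib_left integrable_cnj_mult)

lemma l2_cinner_scaleC_left: "l2_cinner (c *\<^sub>C u) w = cnj c * l2_cinner u w"
  by (cases u rule: l2_cases, cases w rule: l2_cases)
    (simp add: abs_l2_scaleC abs_l2_cinner square_integrable_scale mult.assoc)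

lemma l2_cinner_scaleC_right: "l2_cinner w (c *\<^sub>C u) = c * l2_cinner w u"
  by (cases u rule: l2_cases, cases w rule: l2_cases)
    (simp add: abs_l2_scaleC abs_l2_cinner square_integrable_scale mult.left_commute)

lemma l2_cinner_commute: "l2_cinner v u = cnj (l2_cinner u v)"
  by (cases u rule: l2_cases, cases v rule: l2_cases)
    (simp add: abs_l2_cinner mult.commute flip: Bochner_Integration.integral_cnj)

lemma scaleR_scaleC: "r *\<^sub>R u = complex_of_real r *\<^sub>C u"
  by (simp add: scaleR_l2_def)

lemma l2_cinner_diff_left: "l2_cinner (u - v) w = l2_cinner u w - l2_cinner v w"
  by (simp add: minus_l2_def l2_cinner_add_left l2_cinner_scaleC_left)

lemma l2_cinner_diff_right: "l2_cinner w (u - v) = l2_cinner w u - l2_cinner w v"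
  by (simp add: minus_l2_def l2_cinner_add_right l2_cinner_scaleC_right)

lemma l2_cinner_self: "l2_cinner u u = complex_of_real ((norm u)\<^sup>2)"
  by (cases u rule: l2_cases) (simp add: abs_l2_cinner norm_abs_l2 integral_cnj_mult_self)

lemma l2_cinner_zero [simp]: "l2_cinner 0 u = 0" "l2_cinner u 0 = 0"
  using l2_cinner_diff_left[of u u u] l2_cinner_diff_right[of u u u] l2_cinner_diff_left[of 0 0 u]
    l2_cinner_diff_right[of u 0 0] by auto

lemma scaleC_add_right: "c *\<^sub>C (u + v) = c *\<^sub>C u + c *\<^sub>C v"
  by (cases u rule: l2_cases, cases v rule: l2_cases)
    (simp add: abs_l2_add abs_l2_scaleC square_integrable_scale square_integrable_add distrib_left)

lemma scaleC_add_left: "(b + c) *\<^sub>C u = b *\<^sub>C u + c *\<^sub>C u"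
  by (cases u rule: l2_cases)
    (simp add: abs_l2_add abs_l2_scaleC square_integrable_scale distrib_right)

lemma scaleC_scaleC [simp]: "b *\<^sub>C c *\<^sub>C u = (b * c) *\<^sub>C u"
  by (cases u rule: l2_cases) (simp add: abs_l2_scaleC square_integrable_scale mult.assoc)

lemma scaleC_one [simp]: "1 *\<^sub>C u = u"
  by (cases u rule: l2_cases) (simp add: abs_l2_scaleC)

lemma scaleC_zero [simp]: "0 *\<^sub>C u = 0" "c *\<^sub>C 0 = 0"
  using scaleC_add_left[of 0 0 u] scaleC_add_right[of c 0 0] by auto

lemma scaleC_diff_right: "c *\<^sub>C (u - v) = c *\<^sub>C u - c *\<^sub>C v"
  by (simp add: minus_l2_def scaleC_add_right)

lemma scaleC_diff_left: "(b - c) *\<^sub>C u = b *\<^sub>C u - c *\<^sub>C u"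
  using scaleC_add_left[of "b - c" c u] by simp

lemma norm_scaleC [simp]: "norm (c *\<^sub>C u) = cmod c * norm u"
proof -
  have "(norm (c *\<^sub>C u))\<^sup>2 = (cmod c * norm u)\<^sup>2"
    by (cases u rule: l2_cases)
      (simp add: abs_l2_scaleC norm_abs_l2 square_integrable_scale norm_mult power_mult_distrib)
  then show ?thesis
    by (simp add: power2_eq_iff_nonneg)
qed

text \<open>The real inner product is only the real part of \<open>l2_cinner\<close>. Multiplying
  \<open>u\<close> by the phase \<open>a\<close> of the product makes the product real and leaves
  the norm of \<open>u\<close> unchanged, so the real inequality suffices.\<close>

lemma l2_cinner_Cauchy_Schwarz: "cmod (l2_cinner u v) \<le> norm u * norm v"
proof (cases "l2_cinner u v = 0")
  case False
  define a where "a = sgn (l2_cinner u v)"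
  have "cnj a * l2_cinner u v = complex_of_real (cmod (l2_cinner u v))"
    using False by (simp add: a_def sgn_div_norm scaleR_conv_of_real divide_inverse)
      (metis (no_types, lifting) complex_norm_square mult.commute nonzero_mult_div_cancel_left
        divide_inverse mult.assoc norm_eq_zero of_real_eq_0_iff power2_eq_square of_real_mult)
  then have "cmod (l2_cinner u v) = inner (a *\<^sub>C u) v"
    by (simp add: inner_l2_def l2_cinner_scaleC_left)
  also have "\<dots> \<le> norm (a *\<^sub>C u) * norm v"
    by (rule norm_cauchy_schwarz)
  also have "\<dots> = norm u * norm v"
    using False by (simp add: a_def norm_sgn)
  finally show ?thesis .
qed simp

lemma bounded_linear_l2_cinner_right: "bounded_linear (l2_cinner u)"
proof (rule bounded_linear_intro[where K = "norm u"])
  show "l2_cinner u (r *\<^sub>R v) = r *\<^sub>R l2_cinner u v" for r v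
    by (simp add: scaleR_scaleC l2_cinner_scaleC_right scaleR_conv_of_real)
  show "norm (l2_cinner u v) \<le> norm v * norm u" for v
    using l2_cinner_Cauchy_Schwarz[of u v] by (simp add: mult.commute)
qed (rule l2_cinner_add_right)

lemma l2_orthogonal_imp_zero: "(\<And>w. l2_cinner w u = 0) \<Longrightarrow> u = 0"
  using l2_cinner_self[of u] by simp

lemma l2_cinner_cancel_right: "(\<And>w. l2_cinner w u = l2_cinner w v) \<Longrightarrow> u = v"
  using l2_orthogonal_imp_zero[of "u - v"] by (simp add: l2_cinner_diff_right)

lemma l2_cinner_cancel_left: "(\<And>w. l2_cinner u w = l2_cinner v w) \<Longrightarrow> u = v"
  by (rule l2_cinner_cancel_right) (metis l2_cinner_commute)

subsection \<open>Completeness\<close>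

lemma strict_mono_fast_subseq:
  fixes X :: "nat \<Rightarrow> 'a::metric_space" and e :: "nat \<Rightarrow> real"
  assumes "Cauchy X" and e: "\<And>k. e k > 0"
  obtains r where "strict_mono r" "\<And>k m. m \<ge> r k \<Longrightarrow> dist (X m) (X (r k)) < e k"
proof -
  have "\<exists>N. \<forall>m\<ge>N. \<forall>n\<ge>N. dist (X m) (X n) < e k" for k
    using assms(1) e[of k] unfolding Cauchy_def by blast
  then obtain N where N: "\<And>k m n. m \<ge> N k \<Longrightarrow> n \<ge> N k \<Longrightarrow> dist (X m) (X n) < e k"
    by metis
  \<comment> \<open>The partial sum dominates \<open>N k\<close>, and the added \<open>k\<close>
    makes the sequence strictly increasing even where \<open>N\<close> vanishes.\<close>
  define r where "r k = (\<Sum>i\<le>k. N i) + k" for k :: nat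
  have "strict_mono r"
    by (rule strict_monoI_Suc) (simp add: r_def)
  moreover have "N k \<le> r k" for k
    using member_le_sum[of k "{..k}" N] by (simp add: r_def)
  then have "dist (X m) (X (r k)) < e k" if "m \<ge> r k" for k m
    using N[of k m "r k"] that by (meson le_trans)
  ultimately show ?thesis
    using that by blast
qed

lemma l2_cinner_self_eqD:
  assumes "l2_cinner u u = l2_cinner v v"
  shows "norm u = norm v"
proof -
  have "(norm u)\<^sup>2 = (norm v)\<^sup>2"
    using assms by (simp only: l2_cinner_self of_real_eq_iff)
  then show ?thesis
    by (simp add: power2_eq_iff_nonneg)
qed

text \<open>The weights \<open>4 ^ k\<close> are small enough for the weighted squared increments to
  keep a finite total integral (4/8 = 1/2), and large enough that a finite weighted sum C at a point
  bounds the k-th increment there by sqrt C / 2^k. Hence the increments are summable almost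
  everywhere.\<close>

lemma fast_Cauchy_AE_convergent:
  fixes f :: "nat \<Rightarrow> 'a \<Rightarrow> complex"
  assumes [measurable]: "\<And>k. f k \<in> borel_measurable M"
    and fast: "\<And>k. (\<integral>\<^sup>+x. ennreal ((cmod (f (Suc k) x - f k x))\<^sup>2) \<partial>M) \<le> ennreal ((1/8) ^ k)"
  shows "AE x in M. convergent (\<lambda>k. f k x)"
proof -
  define h where "h k x = ennreal (4 ^ k * (cmod (f (Suc k) x - f k x))\<^sup>2)" for k x
  have [measurable]: "h k \<in> borel_measurable M" for k
    unfolding h_def by measurable
  have hk: "(\<integral>\<^sup>+x. h k x \<partial>M) \<le> ennreal ((1/2) ^ k)" for k
  proof -
    have "(\<integral>\<^sup>+x. h k x \<partial>M) = ennreal (4 ^ k) * (\<integral>\<^sup>+x. ennreal ((cmod (f (Suc k) x - f k x))\<^sup>2) \<partial>M)"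
      unfolding h_def by (subst nn_integral_cmult[symmetric]) (auto simp: ennreal_mult)
    also have "\<dots> \<le> ennreal (4 ^ k) * ennreal ((1/8) ^ k)"
      by (intro mult_left_mono fast) simp
    also have "\<dots> = ennreal ((1/2) ^ k)"
      by (simp add: ennreal_mult[symmetric] power_mult_distrib[symmetric])
    finally show ?thesis .
  qed
  have "(\<integral>\<^sup>+x. (\<Sum>k. h k x) \<partial>M) = (\<Sum>k. \<integral>\<^sup>+x. h k x \<partial>M)"
    by (rule nn_integral_suminf) simp
  also have "\<dots> \<le> (\<Sum>k. ennreal ((1/2) ^ k))"
    by (intro suminf_le hk) auto
  also have "\<dots> = ennreal 2"
    using suminf_geometric[of "1/2::real"]
    by (subst suminf_ennreal2) (auto simp: summable_geometric)
  finally have "(\<integral>\<^sup>+x. (\<Sum>k. h k x) \<partial>M) \<noteq> \<infinity>"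
    by (auto simp: top_unique)
  then have "AE x in M. (\<Sum>k. h k x) \<noteq> \<infinity>"
    by (intro nn_integral_PInf_AE) auto
  then show ?thesis
  proof eventually_elim
    case (elim x)
    define C where "C = enn2real (\<Sum>k. h k x)"
    have C: "ennreal C = (\<Sum>k. h k x)" "C \<ge> 0"
      using elim by (auto simp: C_def less_top)
    have "cmod (f (Suc k) x - f k x) \<le> sqrt C * (1/2) ^ k" for k
    proof -
      have "h k x \<le> ennreal C"
        using sum_le_suminf[of "\<lambda>k. h k x" "{k}"] by (simp add: C)
      then have "4 ^ k * (cmod (f (Suc k) x - f k x))\<^sup>2 \<le> C"
        unfolding h_def by (simp only: ennreal_le_iff[OF C(2)])
      moreover have "(2 ^ k * cmod (f (Suc k) x - f k x))\<^sup>2 = 4 ^ k * (cmod (f (Suc k) x - f k x))\<^sup>2"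
        by (simp add: power_mult_distrib power2_eq_square[of "2 ^ k"]) (simp flip: power_mult_distrib)
      ultimately have "(2 ^ k * cmod (f (Suc k) x - f k x))\<^sup>2 \<le> C"
        by simp
      then have "2 ^ k * cmod (f (Suc k) x - f k x) \<le> sqrt C"
        by (rule real_le_rsqrt)
      then show ?thesis
        by (simp add: field_simps)
    qed
    then have "summable (\<lambda>k. f (Suc k) x - f k x)"
      by (rule summable_comparison_test'[where N = 0, rotated])
        (intro summable_mult summable_geometric, simp)
    then have "convergent (\<lambda>n. \<Sum>k<n. f (Suc k) x - f k x)"
      by (simp add: summable_iff_convergent)
    then have "convergent (\<lambda>n. f n x - f 0 x)"
      by (simp only: sum_lessThan_telescope[of "\<lambda>n. f n x"])
    then obtain L where "(\<lambda>n. f n x - f 0 x) \<longlonglongrightarrow> L"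
      by (auto simp: convergent_def)
    then have "(\<lambda>n. f n x - f 0 x + f 0 x) \<longlonglongrightarrow> L + f 0 x"
      by (intro tendsto_intros)
    then show ?case
      by (auto simp: convergent_def)
  qed
qed

text \<open>Riesz-Fischer: a subsequence with geometric rate converges almost everywhere, Fatou's
  lemma bounds the distance to the pointwise limit, and a Cauchy sequence follows its
  subsequence.\<close>

lemma l2_Cauchy_convergent:
  fixes X :: "nat \<Rightarrow> 'a::euclidean_space l2"
  assumes "Cauchy X"
  shows "convergent X"
proof -
  \<comment> \<open>The rate 1/3 for the norms squares to 1/9, within the 1/8 that almost everywhere
    convergence asks for.\<close>
  obtain r where r: "strict_mono r"
    and rd: "\<And>k m. m \<ge> r k \<Longrightarrow> dist (X m) (X (r k)) < (1/3) ^ k"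
    using strict_mono_fast_subseq[OF assms, of "\<lambda>k. (1/3) ^ k"] by auto
  have "\<exists>f. square_integrable f \<and> X (r k) = abs_l2 f" for k
    by (metis l2_cases)
  then obtain f where f: "\<And>k. square_integrable (f k)" and Xf: "\<And>k. X (r k) = abs_l2 (f k)"
    by metis
  have [measurable]: "f k \<in> borel_measurable borel" for k
    using f[of k] by (simp add: square_integrable_def)
  have nn: "(\<integral>\<^sup>+x. ennreal ((cmod (f m x - f k x))\<^sup>2) \<partial>lborel) \<le> ennreal ((1/9) ^ k)"
    if "m \<ge> k" for k m
  proof -
    have "norm (X (r m) - X (r k)) \<le> (1/3) ^ k"
      using rd[of k "r m"] r that by (simp add: dist_norm strict_mono_less_eq)
    then have "(norm (X (r m) - X (r k)))\<^sup>2 \<le> ((1/3) ^ k)\<^sup>2"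
      by (intro power_mono) auto
    also have "\<dots> = (1/9) ^ k"
      by (simp add: power2_eq_square flip: power_mult_distrib)
    finally show ?thesis
      using f by (simp add: Xf abs_l2_diff nn_integral_abs_l2 square_integrable_diff)
  qed
  have "(\<integral>\<^sup>+x. ennreal ((cmod (f (Suc k) x - f k x))\<^sup>2) \<partial>lborel) \<le> ennreal ((1/8) ^ k)" for k
    by (rule order_trans[OF nn]) (auto intro!: ennreal_leI power_mono)
  then have conv: "AE x in lborel. convergent (\<lambda>k. f k x)"
    by (intro fast_Cauchy_AE_convergent) simp_all
  \<comment> \<open>\<open>lim\<close> is total, so \<open>F\<close> is defined and measurable
    everywhere; the points where no limit exists form a null set.\<close>
  define F where "F x = lim (\<lambda>k. f k x)" for x
  have [measurable]: "F \<in> borel_measurable borel"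
    unfolding F_def by measurable
  have Fk: "(\<integral>\<^sup>+x. ennreal ((cmod (F x - f k x))\<^sup>2) \<partial>lborel) \<le> ennreal ((1/9) ^ k)" for k
  proof -
    have "(\<integral>\<^sup>+x. ennreal ((cmod (F x - f k x))\<^sup>2) \<partial>lborel) =
      (\<integral>\<^sup>+x. liminf (\<lambda>m. ennreal ((cmod (f m x - f k x))\<^sup>2)) \<partial>lborel)"
    proof (rule nn_integral_cong_AE, use conv in eventually_elim)
      case (elim x)
      then have "(\<lambda>m. f m x) \<longlonglongrightarrow> F x"
        by (simp add: F_def convergent_LIMSEQ_iff)
      then have "(\<lambda>m. ennreal ((cmod (f m x - f k x))\<^sup>2)) \<longlonglongrightarrow> ennreal ((cmod (F x - f k x))\<^sup>2)"
        by (intro tendsto_intros)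
      then show ?case
        by (subst lim_imp_Liminf[of sequentially]) auto
    qed
    also have "\<dots> \<le> liminf (\<lambda>m. \<integral>\<^sup>+x. ennreal ((cmod (f m x - f k x))\<^sup>2) \<partial>lborel)"
      by (rule nn_integral_liminf) simp
    also have "\<dots> \<le> limsup (\<lambda>m. \<integral>\<^sup>+x. ennreal ((cmod (f m x - f k x))\<^sup>2) \<partial>lborel)"
      by (rule Liminf_le_Limsup) simp
    also have "\<dots> \<le> ennreal ((1/9) ^ k)"
      using nn by (intro Limsup_bounded) (auto simp: eventually_sequentially)
    finally show ?thesis .
  qed
  have sqd: "square_integrable (\<lambda>x. F x - f k x)" for k
    using Fk[of k] by (intro square_integrableI_bounded) (auto simp: less_top[symmetric] top_unique)
  have sq: "square_integrable F"
    using square_integrable_add[OF sqd[of 0] f[of 0]] by simp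
  have le: "norm (abs_l2 F - X (r k)) \<le> (1/3) ^ k" for k
  proof -
    have "ennreal ((norm (abs_l2 F - X (r k)))\<^sup>2) \<le> ennreal ((1/9) ^ k)"
      using Fk[of k] sq f sqd[of k] by (simp add: Xf abs_l2_diff nn_integral_abs_l2)
    then have "(norm (abs_l2 F - X (r k)))\<^sup>2 \<le> (1/9) ^ k"
      by simp
    also have "\<dots> = ((1/3::real) ^ k)\<^sup>2"
      by (simp add: power2_eq_square flip: power_mult_distrib)
    finally show ?thesis
      by (rule power2_le_imp_le) simp
  qed
  have "(\<lambda>k. abs_l2 F - X (r k)) \<longlonglongrightarrow> 0"
  proof (rule Lim_null_comparison)
    show "\<forall>\<^sub>F k in sequentially. norm (abs_l2 F - X (r k)) \<le> (1/3) ^ k"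
      using le by simp
    show "(\<lambda>k. (1/3::real) ^ k) \<longlonglongrightarrow> 0"
      by (rule LIMSEQ_realpow_zero) auto
  qed
  then have "(\<lambda>k. abs_l2 F - (abs_l2 F - X (r k))) \<longlonglongrightarrow> abs_l2 F - 0"
    by (rule tendsto_diff[OF tendsto_const])
  then have "(X \<circ> r) \<longlonglongrightarrow> abs_l2 F"
    by (simp add: o_def)
  then have "X \<longlonglongrightarrow> abs_l2 F"
    by (rule Cauchy_converges_subseq[OF assms r])
  then show ?thesis
    unfolding convergent_def by blast
qed

instance l2 :: (euclidean_space) complete_space
  by standard (rule l2_Cauchy_convergent)

text \<open>A minimising sequence for the distance to \<open>S\<close> is Cauchy by the
  parallelogram law, because midpoints stay in \<open>S\<close> and cannot be closer than the
  infimum. Moving its limit along a direction of \<open>S\<close> cannot shorten the distance, which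
  forces orthogonality.\<close>

lemma orthogonal_projection_exists:
  fixes S :: "'a::{real_inner, complete_space} set"
  assumes "subspace S" "closed S"
  obtains p where "p \<in> S" "\<And>y. y \<in> S \<Longrightarrow> inner (x - p) y = 0"
proof -
  define d where "d = infdist x S"
  have ne: "S \<noteq> {}"
    using assms(1) subspace_0 by blast
  have d_le: "d \<le> norm (x - y)" if "y \<in> S" for y
    using infdist_le[OF that, of x] by (simp add: d_def dist_norm)
  have "\<exists>y\<in>S. norm (x - y) < d + e" if "e > 0" for e
    using cInf_lessD[of "dist x ` S" "d + e"] that ne
    by (auto simp: d_def dist_norm infdist_notempty)
  then have "\<exists>y\<in>S. norm (x - y) < d + 1 / real (Suc n)" for n
    by simp
  then obtain Y where YS: "\<And>n. Y n \<in> S" and Yd: "\<And>n. norm (x - Y n) < d + 1 / real (Suc n)"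
    by metis
  have d0: "d \<ge> 0"
    by (simp add: d_def infdist_nonneg)
  \<comment> \<open>In the parallelogram identity the terms d^2 cancel. Only the excess of the two
    squared distances over d^2 remains, at most (2 d + 1) / (N + 1) each.\<close>
  have par: "(dist (Y m) (Y n))\<^sup>2 \<le> 4 * (2 * d + 1) / real (Suc N)" if "m \<ge> N" "n \<ge> N" for m n N
  proof -
    have sq: "(norm (x - Y k))\<^sup>2 \<le> d\<^sup>2 + (2 * d + 1) / real (Suc N)" if "k \<ge> N" for k
    proof -
      define e where "e = 1 / real (Suc N)"
      have e: "0 \<le> e" "e \<le> 1"
        by (auto simp: e_def)
      have "1 / real (Suc k) \<le> e"
        using that by (simp add: e_def frac_le)
      then have "norm (x - Y k) \<le> d + e"
        using Yd[of k] by linarith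
      then have "(norm (x - Y k))\<^sup>2 \<le> (d + e)\<^sup>2"
        by (intro power_mono) auto
      also have "\<dots> = d\<^sup>2 + 2 * d * e + e * e"
        by (simp add: power2_eq_square algebra_simps)
      also have "\<dots> \<le> d\<^sup>2 + (2 * d + 1) * e"
        using mult_left_le[OF e(2) e(1)] by (simp add: algebra_simps)
      finally show ?thesis
        by (simp add: e_def)
    qed
    have mid: "(1/2) *\<^sub>R (Y m + Y n) \<in> S"
      using assms(1) YS by (simp add: subspace_add subspace_mul)
    have "d \<le> norm (x - (1/2) *\<^sub>R (Y m + Y n))"
      by (rule d_le[OF mid])
    then have "d\<^sup>2 \<le> (norm (x - (1/2) *\<^sub>R (Y m + Y n)))\<^sup>2"
      using d0 by (intro power_mono) auto
    moreover have "(dist (Y m) (Y n))\<^sup>2 = 2 * (norm (x - Y m))\<^sup>2 + 2 * (norm (x - Y n))\<^sup>2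
        - 4 * (norm (x - (1/2) *\<^sub>R (Y m + Y n)))\<^sup>2"
      by (simp add: dist_norm power2_norm_eq_inner inner_diff_left inner_diff_right
          inner_add_left inner_add_right inner_commute algebra_simps)
    ultimately show ?thesis
      using sq[OF that(1)] sq[OF that(2)] by (simp add: add_divide_distrib)
  qed
  have "Cauchy Y"
  proof (rule metric_CauchyI)
    fix e :: real assume "e > 0"
    have "(\<lambda>N. 4 * (2 * d + 1) * (1 / real (Suc N))) \<longlonglongrightarrow> 4 * (2 * d + 1) * 0"
      by (intro tendsto_intros LIMSEQ_Suc[OF lim_1_over_n])
    then have "\<forall>\<^sub>F N in sequentially. 4 * (2 * d + 1) * (1 / real (Suc N)) < e\<^sup>2"
      using \<open>e > 0\<close> by (intro order_tendstoD) auto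
    then obtain N where N: "4 * (2 * d + 1) * (1 / real (Suc N)) < e\<^sup>2"
      by (auto simp: eventually_sequentially)
    have "dist (Y m) (Y n) < e" if "m \<ge> N" "n \<ge> N" for m n
    proof (rule power2_less_imp_less)
      show "(dist (Y m) (Y n))\<^sup>2 < e\<^sup>2"
        using par[OF that] N by simp
    qed (use \<open>e > 0\<close> in auto)
    then show "\<exists>M. \<forall>m\<ge>M. \<forall>n\<ge>M. dist (Y m) (Y n) < e"
      by blast
  qed
  then obtain p where p: "Y \<longlonglongrightarrow> p"
    by (auto simp: Cauchy_convergent_iff convergent_def)
  have pS: "p \<in> S"
    using closed_sequentially[OF assms(2) _ p] YS by blast
  have "(\<lambda>n. norm (x - Y n)) \<longlonglongrightarrow> norm (x - p)"
    by (intro tendsto_intros p)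
  moreover have "(\<lambda>n. d + 1 / real (Suc n)) \<longlonglongrightarrow> d + 0"
    by (intro tendsto_intros LIMSEQ_Suc[OF lim_1_over_n])
  ultimately have "norm (x - p) \<le> d + 0"
    by (rule LIMSEQ_le) (use Yd less_imp_le in blast)
  then have pd: "norm (x - p) \<le> d"
    by simp
  have "inner (x - p) y = 0" if "y \<in> S" for y
  proof (cases "y = 0")
    case False
    \<comment> \<open>The minimiser of the quadratic polynomial t \<mapsto> |x - p - t y|^2.\<close>
    define t where "t = inner (x - p) y / (norm y)\<^sup>2"
    have "p + t *\<^sub>R y \<in> S"
      using assms(1) pS that by (simp add: subspace_add subspace_mul)
    then have "norm (x - p) \<le> norm (x - (p + t *\<^sub>R y))"
      using d_le pd by (meson order_trans)
    then have "(norm (x - p))\<^sup>2 \<le> (norm ((x - p) - t *\<^sub>R y))\<^sup>2"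
      by (intro power_mono) (auto simp: algebra_simps)
    also have "\<dots> = (norm (x - p))\<^sup>2 - 2 * t * inner (x - p) y + t\<^sup>2 * (norm y)\<^sup>2"
      by (simp only: power2_norm_eq_inner inner_diff_left[of "x - p"] inner_diff_right[of _ "x - p"]
          inner_scaleR_left inner_scaleR_right inner_commute[of y "x - p"])
        (simp add: power2_eq_square algebra_simps)
    also have "\<dots> = (norm (x - p))\<^sup>2 - (inner (x - p) y)\<^sup>2 / (norm y)\<^sup>2"
      using False by (simp add: t_def power2_eq_square)
    finally show ?thesis
      using False by (simp add: divide_le_0_iff)
  qed simp
  with pS that show ?thesis by blast
qed

section \<open>Lebesgue measure and Gaussian integrals\<close>

lemma lborel_prod_integral:
  fixes f :: "'a::euclidean_space \<Rightarrow> real \<Rightarrow> 'b::{real_normed_field, banach, second_countable_topology}"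
  assumes int: "\<And>b. b \<in> Basis \<Longrightarrow> integrable lborel (f b)"
  shows "integrable lborel (\<lambda>x::'a. \<Prod>b\<in>Basis. f b (x \<bullet> b))" (is ?int)
    and "(\<integral>x. (\<Prod>b\<in>Basis. f b (x \<bullet> b)) \<partial>(lborel :: 'a measure)) = (\<Prod>b\<in>Basis. \<integral>t. f b t \<partial>lborel)" (is ?eq)
proof -
  interpret product_sigma_finite "\<lambda>_::'a. lborel :: real measure" ..
  let ?T = "\<lambda>g. \<Sum>b\<in>Basis. g b *\<^sub>R (b::'a)"
  have [measurable]: "f b \<in> borel_measurable borel" if "b \<in> Basis" for b
    using int[OF that] by auto
  have F: "(\<lambda>x::'a. \<Prod>b\<in>Basis. f b (x \<bullet> b)) \<in> borel_measurable borel"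
    by measurable
  have T: "?T \<in> measurable (\<Pi>\<^sub>M b\<in>Basis. lborel) borel"
    by measurable
  have FT: "(\<lambda>g. \<Prod>b\<in>Basis. f b (?T g \<bullet> b)) = (\<lambda>g. \<Prod>b\<in>Basis. f b (g b))"
    by (rule ext) (auto intro!: prod.cong)
  show ?int
    by (subst lborel_eq, subst integrable_distr_eq[OF T F], subst FT)
      (intro product_integrable_prod int; simp)
  show ?eq
    by (subst lborel_eq, subst integral_distr[OF T F], subst FT)
      (intro product_integral_prod int; simp)
qed

lemma sum_Basis_power2: "(\<Sum>b\<in>Basis. (x \<bullet> b)\<^sup>2) = (norm x)\<^sup>2" for x :: "'a::euclidean_space"
  by (subst power2_norm_eq_inner, subst euclidean_inner) (simp add: power2_eq_square)

lemma exp_minus_norm_power2: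
  "exp (- c * (norm x)\<^sup>2) = (\<Prod>b\<in>Basis. exp (- c * (x \<bullet> b)\<^sup>2))" for x :: "'a::euclidean_space"
  by (simp only: exp_sum[OF finite_Basis, symmetric] sum_distrib_left[symmetric] sum_Basis_power2)

text \<open>The real part of \<open>b\<close> is removed by completing the square; the imaginary
  part is a frequency and is handled by the characteristic function of the normal distribution. The
  substitution y = \<beta>/2 + x / sqrt 2 serves both purposes.\<close>

lemma Gaussian_1d:
  fixes b :: complex
  shows "has_bochner_integral lborel (\<lambda>y::real. exp (- of_real (y\<^sup>2) + b * of_real y))
    (of_real (sqrt pi) * exp (b\<^sup>2 / 4))"
proof -
  define \<beta> \<tau> where "\<beta> = Re b" and "\<tau> = Im b"
  have b: "b = of_real \<beta> + \<i> * of_real \<tau>"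
    by (simp add: \<beta>_def \<tau>_def complex_eq_iff)
  have int: "integrable lborel (\<lambda>x. std_normal_density x *\<^sub>R iexp (\<tau> / sqrt 2 * x))"
  proof (rule Bochner_Integration.integrable_bound)
    show "integrable lborel std_normal_density"
      by simp
  qed (auto simp: normal_density_nonneg)
  have "(CLINT x | std_normal_distribution. iexp (\<tau> / sqrt 2 * x)) =
      (\<integral>x. std_normal_density x *\<^sub>R iexp (\<tau> / sqrt 2 * x) \<partial>lborel)"
    by (rule integral_density) (auto simp: normal_density_nonneg)
  then have "(\<integral>x. std_normal_density x *\<^sub>R iexp (\<tau> / sqrt 2 * x) \<partial>lborel)
      = complex_of_real (exp (- ((\<tau> / sqrt 2)\<^sup>2) / 2))"
    using fun_cong[OF char_std_normal_distribution, of "\<tau> / sqrt 2"]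
    by (simp only: char_def)
  with int have hb: "has_bochner_integral lborel (\<lambda>x. std_normal_density x *\<^sub>R iexp (\<tau> / sqrt 2 * x))
      (complex_of_real (exp (- (\<tau>\<^sup>2 / 4))))"
    by (simp add: has_bochner_integral_iff power_divide)
  \<comment> \<open>\<open>C\<close> cancels the factor 1 / sqrt (2 pi) of the normal density and
    collects the part of the exponent that is free of x after the substitution.\<close>
  define C where "C = complex_of_real (sqrt (2 * pi)) * exp (of_real (\<beta>\<^sup>2 / 4) + \<i> * of_real (\<tau> * \<beta> / 2))"
  have "has_bochner_integral lborel (\<lambda>x. C * (std_normal_density x *\<^sub>R iexp (\<tau> / sqrt 2 * x)))
      (C * complex_of_real (exp (- (\<tau>\<^sup>2 / 4))))"
    by (rule has_bochner_integral_mult_right) (use hb in auto)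
  also have "(\<lambda>x. C * (std_normal_density x *\<^sub>R iexp (\<tau> / sqrt 2 * x))) =
     (\<lambda>x. exp (- of_real ((\<beta>/2 + 1 / sqrt 2 * x)\<^sup>2) + b * of_real (\<beta>/2 + 1 / sqrt 2 * x)))"
  proof
    fix x :: real
    have re: "- ((\<beta>/2 + 1 / sqrt 2 * x)\<^sup>2) + \<beta> * (\<beta>/2 + 1 / sqrt 2 * x) = \<beta>\<^sup>2 / 4 - x\<^sup>2 / 2"
      by (simp add: power2_eq_square field_simps)
    have "C * (std_normal_density x *\<^sub>R iexp (\<tau> / sqrt 2 * x)) =
      exp (of_real (\<beta>\<^sup>2 / 4) + \<i> * of_real (\<tau> * \<beta> / 2)) * (of_real (exp (- x\<^sup>2 / 2)) * iexp (\<tau> / sqrt 2 * x))"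
      by (simp add: C_def normal_density_def scaleR_conv_of_real mult.commute mult.left_commute)
    also have "\<dots> = exp (of_real (\<beta>\<^sup>2 / 4 - x\<^sup>2 / 2) + \<i> * of_real (\<tau> * \<beta> / 2 + \<tau> / sqrt 2 * x))"
      by (simp add: exp_of_real[symmetric] mult_exp_exp algebra_simps del: exp_of_real)
    also have "of_real (\<beta>\<^sup>2 / 4 - x\<^sup>2 / 2) + \<i> * complex_of_real (\<tau> * \<beta> / 2 + \<tau> / sqrt 2 * x) =
      - of_real ((\<beta>/2 + 1 / sqrt 2 * x)\<^sup>2) + b * of_real (\<beta>/2 + 1 / sqrt 2 * x)"
      by (subst re[symmetric]) (simp add: b algebra_simps add_divide_distrib)
    finally show "C * (std_normal_density x *\<^sub>R iexp (\<tau> / sqrt 2 * x)) =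
      exp (- of_real ((\<beta>/2 + 1 / sqrt 2 * x)\<^sup>2) + b * of_real (\<beta>/2 + 1 / sqrt 2 * x))" .
  qed
  also have "C * complex_of_real (exp (- (\<tau>\<^sup>2 / 4))) =
      (of_real (sqrt pi) * exp (b\<^sup>2 / 4)) /\<^sub>R \<bar>1 / sqrt 2\<bar>"
  proof -
    have "b\<^sup>2 / 4 = of_real (\<beta>\<^sup>2 / 4) + \<i> * of_real (\<tau> * \<beta> / 2) + of_real (- (\<tau>\<^sup>2 / 4))"
      by (simp add: b power2_eq_square field_simps)
    then have "exp (b\<^sup>2 / 4) = exp (of_real (\<beta>\<^sup>2 / 4) + \<i> * of_real (\<tau> * \<beta> / 2)) * of_real (exp (- (\<tau>\<^sup>2 / 4)))"
      by (simp only: exp_add exp_of_real)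
    then show ?thesis
      by (simp add: C_def real_sqrt_mult scaleR_conv_of_real)
  qed
  finally show ?thesis
    by (subst lborel_has_bochner_integral_real_affine_iff[where c = "1 / sqrt 2" and t = "\<beta> / 2"])
      simp_all
qed

lemma vec_prod_integral:
  fixes f :: "'n::finite \<Rightarrow> real \<Rightarrow> 'b::{real_normed_field, banach, second_countable_topology}"
  assumes int: "\<And>j. integrable lborel (f j)"
  shows "integrable lborel (\<lambda>x::real^'n. \<Prod>j\<in>UNIV. f j (x $ j))" (is ?int)
    and "(\<integral>x. (\<Prod>j\<in>UNIV. f j (x $ j)) \<partial>(lborel :: (real^'n) measure)) = (\<Prod>j\<in>UNIV. \<integral>t. f j t \<partial>lborel)" (is ?eq)
proof -
  let ?ax = "\<lambda>j::'n. axis j (1::real)"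
  define F where "F b = f (inv_into UNIV ?ax b)" for b
  have inj: "inj ?ax"
    by (auto simp: inj_def axis_eq_axis)
  have B: "(Basis :: (real^'n) set) = range ?ax"
    by (auto simp: Basis_vec_def)
  have re: "(\<Prod>b\<in>Basis. G b) = (\<Prod>j\<in>UNIV. G (?ax j))" for G :: "real^'n \<Rightarrow> 'b"
    unfolding B by (subst prod.reindex[OF inj]) simp
  have F: "F (?ax j) = f j" for j
    by (simp add: F_def inv_f_f[OF inj])
  have "integrable lborel (F b)" for b
    by (simp add: F_def int)
  from lborel_prod_integral[where f = F, OF this] show ?int ?eq
    by (simp_all add: re F inner_axis)
qed

lemma Gaussian_vec:
  fixes b :: "complex^'n"
  shows "has_bochner_integral lborel
    (\<lambda>y::real^'n. exp (- of_real (\<Sum>j\<in>UNIV. (y $ j)\<^sup>2) + (\<Sum>j\<in>UNIV. b $ j * of_real (y $ j))))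
    (of_real (pi powr (real CARD('n) / 2)) * exp ((\<Sum>j\<in>UNIV. (b $ j)\<^sup>2) / 4))"
proof -
  let ?f = "\<lambda>j y. exp (- of_real (y\<^sup>2) + b $ j * of_real y)"
  have int: "integrable lborel (?f j)" for j
    using Gaussian_1d[of "b $ j"] by (rule integrable.intros)
  have eq: "(\<lambda>y::real^'n. exp (- of_real (\<Sum>j\<in>UNIV. (y $ j)\<^sup>2) + (\<Sum>j\<in>UNIV. b $ j * of_real (y $ j)))) =
    (\<lambda>y. \<Prod>j\<in>UNIV. ?f j (y $ j))"
    by (rule ext) (simp flip: exp_sum add: sum.distrib sum_negf sum_subtractf)
  have "(\<Prod>j\<in>(UNIV::'n set). of_real (sqrt pi) * exp ((b $ j)\<^sup>2 / 4)) =
     of_real (pi powr (real CARD('n) / 2)) * exp ((\<Sum>j\<in>UNIV. (b $ j)\<^sup>2) / 4)"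
    by (simp add: prod.distrib exp_sum[symmetric] sum_divide_distrib powr_half_sqrt[symmetric]
        powr_powr powr_realpow[symmetric] flip: of_real_power)
  then show ?thesis
    unfolding has_bochner_integral_iff eq
    using vec_prod_integral[where f = ?f, OF int] has_bochner_integral_integral_eq[OF Gaussian_1d]
    by simp
qed

lemma integrable_Gaussian_1d:
  assumes "c > (0::real)"
  shows "integrable lborel (\<lambda>x::real. exp (- c * x\<^sup>2))"
proof -
  have "integrable lborel (normal_density 0 (1 / sqrt (2 * c)))"
    using assms by simp
  then have "integrable lborel (\<lambda>x. sqrt (2 * pi * (1 / sqrt (2 * c))\<^sup>2) * normal_density 0 (1 / sqrt (2 * c)) x)"
    by (rule integrable_mult_right)
  also have "(\<lambda>x. sqrt (2 * pi * (1 / sqrt (2 * c))\<^sup>2) * normal_density 0 (1 / sqrt (2 * c)) x) = (\<lambda>x. exp (- c * x\<^sup>2))"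
    using assms by (auto simp: normal_density_def power_divide)
  finally show ?thesis .
qed

lemma integrable_Gaussian:
  assumes "c > (0::real)"
  shows "integrable lborel (\<lambda>x::'a::euclidean_space. exp (- c * (norm x)\<^sup>2))"
  unfolding exp_minus_norm_power2
  by (rule lborel_prod_integral) (rule integrable_Gaussian_1d[OF assms])

lemma integral_Gaussian_pi: "(\<integral>x. exp (- pi * (norm x)\<^sup>2) \<partial>(lborel :: 'a::euclidean_space measure)) = 1"
proof -
  have "(\<integral>x. exp (- pi * x\<^sup>2) \<partial>(lborel :: real measure)) = (\<integral>x. normal_density 0 (1 / sqrt (2 * pi)) x \<partial>lborel)"
    by (rule Bochner_Integration.integral_cong) (auto simp: normal_density_def power_divide)
  also have "\<dots> = 1"
    by simp
  finally show ?thesis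
    unfolding exp_minus_norm_power2
    by (subst lborel_prod_integral) (auto intro: integrable_Gaussian_1d[of pi, simplified])
qed

text \<open>Half of the Gaussian is spent on absorbing the linear exponent, by completing the
  square; the other half stays integrable.\<close>

lemma exp_linear_Gaussian_le:
  fixes c C r :: real
  assumes "c > 0"
  shows "exp (C * r - c * r\<^sup>2) \<le> exp (C\<^sup>2 / (2 * c)) * exp (- (c / 2) * r\<^sup>2)"
proof -
  have "0 \<le> (c * r - C)\<^sup>2 / (2 * c)"
    using assms by simp
  also have "\<dots> = C\<^sup>2 / (2 * c) + c / 2 * r\<^sup>2 - C * r"
    using assms by (simp add: power2_eq_square field_simps)
  finally have "C * r - c * r\<^sup>2 \<le> C\<^sup>2 / (2 * c) + - (c / 2) * r\<^sup>2"
    by (simp add: field_simps)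
  then show ?thesis
    by (simp flip: exp_add)
qed

lemma integrable_exp_linear_Gaussian:
  assumes "c > (0::real)"
  shows "integrable lborel (\<lambda>x::'a::euclidean_space. exp (C * norm x - c * (norm x)\<^sup>2))"
proof (rule Bochner_Integration.integrable_bound)
  show "integrable lborel (\<lambda>x::'a. exp (C\<^sup>2 / (2 * c)) * exp (- (c / 2) * (norm x)\<^sup>2))"
    using assms by (intro integrable_mult_right integrable_Gaussian) auto
qed (use exp_linear_Gaussian_le[OF assms] in auto)

subsection \<open>Invariance under linear isometries\<close>

lemma inner_Basis_bij:
  assumes \<beta>: "bij_betw \<beta> (Basis :: 'a::euclidean_space set) (Basis :: 'b::euclidean_space set)"
    and a: "a \<in> Basis"
  shows "(\<Sum>a'\<in>Basis. (x \<bullet> a') *\<^sub>R \<beta> a') \<bullet> \<beta> a = x \<bullet> a"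
proof -
  have \<beta>B: "\<beta> a' \<in> Basis" if "a' \<in> Basis" for a'
    using \<beta> that by (auto simp: bij_betw_def)
  have "(\<Sum>a'\<in>Basis. (x \<bullet> a') *\<^sub>R \<beta> a') \<bullet> \<beta> a = (\<Sum>a'\<in>Basis. (x \<bullet> a') * (if a' = a then 1 else 0))"
    unfolding inner_sum_left inner_scaleR_left
    by (intro sum.cong refl arg_cong2[where f = "(*)"])
      (use \<beta> \<beta>B a in \<open>auto simp: inner_Basis bij_betw_def dest: inj_onD\<close>)
  also have "\<dots> = x \<bullet> a"
    using a by (simp add: if_distrib sum.delta cong: if_cong)
  finally show ?thesis .
qed

text \<open>Boxes determine Lebesgue measure, and relabelling coordinates pulls a box back to a box
  with the same side lengths.\<close>

lemma lborel_distr_Basis_bij: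
  fixes T :: "'a::euclidean_space \<Rightarrow> 'b::euclidean_space"
  assumes \<beta>: "bij_betw \<beta> (Basis :: 'a set) (Basis :: 'b set)"
    and T: "\<And>x. T x = (\<Sum>a\<in>Basis. (x \<bullet> a) *\<^sub>R \<beta> a)"
  shows "distr lborel borel T = lborel"
proof (rule lborel_eqI[symmetric])
  have [measurable]: "T \<in> borel_measurable borel"
    unfolding T[abs_def] by measurable
  have \<beta>B: "\<beta> a \<in> Basis" if "a \<in> Basis" for a
    using \<beta> that by (auto simp: bij_betw_def)
  have inn: "T x \<bullet> \<beta> a = x \<bullet> a" if "a \<in> Basis" for x a
    unfolding T by (rule inner_Basis_bij[OF \<beta> that])
  fix l u :: 'b assume lu: "\<And>b. b \<in> Basis \<Longrightarrow> l \<bullet> b \<le> u \<bullet> b"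
  let ?S = "\<lambda>y::'b. \<Sum>a\<in>Basis. (y \<bullet> \<beta> a) *\<^sub>R (a::'a)"
  have all: "(\<forall>b\<in>Basis. P b) \<longleftrightarrow> (\<forall>a\<in>Basis. P (\<beta> a))" for P
    unfolding bij_betw_imp_surj_on[OF \<beta>, symmetric] by simp
  have "T -` box l u = box (?S l) (?S u)"
    by (auto simp: box_def all inn)
  then have "emeasure (distr lborel borel T) (box l u) = emeasure lborel (box (?S l) (?S u))"
    by (simp add: emeasure_distr)
  also have "\<dots> = (\<Prod>a\<in>Basis. (?S u - ?S l) \<bullet> a)"
    by (rule emeasure_lborel_box) (simp add: lu \<beta>B)
  also have "(\<Prod>a\<in>Basis. (?S u - ?S l) \<bullet> a) = (\<Prod>a\<in>Basis. (u - l) \<bullet> \<beta> a)"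
    by (intro prod.cong) (auto simp: inner_diff_left)
  also have "\<dots> = (\<Prod>b\<in>Basis. (u - l) \<bullet> b)"
    by (rule prod.reindex_bij_betw[OF \<beta>])
  finally show "emeasure (distr lborel borel T) (box l u) = (\<Prod>b\<in>Basis. (u - l) \<bullet> b)" .
qed simp

lemma lborel_distr_orthogonal:
  fixes f :: "real^'k::{finite,wellorder} \<Rightarrow> real^'k::_"
  assumes f: "orthogonal_transformation f"
  shows "distr lborel borel f = lborel"
proof (rule lborel_eqI[symmetric])
  have "linear f"
    using f by (rule orthogonal_transformation_linear)
  then have [measurable]: "f \<in> borel_measurable borel"
    by (intro borel_measurable_continuous_onI linear_continuous_on linear_conv_bounded_linear[THEN iffD1])
  have bij: "bij f"
    using f by (rule orthogonal_transformation_bij)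
  have inv: "orthogonal_transformation (inv_into UNIV f)"
    using f by (rule orthogonal_transformation_inv)
  fix l u :: "real^'k::_" assume lu: "\<And>b. b \<in> Basis \<Longrightarrow> l \<bullet> b \<le> u \<bullet> b"
  have vim: "f -` box l u = inv_into UNIV f ` box l u"
    using bij by (simp add: bij_vimage_eq_inv_image)
  have borel: "f -` box l u \<in> sets borel"
    using measurable_sets[of f borel borel "box l u"] by simp
  have L: "inv_into UNIV f ` box l u \<in> lmeasurable"
    using measurable_orthogonal_image[OF inv, of "box l u"] by simp
  have "emeasure (distr lborel borel f) (box l u) = emeasure lborel (f -` box l u)"
    by (simp add: emeasure_distr)
  also have "\<dots> = emeasure lebesgue (f -` box l u)"
    using borel by simp
  also have "\<dots> = ennreal (measure lebesgue (inv_into UNIV f ` box l u))"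
    using L by (simp add: vim emeasure_eq_measure2)
  also have "\<dots> = ennreal (measure lebesgue (box l u))"
    by (simp add: measure_orthogonal_image[OF inv])
  also have "\<dots> = emeasure lborel (box l u)"
    by (simp add: emeasure_eq_measure2)
  also have "\<dots> = (\<Prod>b\<in>Basis. (u - l) \<bullet> b)"
    using lu by (rule emeasure_lborel_box)
  finally show "emeasure (distr lborel borel f) (box l u) = (\<Prod>b\<in>Basis. (u - l) \<bullet> b)" .
qed simp

text \<open>
  The library has invariance under orthogonal maps only on \<open>real^'k\<close> with a well-ordered index type;
  \<open>'n bit0\<close> is such a type with \<open>2 * CARD('n)\<close> elements.
\<close>

lemma lborel_distr_isometry:
  fixes L :: "complex^'n \<Rightarrow> complex^'n"
  assumes L: "linear L" "\<And>x. norm (L x) = norm x"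
  shows "distr lborel borel L = lborel"
proof -
  have "card (Basis :: (real^('n bit0)) set) = card (Basis :: (complex^'n) set)"
    by simp
  then obtain \<beta> where \<beta>: "bij_betw \<beta> (Basis :: (real^('n bit0)) set) (Basis :: (complex^'n) set)"
    using finite_same_card_bij[OF finite_Basis finite_Basis] by metis
  define T where "T x = (\<Sum>a\<in>Basis. (x \<bullet> a) *\<^sub>R \<beta> a)" for x
  define T' where "T' y = (\<Sum>a\<in>Basis. (y \<bullet> \<beta> a) *\<^sub>R a)" for y
  have \<beta>B: "\<beta> a \<in> Basis" if "a \<in> Basis" for a
    using \<beta> that by (auto simp: bij_betw_def)
  have all: "(\<forall>b\<in>Basis. P b) \<longleftrightarrow> (\<forall>a\<in>Basis. P (\<beta> a))" for P
    unfolding bij_betw_imp_surj_on[OF \<beta>, symmetric] by simp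
  have inn: "T x \<bullet> \<beta> a = x \<bullet> a" if "a \<in> Basis" for x a
    unfolding T_def by (rule inner_Basis_bij[OF \<beta> that])
  have T'T: "T' (T x) = x" for x
    by (simp add: T'_def inn euclidean_representation cong: sum.cong)
  have TT': "T (T' y) = y" for y
    by (rule euclidean_eqI, rule all[THEN iffD2, rule_format]) (simp add: inn T'_def)
  have linT: "linear T" "linear T'"
    unfolding T_def T'_def
    by (auto intro!: linearI simp: inner_add_left scaleR_add_left sum.distrib scaleR_sum_right)
  have normT: "norm (T x) = norm x" for x
  proof -
    have "(norm (T x))\<^sup>2 = (\<Sum>b\<in>Basis. (T x \<bullet> b)\<^sup>2)"
      by (simp only: sum_Basis_power2)
    also have "\<dots> = (\<Sum>a\<in>Basis. (T x \<bullet> \<beta> a)\<^sup>2)"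
      by (rule sum.reindex_bij_betw[OF \<beta>, symmetric])
    also have "\<dots> = (norm x)\<^sup>2"
      by (simp add: inn sum_Basis_power2 cong: sum.cong)
    finally show ?thesis
      by (simp add: power2_eq_iff_nonneg)
  qed
  \<comment> \<open>In the coordinates given by \<open>T\<close>, \<open>L\<close> becomes an
    isometry \<open>f\<close> of a real coordinate space. The relation
    \<open>L \<circ> T = T \<circ> f\<close> then transfers the invariance from \<open>f\<close> to
    \<open>L\<close>.\<close>
  define f where "f = T' \<circ> L \<circ> T"
  have "linear f"
    unfolding f_def using L linT by (intro linear_compose)
  moreover have "norm (f x) = norm x" for x
    using normT[of "f x"] by (simp add: f_def TT' L normT)
  ultimately have "distr lborel borel f = lborel"
    by (intro lborel_distr_orthogonal) (auto simp: orthogonal_transformation)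
  have dT: "distr lborel borel T = lborel"
    by (rule lborel_distr_Basis_bij[OF \<beta>]) (simp add: T_def)
  have [measurable]: "T \<in> borel_measurable borel" "L \<in> borel_measurable borel"
    "f \<in> borel_measurable borel"
    using \<open>linear f\<close> L linT
    by (auto intro!: borel_measurable_continuous_onI linear_continuous_on simp: linear_conv_bounded_linear)
  have "distr lborel borel L = distr (distr lborel borel T) borel L"
    by (simp add: dT)
  also have "\<dots> = distr lborel borel (L \<circ> T)"
    by (simp add: distr_distr)
  also have "L \<circ> T = T \<circ> f"
    by (auto simp: f_def TT')
  also have "distr lborel borel (T \<circ> f) = distr (distr lborel borel f) borel T"
    by (simp add: distr_distr)
  also have "\<dots> = lborel"
    using \<open>distr lborel borel f = lborel\<close> dT by simp
  finally show ?thesis .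
qed

lemma integrable_isometry_iff:
  fixes L :: "complex^'n \<Rightarrow> complex^'n" and f :: "complex^'n \<Rightarrow> 'b::{banach, second_countable_topology}"
  assumes L: "linear L" "\<And>x. norm (L x) = norm x" and f: "f \<in> borel_measurable borel"
  shows "integrable lborel (\<lambda>x. f (L x)) \<longleftrightarrow> integrable lborel f"
    and "(\<integral>x. f (L x) \<partial>lborel) = (\<integral>x. f x \<partial>lborel)"
proof -
  have [measurable]: "L \<in> borel_measurable borel"
    using L by (auto intro!: borel_measurable_continuous_onI linear_continuous_on simp: linear_conv_bounded_linear)
  note d = lborel_distr_isometry[OF L]
  show "integrable lborel (\<lambda>x. f (L x)) \<longleftrightarrow> integrable lborel f"
    by (subst (2) d[symmetric], subst integrable_distr_eq) (use f in auto)
  show "(\<integral>x. f (L x) \<partial>lborel) = (\<integral>x. f x \<partial>lborel)"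
    by (subst (2) d[symmetric], subst integral_distr) (use f in auto)
qed

section \<open>Uniqueness of the Fourier transform\<close>

lemma integrable_pair_mult:
  fixes f :: "'a::euclidean_space \<Rightarrow> 'c::{real_normed_field, banach, second_countable_topology}"
    and g :: "'b::euclidean_space \<Rightarrow> 'c"
  assumes f: "integrable lborel f" and g: "integrable lborel g"
  shows "integrable (lborel \<Otimes>\<^sub>M lborel) (\<lambda>(x, y). f x * g y)"
proof (rule lborel_pair.Fubini_integrable)
  have [measurable]: "f \<in> borel_measurable borel" "g \<in> borel_measurable borel"
    using f g by auto
  show "(\<lambda>(x, y). f x * g y) \<in> borel_measurable (lborel \<Otimes>\<^sub>M lborel)"
    by measurable
  show "integrable lborel (\<lambda>x. \<integral>y. norm (case (x, y) of (x, y) \<Rightarrow> f x * g y) \<partial>lborel)"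
    using f by (simp add: norm_mult)
  show "AE x in lborel. integrable lborel (\<lambda>y. case (x, y) of (x, y) \<Rightarrow> f x * g y)"
    using g by simp
qed

lemma norm_vec_power2: "(norm x)\<^sup>2 = (\<Sum>j\<in>UNIV. (x $ j)\<^sup>2)" for x :: "real^'n"
  by (simp only: power2_norm_eq_inner inner_vec_def) (simp add: power2_eq_square)

text \<open>The scale \<open>t\<close> makes one formula produce Gaussians of every width; t = 0
  gives the total mass.\<close>

lemma Gaussian_Fourier:
  fixes x :: "real^'n"
  shows "(\<integral>\<xi>. of_real (exp (- (norm \<xi>)\<^sup>2)) * exp (\<i> * of_real (t * (\<xi> \<bullet> x))) \<partial>lborel)
    = complex_of_real (pi powr (real CARD('n) / 2) * exp (- (t\<^sup>2 * (norm x)\<^sup>2 / 4)))"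
proof -
  let ?b = "\<chi> j. \<i> * of_real (t * x $ j)"
  have "(\<lambda>\<xi>::real^'n. of_real (exp (- (norm \<xi>)\<^sup>2)) * exp (\<i> * of_real (t * (\<xi> \<bullet> x)))) =
    (\<lambda>\<xi>. exp (- of_real (\<Sum>j\<in>UNIV. (\<xi> $ j)\<^sup>2) + (\<Sum>j\<in>UNIV. ?b $ j * of_real (\<xi> $ j))))"
    unfolding norm_vec_power2
    by (rule ext) (simp add: inner_vec_def sum_distrib_left
        mult_ac exp_of_real[symmetric] exp_add[symmetric] del: exp_of_real)
  then have "(\<integral>\<xi>. of_real (exp (- (norm \<xi>)\<^sup>2)) * exp (\<i> * of_real (t * (\<xi> \<bullet> x))) \<partial>lborel) =
    of_real (pi powr (real CARD('n) / 2)) * exp ((\<Sum>j\<in>UNIV. (?b $ j)\<^sup>2) / 4)"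
    using has_bochner_integral_integral_eq[OF Gaussian_vec[of ?b]] by simp
  also have "(\<Sum>j\<in>UNIV. (?b $ j)\<^sup>2) / 4 = of_real (- (t\<^sup>2 * (norm x)\<^sup>2 / 4))"
    by (simp add: power_mult_distrib norm_vec_power2 sum_negf sum_distrib_left)
  finally show ?thesis
    by (simp only: exp_of_real of_real_mult)
qed

lemma integral_scaled_translate:
  fixes f :: "'a::euclidean_space \<Rightarrow> 'b::{banach, second_countable_topology}"
  assumes f: "f \<in> borel_measurable borel" and c: "c \<noteq> 0"
  shows "(\<integral>x. f x \<partial>lborel) = \<bar>c\<bar> ^ DIM('a) *\<^sub>R (\<integral>x. f (t + c *\<^sub>R x) \<partial>lborel)"
proof -
  have "(\<integral>x. f x \<partial>lborel) =
    (\<integral>x. f x \<partial>density (distr lborel borel (\<lambda>x. t + c *\<^sub>R x)) (\<lambda>_. ennreal (\<bar>c\<bar> ^ DIM('a))))"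
    using lborel_affine[OF c, of t] by (simp add: ennreal_power)
  also have "\<dots> = (\<integral>x. \<bar>c\<bar> ^ DIM('a) *\<^sub>R f x \<partial>distr lborel borel (\<lambda>x. t + c *\<^sub>R x))"
    by (rule integral_density) (use f in auto)
  also have "\<dots> = (\<integral>x. \<bar>c\<bar> ^ DIM('a) *\<^sub>R f (t + c *\<^sub>R x) \<partial>lborel)"
    by (rule integral_distr) (use f in auto)
  finally show ?thesis
    by simp
qed

text \<open>A Gaussian is a superposition of characters, so Fubini reduces the integral to the
  vanishing transform, taken at \<open>t *\<^sub>R \<xi>\<close> and multiplied by a phase that
  depends on \<open>a\<close>.\<close>

lemma Fourier_zero_imp_Gaussian_average_zero:
  fixes h :: "real^'n \<Rightarrow> complex"
  assumes h: "integrable lborel h"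
    and F: "\<And>\<xi>. (\<integral>y. h y * exp (\<i> * of_real (\<xi> \<bullet> y)) \<partial>lborel) = 0"
  shows "(\<integral>y. h y * of_real (exp (- (t\<^sup>2 * (norm (y - a))\<^sup>2 / 4))) \<partial>lborel) = 0"
proof -
  have [measurable]: "h \<in> borel_measurable borel"
    using h by auto
  let ?K = "pi powr (real CARD('n) / 2)"
  let ?f = "\<lambda>y \<xi>. h y * (complex_of_real (exp (- (norm \<xi>)\<^sup>2)) * exp (\<i> * of_real (t * (\<xi> \<bullet> (y - a)))))"
  have g: "integrable lborel (\<lambda>\<xi>::real^'n. complex_of_real (exp (- (norm \<xi>)\<^sup>2)))"
    using integrable_Gaussian[of 1] by (intro integrable_of_real) simp
  have "integrable (lborel \<Otimes>\<^sub>M lborel) (case_prod ?f)"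
    by (rule Bochner_Integration.integrable_bound[OF integrable_pair_mult[OF h g]])
      (auto simp: norm_mult)
  then have "(\<integral>\<xi>. (\<integral>y. ?f y \<xi> \<partial>lborel) \<partial>lborel) = (\<integral>y. (\<integral>\<xi>. ?f y \<xi> \<partial>lborel) \<partial>lborel)"
    by (rule lborel_pair.Fubini_integral)
  moreover have "(\<integral>y. ?f y \<xi> \<partial>lborel) = 0" for \<xi>
  proof -
    have "?f y \<xi> = (complex_of_real (exp (- (norm \<xi>)\<^sup>2)) * exp (- \<i> * of_real (t * (\<xi> \<bullet> a)))) *
        (h y * exp (\<i> * of_real ((t *\<^sub>R \<xi>) \<bullet> y)))" for y
      by (simp add: inner_diff_right algebra_simps exp_add[symmetric])
    then show ?thesis
      by (simp only: F integral_mult_right_zero mult_zero_right)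
  qed
  ultimately have "(\<integral>y. h y * of_real (?K * exp (- (t\<^sup>2 * (norm (y - a))\<^sup>2 / 4))) \<partial>lborel) = 0"
    by (simp only: integral_mult_right_zero Gaussian_Fourier integral_zero)
  then have "of_real ?K * (\<integral>y. h y * of_real (exp (- (t\<^sup>2 * (norm (y - a))\<^sup>2 / 4))) \<partial>lborel) = 0"
    by (simp only: of_real_mult mult.left_commute[of "h _"] integral_mult_right_zero)
  then show ?thesis
    by simp
qed

text \<open>Integrating Gaussian averages over centres in a box produces the indicator of the box
  smoothed at scale \<open>c\<close>, which approaches the indicator itself as \<open>c\<close>
  tends to 0.\<close>

lemma Fourier_zero_imp_smoothed_box_zero:
  fixes h :: "real^'n \<Rightarrow> complex"
  assumes h: "integrable lborel h"
    and F: "\<And>\<xi>. (\<integral>y. h y * exp (\<i> * of_real (\<xi> \<bullet> y)) \<partial>lborel) = 0"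
    and c: "c > 0"
  shows "(\<integral>y. h y * of_real (\<integral>b. indicator (box l u) (y + c *\<^sub>R b) * exp (- (norm b)\<^sup>2) \<partial>lborel) \<partial>lborel) = 0"
proof -
  have [measurable]: "h \<in> borel_measurable borel"
    using h by auto
  let ?I = "indicator (box l u) :: real^'n \<Rightarrow> real"
  \<comment> \<open>With t = 2 / c the substitution a = y + c b turns the exponent into -|b|^2, so
    that \<open>c\<close> is the width of the smoothing.\<close>
  let ?g = "\<lambda>y a. exp (- ((2 / c)\<^sup>2 * (norm (y - a))\<^sup>2 / 4))"
  have sub: "(\<integral>a. ?I a * ?g y a \<partial>lborel) = c ^ CARD('n) * (\<integral>b. ?I (y + c *\<^sub>R b) * exp (- (norm b)\<^sup>2) \<partial>lborel)" for y
    by (subst integral_scaled_translate[where c = c and t = y])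
      (use c in \<open>auto simp: power_mult_distrib power_divide\<close>)
  have I: "integrable lborel (\<lambda>x. complex_of_real (?I x))"
    by (intro integrable_of_real integrable_real_indicator emeasure_bounded_finite bounded_box) auto
  let ?f = "\<lambda>y a. h y * (complex_of_real (?I a) * complex_of_real (?g y a))"
  have "integrable (lborel \<Otimes>\<^sub>M lborel) (case_prod ?f)"
    by (rule Bochner_Integration.integrable_bound[OF integrable_pair_mult[OF h I]])
      (auto simp: norm_mult mult_left_le split: split_indicator)
  then have "(\<integral>a. (\<integral>y. ?f y a \<partial>lborel) \<partial>lborel) = (\<integral>y. (\<integral>a. ?f y a \<partial>lborel) \<partial>lborel)"
    by (rule lborel_pair.Fubini_integral)
  moreover have "(\<integral>y. ?f y a \<partial>lborel) = 0" for a
  proof -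
    have "(\<integral>y. ?f y a \<partial>lborel) = (\<integral>y. complex_of_real (?I a) * (h y * complex_of_real (?g y a)) \<partial>lborel)"
      by (simp add: mult_ac)
    then show ?thesis
      by (simp only: Fourier_zero_imp_Gaussian_average_zero[OF h F] integral_mult_right_zero mult_zero_right)
  qed
  moreover have "(\<integral>a. ?f y a \<partial>lborel) = h y * of_real (\<integral>a. ?I a * ?g y a \<partial>lborel)" for y
    by (simp only: integral_mult_right_zero of_real_mult[symmetric] integral_complex_of_real)
  ultimately have "(\<integral>y. h y * of_real (c ^ CARD('n) * (\<integral>b. ?I (y + c *\<^sub>R b) * exp (- (norm b)\<^sup>2) \<partial>lborel)) \<partial>lborel) = 0"
    by (simp only: sub integral_zero)
  then have "of_real (c ^ CARD('n)) * (\<integral>y. h y * of_real (\<integral>b. ?I (y + c *\<^sub>R b) * exp (- (norm b)\<^sup>2) \<partial>lborel) \<partial>lborel) = 0"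
    by (simp only: of_real_mult mult.left_commute[of "h _"] integral_mult_right_zero)
  then show ?thesis
    using c by simp
qed

lemma AE_lborel_not_in_frontier_box: "AE y in lborel. y \<notin> cbox l u - box l (u::'a::euclidean_space)"
proof -
  have "cbox l u - box l u \<in> null_sets lebesgue"
    using negligible_frontier_interval negligible_iff_null_sets by blast
  moreover have "cbox l u - box l u \<in> sets lborel"
    by simp
  ultimately have "cbox l u - box l u \<in> null_sets lborel"
    by (simp add: null_sets_def)
  then show ?thesis
    by (rule AE_not_in)
qed

lemma tendsto_indicator_box:
  fixes x :: "'a::euclidean_space"
  assumes y: "y \<notin> cbox l u - box l u" and f: "(f \<longlongrightarrow> y) F"
  shows "((\<lambda>x. indicator (box l u) (f x) :: real) \<longlongrightarrow> indicator (box l u) y) F"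
proof (cases "y \<in> box l u")
  case True
  with f have "\<forall>\<^sub>F x in F. f x \<in> box l u"
    by (intro topological_tendstoD) auto
  then have "\<forall>\<^sub>F x in F. (indicator (box l u) (f x) :: real) = indicator (box l u) y"
    by eventually_elim (use True in auto)
  then show ?thesis
    by (rule tendsto_eventually)
next
  case False
  with y have "y \<in> - cbox l u"
    by auto
  with f have "\<forall>\<^sub>F x in F. f x \<in> - cbox l u"
    by (intro topological_tendstoD) auto
  then have "\<forall>\<^sub>F x in F. (indicator (box l u) (f x) :: real) = indicator (box l u) y"
    by eventually_elim (use False box_subset_cbox[of l u] in \<open>auto simp: indicator_def\<close>)
  then show ?thesis
    by (rule tendsto_eventually)
qed

text \<open>The smoothed indicators are bounded by the Gaussian mass \<open>K\<close> and converge
  to \<open>K\<close> times the indicator away from the boundary of the box. The boundary is a null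
  set, so dominated convergence passes to the limit.\<close>

lemma Fourier_zero_imp_box_zero:
  fixes h :: "real^'n \<Rightarrow> complex"
  assumes h: "integrable lborel h"
    and F: "\<And>\<xi>. (\<integral>y. h y * exp (\<i> * of_real (\<xi> \<bullet> y)) \<partial>lborel) = 0"
  shows "(\<integral>y. h y * of_real (indicator (box l u) y) \<partial>lborel) = 0"
proof -
  have [measurable]: "h \<in> borel_measurable borel"
    using h by auto
  let ?I = "indicator (box l u) :: real^'n \<Rightarrow> real"
  let ?c = "\<lambda>n. 1 / real (Suc n)"
  define K where "K = (\<integral>b. exp (- (norm b)\<^sup>2) \<partial>(lborel :: (real^'n) measure))"
  define \<psi> where "\<psi> n y = (\<integral>b. ?I (y + ?c n *\<^sub>R b) * exp (- (norm b)\<^sup>2) \<partial>lborel)" for n y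
  have g: "integrable lborel (\<lambda>b::real^'n. exp (- (norm b)\<^sup>2))"
    using integrable_Gaussian[of 1] by simp
  have "complex_of_real K = of_real (pi powr (real CARD('n) / 2))"
    using Gaussian_Fourier[of 0 "0 :: real^'n"] by (simp add: K_def)
  then have "K \<noteq> 0"
    by (simp only: of_real_eq_iff) simp
  have lim: "(\<lambda>n. \<psi> n y) \<longlonglongrightarrow> ?I y * K" if y: "y \<notin> cbox l u - box l u" for y
  proof -
    have "(\<lambda>n. \<psi> n y) \<longlonglongrightarrow> (\<integral>b. ?I y * exp (- (norm b)\<^sup>2) \<partial>(lborel :: (real^'n) measure))"
      unfolding \<psi>_def
    proof (rule integral_dominated_convergence[where w = "\<lambda>b::real^'n. exp (- (norm b)\<^sup>2)"])
      show "AE b in lborel. (\<lambda>n. ?I (y + ?c n *\<^sub>R b) * exp (- (norm b)\<^sup>2)) \<longlonglongrightarrow> ?I y * exp (- (norm b)\<^sup>2)"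
      proof (rule AE_I2)
        fix b :: "real^'n"
        have "(\<lambda>n. y + ?c n *\<^sub>R b) \<longlonglongrightarrow> y + 0 *\<^sub>R b"
          by (intro tendsto_intros LIMSEQ_Suc[OF lim_1_over_n])
        then have "(\<lambda>n. y + ?c n *\<^sub>R b) \<longlonglongrightarrow> y"
          by simp
        from tendsto_indicator_box[OF y this]
        show "(\<lambda>n. ?I (y + ?c n *\<^sub>R b) * exp (- (norm b)\<^sup>2)) \<longlonglongrightarrow> ?I y * exp (- (norm b)\<^sup>2)"
          by (intro tendsto_mult tendsto_const)
      qed
    qed (use g in \<open>auto split: split_indicator\<close>)
    then show ?thesis
      by (simp add: K_def)
  qed
  have [measurable]: "\<psi> n \<in> borel_measurable borel" for n
    unfolding \<psi>_def by measurable
  have \<psi>_le: "\<bar>\<psi> n y\<bar> \<le> K" for n y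
  proof -
    have "norm (\<psi> n y) \<le> (\<integral>b. norm (?I (y + ?c n *\<^sub>R b) * exp (- (norm b)\<^sup>2)) \<partial>lborel)"
      unfolding \<psi>_def by (rule integral_norm_bound)
    also have "\<dots> \<le> K"
      unfolding K_def by (rule integral_mono'[OF g]) (auto split: split_indicator)
    finally show ?thesis
      by simp
  qed
  have "(\<lambda>n. \<integral>y. h y * of_real (\<psi> n y) \<partial>lborel) \<longlonglongrightarrow> (\<integral>y. h y * of_real (?I y * K) \<partial>lborel)"
  proof (rule integral_dominated_convergence)
    show "integrable lborel (\<lambda>y. norm (h y) * K)"
      using h by simp
    show "AE y in lborel. (\<lambda>n. h y * of_real (\<psi> n y)) \<longlonglongrightarrow> h y * of_real (?I y * K)"
      using AE_lborel_not_in_frontier_box[of l u]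
      by eventually_elim (intro tendsto_intros lim)
    show "AE y in lborel. norm (h y * of_real (\<psi> n y)) \<le> norm (h y) * K" for n
      using \<psi>_le by (auto simp: norm_mult intro!: mult_left_mono)
  qed auto
  moreover have "(\<integral>y. h y * of_real (\<psi> n y) \<partial>lborel) = 0" for n
    unfolding \<psi>_def by (rule Fourier_zero_imp_smoothed_box_zero[OF h F]) auto
  ultimately have "(\<integral>y. h y * of_real (?I y * K) \<partial>lborel) = 0"
    by (simp only: LIMSEQ_const_iff)
  moreover have "(\<integral>y. h y * of_real (?I y * K) \<partial>lborel) = (\<integral>y. h y * of_real (?I y) \<partial>lborel) * of_real K"
    by (simp only: of_real_mult mult.assoc[symmetric] integral_mult_left_zero)
  ultimately show ?thesis
    using \<open>K \<noteq> 0\<close> by simp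
qed

text \<open>The Borel sets over which \<open>h\<close> integrates to zero form a Dynkin system
  containing the boxes, which are stable under intersection. So it contains every Borel set, and the
  real and imaginary parts of \<open>h\<close> are densities of the zero measure.\<close>

lemma Fourier_zero_imp_AE_zero:
  fixes h :: "real^'n \<Rightarrow> complex"
  assumes h: "integrable lborel h"
    and F: "\<And>\<xi>. (\<integral>y. h y * exp (\<i> * of_real (\<xi> \<bullet> y)) \<partial>lborel) = 0"
  shows "AE y in lborel. h y = 0"
proof -
  have [measurable]: "h \<in> borel_measurable borel"
    using h by auto
  let ?E = "range (\<lambda>(a, b). box a b :: (real^'n) set)"
  have "(LINT y:A|lborel. h y) = 0" if "A \<in> sigma_sets UNIV ?E" for A
  proof (rule sigma_sets_induct_disjoint[OF _ _ that])
    show "Int_stable ?E"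
      by (auto simp: Int_stable_def box_Int_box)
    show "(LINT y:A|lborel. h y) = 0" if "A \<in> ?E" for A
      using that Fourier_zero_imp_box_zero[OF h F]
      by (auto simp: set_lebesgue_integral_def scaleR_conv_of_real mult.commute)
    show "(LINT y:UNIV - A|lborel. h y) = 0"
      if A: "A \<in> sigma_sets UNIV ?E" and "(LINT y:A|lborel. h y) = 0" for A
    proof -
      have Am: "A \<in> sets borel"
        using A by (simp add: borel_eq_box)
      \<comment> \<open>For complements: the integral over the whole space is the transform at
        0.\<close>
      have "(\<integral>y. h y \<partial>lborel) = 0"
        using F[of 0] by simp
      moreover have "(\<integral>y. h y \<partial>lborel) = (LINT y:A|lborel. h y) + (LINT y:UNIV - A|lborel. h y)"
        unfolding set_lebesgue_integral_def
        by (subst Bochner_Integration.integral_add[symmetric])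
          (use Am h in \<open>auto intro!: integrable_mult_indicator Bochner_Integration.integral_cong split: split_indicator\<close>)
      ultimately show ?thesis
        using that by simp
    qed
    show "(LINT y:(\<Union>i. A i)|lborel. h y) = 0"
      if "disjoint_family A" "range A \<subseteq> sigma_sets UNIV ?E" "\<And>i::nat. (LINT y:A i|lborel. h y) = 0" for A
    proof (subst lebesgue_integral_countable_add)
      show Ai: "A i \<in> sets lborel" for i
        using that by (auto simp: borel_eq_box)
      show "set_integrable lborel (\<Union>i. A i) h"
        unfolding set_integrable_def using Ai by (intro integrable_mult_indicator h) auto
    qed (use that in \<open>auto simp: disjoint_family_on_def\<close>)
  qed (auto simp: set_lebesgue_integral_def)
  then have zero: "(LINT y:A|lborel. h y) = 0" if "A \<in> sets lborel" for A
    using that by (simp add: borel_eq_box)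
  have int: "integrable lborel (\<lambda>y. indicator A y *\<^sub>R h y)" if "A \<in> sets lborel" for A
    using that h by (rule integrable_mult_indicator)
  have "AE y in lborel. Re (h y) = 0"
  proof (rule density_unique_real)
    show "(LINT y:A|lborel. Re (h y)) = (LINT y:A|lborel. 0)" if "A \<in> sets lborel" for A
      using arg_cong[OF zero[OF that], of Re] int[OF that]
      by (simp add: set_lebesgue_integral_def flip: integral_Re)
  qed (use h in auto)
  moreover have "AE y in lborel. Im (h y) = 0"
  proof (rule density_unique_real)
    show "(LINT y:A|lborel. Im (h y)) = (LINT y:A|lborel. 0)" if "A \<in> sets lborel" for A
      using arg_cong[OF zero[OF that], of Im] int[OF that]
      by (simp add: set_lebesgue_integral_def flip: integral_Im)
  qed (use h in auto)
  ultimately show ?thesis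
    by eventually_elim (simp add: complex_eq_iff)
qed

section \<open>Coherent states\<close>

definition bargmann_kernel :: "complex^'n \<Rightarrow> real^'n \<Rightarrow> complex" where
  "bargmann_kernel z y = exp (of_real (sqrt (2 * pi)) * (\<Sum>j\<in>UNIV. of_real (y $ j) * z $ j)
        - 1 / 2 * of_real (\<Sum>j\<in>UNIV. (y $ j)\<^sup>2)
        - of_real (pi / 2) * (\<Sum>j\<in>UNIV. (z $ j)\<^sup>2))"

text \<open>The Riesz representer of the evaluation u \<mapsto> (B u)(w); the kernel is conjugated
  because \<open>l2_cinner\<close> is conjugate-linear on the left. Pointwise statements about B
  thereby become statements about inner products.\<close>

definition coherent_state :: "complex^'n \<Rightarrow> (real^'n) l2" where
  "coherent_state w = abs_l2 (\<lambda>y. of_real (pi powr (- real CARD('n) / 4)) * cnj (bargmann_kernel w y))"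

lemma bargmann_abs_l2:
  fixes f :: "real^'n \<Rightarrow> complex"
  assumes "square_integrable f"
  shows "bargmann (abs_l2 f) z =
    of_real (pi powr (- real CARD('n) / 4)) * (\<integral>y. f y * bargmann_kernel z y \<partial>lborel)"
  using assms by (simp add: bargmann.abs_eq l2_eq_refl bargmann_kernel_def)

lemma bargmann_kernel_measurable [measurable]: "bargmann_kernel z \<in> borel_measurable borel"
  unfolding bargmann_kernel_def by (intro borel_measurable_continuous_onI continuous_intros)

text \<open>Sorted so that the second factor is the integrand of \<open>Gaussian_vec\<close> and the
  first does not depend on \<open>y\<close>.\<close>

lemma bargmann_kernel_product:
  "cnj (bargmann_kernel w y) * bargmann_kernel z y =
    exp (- of_real (pi / 2) * (\<Sum>j\<in>UNIV. (z $ j)\<^sup>2 + (cnj (w $ j))\<^sup>2)) *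
    exp (- of_real (\<Sum>j\<in>UNIV. (y $ j)\<^sup>2)
      + (\<Sum>j\<in>UNIV. (\<chi> j. of_real (sqrt (2 * pi)) * (z $ j + cnj (w $ j))) $ j * of_real (y $ j)))"
  unfolding bargmann_kernel_def
  by (simp only: exp_cnj exp_add[symmetric], rule arg_cong[where f = exp])
    (simp add: sum.distrib sum_distrib_left sum_negf algebra_simps)

lemma integrable_bargmann_kernel_product:
  "integrable lborel (\<lambda>y. cnj (bargmann_kernel w y) * bargmann_kernel z y)"
  unfolding bargmann_kernel_product
  by (intro integrable_mult_right integrable.intros) (rule Gaussian_vec)

lemma square_integrable_bargmann_kernel: "square_integrable (bargmann_kernel z)"
proof -
  have "(\<lambda>y. (cmod (bargmann_kernel z y))\<^sup>2) = (\<lambda>y. Re (cnj (bargmann_kernel z y) * bargmann_kernel z y))"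
    by (rule ext, simp only: cmod_power2) (simp add: power2_eq_square)
  then show ?thesis
    using integrable_Re[OF integrable_bargmann_kernel_product[of z z]]
    by (simp add: square_integrable_def)
qed

lemma square_integrable_cnj: "square_integrable f \<Longrightarrow> square_integrable (\<lambda>x. cnj (f x))"
  by (auto simp: square_integrable_def)

lemma square_integrable_coherent_state:
  "square_integrable (\<lambda>y. c * cnj (bargmann_kernel w y))"
  by (intro square_integrable_scale square_integrable_cnj square_integrable_bargmann_kernel)

lemma l2_cinner_coherent_state: "l2_cinner (coherent_state w) u = bargmann u w"
  by (cases u rule: l2_cases)
    (simp add: coherent_state_def abs_l2_cinner square_integrable_coherent_state bargmann_abs_l2
      mult.assoc mult.commute[of "bargmann_kernel _ _"])

lemma bargmann_add: "bargmann (u + v) z = bargmann u z + bargmann v z"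
  by (simp add: l2_cinner_add_right flip: l2_cinner_coherent_state)

lemma bargmann_scaleC: "bargmann (c *\<^sub>C u) z = c * bargmann u z"
  by (simp add: l2_cinner_scaleC_right flip: l2_cinner_coherent_state)

lemma bargmann_zero: "bargmann 0 z = 0"
  by (simp flip: l2_cinner_coherent_state)

lemma bargmann_coherent_state:
  "bargmann (coherent_state w) z = exp (of_real pi * vec_cinner w z)" for w z :: "complex^'n"
proof -
  let ?c = "pi powr (- real CARD('n) / 4)"
  let ?b = "\<chi> j. of_real (sqrt (2 * pi)) * (z $ j + cnj (w $ j))"
  \<comment> \<open>The two normalising factors \<pi>^(-d/4) cancel the \<pi>^(d/2) of the Gaussian
    integral.\<close>
  have pp: "?c * (?c * pi powr (real CARD('n) / 2)) = 1"
    by (simp flip: powr_add)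
  have "bargmann (coherent_state w) z =
    of_real ?c * (\<integral>y. of_real ?c * (cnj (bargmann_kernel w y) * bargmann_kernel z y) \<partial>lborel)"
    by (simp add: coherent_state_def bargmann_abs_l2 square_integrable_coherent_state mult.assoc)
  also have "\<dots> = of_real ?c * (of_real ?c * (exp (- of_real (pi / 2) * (\<Sum>j\<in>UNIV. (z $ j)\<^sup>2 + (cnj (w $ j))\<^sup>2)) *
     (of_real (pi powr (real CARD('n) / 2)) * exp ((\<Sum>j\<in>UNIV. (?b $ j)\<^sup>2) / 4))))"
    by (simp only: integral_mult_right_zero bargmann_kernel_product
        has_bochner_integral_integral_eq[OF Gaussian_vec])
  also have "\<dots> = of_real (?c * (?c * pi powr (real CARD('n) / 2))) *
     exp (- of_real (pi / 2) * (\<Sum>j\<in>UNIV. (z $ j)\<^sup>2 + (cnj (w $ j))\<^sup>2) + (\<Sum>j\<in>UNIV. (?b $ j)\<^sup>2) / 4)"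
    by (simp only: exp_add of_real_mult mult_ac)
  also have "\<dots> = exp (- of_real (pi / 2) * (\<Sum>j\<in>UNIV. (z $ j)\<^sup>2 + (cnj (w $ j))\<^sup>2) + (\<Sum>j\<in>UNIV. (?b $ j)\<^sup>2) / 4)"
    by (simp only: pp of_real_1 mult_1)
  \<comment> \<open>Each (?b $ j)^2 / 4 is \<pi>/2 times the square of z + cnj w in that coordinate:
    the pure squares cancel against the prefactor and the cross term survives.\<close>
  also have "- of_real (pi / 2) * (\<Sum>j\<in>UNIV. (z $ j)\<^sup>2 + (cnj (w $ j))\<^sup>2) + (\<Sum>j\<in>UNIV. (?b $ j)\<^sup>2) / 4
     = of_real pi * vec_cinner w z"
  proof -
    have "(complex_of_real (sqrt (2 * pi)))\<^sup>2 = 2 * of_real pi"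
      by (simp flip: of_real_power)
    then have "(?b $ j)\<^sup>2 / 4 = of_real (pi / 2) * ((z $ j)\<^sup>2 + (cnj (w $ j))\<^sup>2) + of_real pi * (cnj (w $ j) * z $ j)" for j
      by (simp only: vec_lambda_beta power_mult_distrib) (simp add: power2_eq_square field_simps)
    then show ?thesis
      by (simp only: sum_divide_distrib sum.distrib vec_cinner_def sum_distrib_left[symmetric])
        (simp add: sum.distrib distrib_left)
  qed
  finally show ?thesis .
qed

text \<open>At the purely imaginary points z = \<i> \<xi> / sqrt (2 pi) the transform is, up to a
  nonzero factor, the Fourier transform of f(y) exp(-|y|^2/2). That function is integrable as a
  product of two square integrable ones.\<close>

lemma bargmann_eq_0_imp:
  fixes u :: "(real^'n) l2"
  assumes "\<And>z. bargmann u z = 0"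
  shows "u = 0"
proof -
  obtain f where f: "square_integrable f" and u: "u = abs_l2 f"
    by (rule l2_cases)
  define h where "h y = f y * bargmann_kernel 0 y" for y
  have h: "integrable lborel h"
    unfolding h_def using integrable_cnj_mult[OF square_integrable_cnj[OF f] square_integrable_bargmann_kernel]
    by simp
  have "(\<integral>y. h y * exp (\<i> * of_real (\<xi> \<bullet> y)) \<partial>lborel) = 0" for \<xi> :: "real^'n"
  proof -
    let ?z = "(\<chi> j. \<i> * of_real (\<xi> $ j / sqrt (2 * pi))) :: complex^'n"
    have "of_real (sqrt (2 * pi)) * (\<Sum>j\<in>UNIV. of_real (y $ j) * ?z $ j) = \<i> * of_real (\<xi> \<bullet> y)" for y
      by (simp add: inner_vec_def sum_distrib_left mult_ac)
    then have "h y * exp (\<i> * of_real (\<xi> \<bullet> y)) =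
       exp (of_real (pi / 2) * (\<Sum>j\<in>UNIV. (?z $ j)\<^sup>2)) * (f y * bargmann_kernel ?z y)" for y
      unfolding h_def bargmann_kernel_def
      by (simp only: mult.left_commute[of _ "f y"] mult.assoc exp_add[symmetric])
        (simp add: algebra_simps)
    then have "(\<integral>y. h y * exp (\<i> * of_real (\<xi> \<bullet> y)) \<partial>lborel) =
       exp (of_real (pi / 2) * (\<Sum>j\<in>UNIV. (?z $ j)\<^sup>2)) * (\<integral>y. f y * bargmann_kernel ?z y \<partial>lborel)"
      by (simp only: integral_mult_right_zero)
    also have "(\<integral>y. f y * bargmann_kernel ?z y \<partial>lborel) = 0"
      using assms[of ?z] f by (simp add: u bargmann_abs_l2)
    finally show ?thesis
      by simp
  qed
  with h have "AE y in lborel. h y = 0"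
    by (rule Fourier_zero_imp_AE_zero)
  then have "AE y in lborel. f y = 0"
    by eventually_elim (simp add: h_def bargmann_kernel_def)
  then show ?thesis
    using f by (simp add: u zero_l2_def abs_l2_eq_iff square_integrable_zero)
qed

section \<open>Density of the coherent states\<close>

lemma subspace_closure:
  fixes S :: "'a::real_normed_vector set"
  assumes "subspace S"
  shows "subspace (closure S)"
proof (rule subspaceI)
  show "0 \<in> closure S"
    using closure_subset[of S] subspace_0[OF assms] by (rule subsetD)
  show "x + y \<in> closure S" if xy: "x \<in> closure S" "y \<in> closure S" for x y
  proof -
    obtain X Y where X: "\<And>n. X n \<in> S" "X \<longlonglongrightarrow> x" and Y: "\<And>n. Y n \<in> S" "Y \<longlonglongrightarrow> y"
      using xy unfolding closure_sequential by blast
    have "(\<lambda>n. X n + Y n) \<longlonglongrightarrow> x + y"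
      using X(2) Y(2) by (rule tendsto_add)
    moreover have "X n + Y n \<in> S" for n
      using X(1) Y(1) by (intro subspace_add[OF assms])
    ultimately show ?thesis
      unfolding closure_sequential by (intro exI[of _ "\<lambda>n. X n + Y n"]) simp
  qed
  show "c *\<^sub>R x \<in> closure S" if x: "x \<in> closure S" for x c
  proof -
    obtain X where X: "\<And>n. X n \<in> S" "X \<longlonglongrightarrow> x"
      using x unfolding closure_sequential by blast
    have "(\<lambda>n. c *\<^sub>R X n) \<longlonglongrightarrow> c *\<^sub>R x"
      using tendsto_const X(2) by (rule tendsto_scaleR)
    moreover have "c *\<^sub>R X n \<in> S" for n
      using X(1) by (intro subspace_mul[OF assms])
    ultimately show ?thesis
      unfolding closure_sequential by (intro exI[of _ "\<lambda>n. c *\<^sub>R X n"]) simp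
  qed
qed

text \<open>\<open>span\<close> is the real span; admitting all complex multiples as generators
  makes it the complex one.\<close>

definition coherent_span :: "(real^'n) l2 set" where
  "coherent_span = span (range (\<lambda>(c, w). c *\<^sub>C coherent_state w))"

lemma closure_coherent_span: "closure (coherent_span :: (real^'n) l2 set) = UNIV"
proof (intro equalityI subset_UNIV subsetI)
  fix x :: "(real^'n) l2"
  have sub: "subspace (closure (coherent_span :: (real^'n) l2 set))"
    unfolding coherent_span_def by (intro subspace_closure subspace_span)
  obtain p where p: "p \<in> closure coherent_span"
    and orth: "\<And>y. y \<in> closure coherent_span \<Longrightarrow> inner (x - p) y = 0"
    using orthogonal_projection_exists[OF sub closed_closure] by blast
  have Re0: "Re (l2_cinner (c *\<^sub>C coherent_state w) (x - p)) = 0" for c w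
  proof -
    have "c *\<^sub>C coherent_state w \<in> coherent_span"
      unfolding coherent_span_def by (rule span_base) force
    then have "inner (x - p) (c *\<^sub>C coherent_state w) = 0"
      using closure_subset by (intro orth) blast
    then show ?thesis
      by (metis inner_l2_def inner_commute)
  qed
  \<comment> \<open>The projection gives orthogonality for the real inner product only. The
    multiples 1 and \<i> of a coherent state recover the real and the imaginary part of the complex
    product.\<close>
  have "bargmann (x - p) z = 0" for z
    using Re0[of 1 z] Re0[of \<i> z]
    by (simp add: l2_cinner_scaleC_left complex_eq_iff flip: l2_cinner_coherent_state)
  then have "x = p"
    using bargmann_eq_0_imp by fastforce
  with p show "x \<in> closure coherent_span"
    by simp
qed

section \<open>The Segal-Bargmann space\<close>

lemma vec_cinner_add_left: "vec_cinner (v + w) z = vec_cinner v z + vec_cinner w z"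
  by (simp add: vec_cinner_def distrib_right sum.distrib)

lemma vec_cinner_add_right: "vec_cinner z (v + w) = vec_cinner z v + vec_cinner z w"
  by (simp add: vec_cinner_def distrib_left sum.distrib)

lemma vec_cinner_scale_left: "vec_cinner (c *s v) z = cnj c * vec_cinner v z"
  by (simp add: vec_cinner_def sum_distrib_left mult.assoc)

lemma vec_cinner_scale_right: "vec_cinner v (c *s z) = c * vec_cinner v z"
  by (simp add: vec_cinner_def sum_distrib_left mult.left_commute)

lemma vec_cinner_commute: "vec_cinner w v = cnj (vec_cinner v w)"
  by (simp add: vec_cinner_def mult.commute)

lemma vec_cinner_zero [simp]: "vec_cinner 0 z = 0" "vec_cinner z 0 = 0"
  by (simp_all add: vec_cinner_def)

lemma vec_cinner_self: "vec_cinner z z = complex_of_real ((norm z)\<^sup>2)"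
  by (simp add: vec_cinner_def norm_vec_def L2_set_def sum_nonneg complex_norm_square mult.commute
      flip: of_real_power)

lemma Re_vec_cinner: "Re (vec_cinner v z) = inner v z"
  by (simp add: vec_cinner_def inner_vec_def inner_complex_def)

lemma vec_cinner_Cauchy_Schwarz: "cmod (vec_cinner v z) \<le> norm v * norm z"
proof -
  have "cmod (vec_cinner v z) \<le> (\<Sum>j\<in>UNIV. \<bar>cmod (v $ j)\<bar> * \<bar>cmod (z $ j)\<bar>)"
    unfolding vec_cinner_def by (rule order_trans[OF norm_sum]) (simp add: norm_mult)
  also have "\<dots> \<le> norm v * norm z"
    unfolding norm_vec_def by (rule L2_set_mult_ineq)
  finally show ?thesis .
qed

lemma norm_vec_scale: "norm (c *s z) = cmod c * norm z" for z :: "complex^'n"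
  by (simp add: norm_vec_def norm_mult L2_set_right_distrib)

lemma scaleR_vec_scale: "r *\<^sub>R z = of_real r *s z" for z :: "complex^'n"
  by (simp add: vec_eq_iff scaleR_conv_of_real[symmetric])

lemma linear_vec_scale: "linear ((*s) c :: complex^'n \<Rightarrow> complex^'n)"
  by (rule linearI) (simp_all add: vec_eq_iff algebra_simps)

lemma linear_matrix_vector: "linear ((*v) A)" for A :: "complex^'n^'m"
  by (rule linearI) (simp_all add: matrix_vector_right_distrib scaleR_vec_scale vector_scalar_commute)

lemma bounded_linear_vec_cinner: "bounded_linear (vec_cinner v)"
  by (rule bounded_linear_intro[where K = "norm v"])
    (use vec_cinner_Cauchy_Schwarz[of v] in
      \<open>auto simp: vec_cinner_add_right scaleR_vec_scale vec_cinner_scale_right scaleR_conv_of_real mult.commute\<close>)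

subsection \<open>Entire functions\<close>

lemma entire_holomorphicE:
  assumes "entire_holomorphic F"
  obtains D where "(F has_derivative D) (at z)" "\<And>c h. D (c *s h) = c * D h"
  using assms unfolding entire_holomorphic_def by blast

lemma entire_holomorphicI:
  assumes "\<And>z. (F has_derivative D z) (at z)" "\<And>z c h. D z (c *s h) = c * D z h"
  shows "entire_holomorphic F"
  using assms unfolding entire_holomorphic_def by blast

lemma entire_holomorphic_continuous_on: "entire_holomorphic F \<Longrightarrow> continuous_on A F"
  by (metis continuous_at_imp_continuous_on entire_holomorphicE has_derivative_continuous)

lemma entire_holomorphic_measurable: "entire_holomorphic F \<Longrightarrow> F \<in> borel_measurable borel"
  by (intro borel_measurable_continuous_onI entire_holomorphic_continuous_on)

lemma entire_holomorphic_const: "entire_holomorphic (\<lambda>z. c)"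
  by (rule entire_holomorphicI[where D = "\<lambda>z h. 0"]) auto

lemma entire_holomorphic_add:
  assumes "entire_holomorphic F" "entire_holomorphic G"
  shows "entire_holomorphic (\<lambda>z. F z + G z)"
  unfolding entire_holomorphic_def
proof
  fix z
  obtain D where D: "(F has_derivative D) (at z)" "\<And>c h. D (c *s h) = c * D h"
    using assms(1) by (rule entire_holomorphicE) blast
  obtain E where E: "(G has_derivative E) (at z)" "\<And>c h. E (c *s h) = c * E h"
    using assms(2) by (rule entire_holomorphicE) blast
  show "\<exists>D. ((\<lambda>z. F z + G z) has_derivative D) (at z) \<and> (\<forall>c h. D (c *s h) = c * D h)"
    by (rule exI, rule conjI, rule has_derivative_add[OF D(1) E(1)])
      (simp add: D(2) E(2) distrib_left)
qed

lemma entire_holomorphic_mult: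
  assumes "entire_holomorphic F" "entire_holomorphic G"
  shows "entire_holomorphic (\<lambda>z. F z * G z)"
  unfolding entire_holomorphic_def
proof
  fix z
  obtain D where D: "(F has_derivative D) (at z)" "\<And>c h. D (c *s h) = c * D h"
    using assms(1) by (rule entire_holomorphicE) blast
  obtain E where E: "(G has_derivative E) (at z)" "\<And>c h. E (c *s h) = c * E h"
    using assms(2) by (rule entire_holomorphicE) blast
  show "\<exists>D. ((\<lambda>z. F z * G z) has_derivative D) (at z) \<and> (\<forall>c h. D (c *s h) = c * D h)"
    by (rule exI, rule conjI, rule has_derivative_mult[OF D(1) E(1)])
      (simp add: D(2) E(2) algebra_simps)
qed

lemma entire_holomorphic_exp:
  assumes "entire_holomorphic F"
  shows "entire_holomorphic (\<lambda>z. exp (F z))"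
  unfolding entire_holomorphic_def
proof
  fix z
  obtain D where D: "(F has_derivative D) (at z)" "\<And>c h. D (c *s h) = c * D h"
    using assms by (rule entire_holomorphicE) blast
  have "((\<lambda>z. exp (F z)) has_derivative (\<lambda>h. exp (F z) * D h)) (at z)"
    by (rule has_derivative_compose[OF D(1) DERIV_exp[of "F z", unfolded has_field_derivative_def]])
  then show "\<exists>D. ((\<lambda>z. exp (F z)) has_derivative D) (at z) \<and> (\<forall>c h. D (c *s h) = c * D h)"
    by (intro exI[of _ "\<lambda>h. exp (F z) * D h"]) (simp add: D(2))
qed

lemma entire_holomorphic_power: "entire_holomorphic F \<Longrightarrow> entire_holomorphic (\<lambda>z. F z ^ n)"
  by (induction n) (auto intro: entire_holomorphic_const entire_holomorphic_mult)

lemma entire_holomorphic_sum: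
  "(\<And>i. i \<in> I \<Longrightarrow> entire_holomorphic (F i)) \<Longrightarrow> entire_holomorphic (\<lambda>z. \<Sum>i\<in>I. F i z)"
  by (induction I rule: infinite_finite_induct)
    (auto intro: entire_holomorphic_const entire_holomorphic_add)

lemma entire_holomorphic_vec_cinner: "entire_holomorphic (vec_cinner v)"
  by (rule entire_holomorphicI[where D = "\<lambda>z. vec_cinner v"])
    (auto intro: bounded_linear_imp_has_derivative bounded_linear_vec_cinner simp: vec_cinner_scale_right)

lemma entire_holomorphic_compose_affine:
  fixes A :: "complex^'n^'n"
  assumes "entire_holomorphic F"
  shows "entire_holomorphic (\<lambda>z. F (A *v z + w))"
  unfolding entire_holomorphic_def
proof
  fix z
  obtain D where D: "(F has_derivative D) (at (A *v z + w))" "\<And>c h. D (c *s h) = c * D h"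
    using assms by (rule entire_holomorphicE) blast
  have "((\<lambda>z. A *v z + w) has_derivative (\<lambda>h. A *v h + 0)) (at z)"
    by (intro has_derivative_add has_derivative_const bounded_linear_imp_has_derivative
        linear_conv_bounded_linear[THEN iffD1] linear_matrix_vector)
  from has_derivative_compose[OF this D(1)]
  show "\<exists>D. ((\<lambda>z. F (A *v z + w)) has_derivative D) (at z) \<and> (\<forall>c h. D (c *s h) = c * D h)"
    by (intro exI[of _ "\<lambda>h. D (A *v h)"]) (simp add: D(2) vector_scalar_commute)
qed

lemma entire_holomorphic_restrict_line:
  assumes "entire_holomorphic F"
  shows "(\<lambda>t. F (t *s z)) holomorphic_on UNIV"
  unfolding holomorphic_on_def
proof
  fix t :: complex
  obtain D where D: "(F has_derivative D) (at (t *s z))" "\<And>c h. D (c *s h) = c * D h"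
    using assms by (rule entire_holomorphicE) blast
  have "linear (\<lambda>t. t *s z)"
    by (rule linearI) (simp_all add: vec_eq_iff algebra_simps)
  then have "((\<lambda>t. t *s z) has_derivative (\<lambda>t. t *s z)) (at t)"
    by (intro bounded_linear_imp_has_derivative) (simp add: linear_conv_bounded_linear)
  from has_derivative_compose[OF this D(1)]
  have "((\<lambda>t. F (t *s z)) has_field_derivative D z) (at t)"
    by (simp add: has_field_derivative_def D(2) mult_commute_abs)
  then show "(\<lambda>t. F (t *s z)) field_differentiable at t within UNIV"
    by (auto simp: field_differentiable_def)
qed

text \<open>Cauchy's formula for f(u) / u on the unit circle: the derivative of the parametrisation
  contributes a factor u that cancels the denominator.\<close>

lemma holomorphic_circle_average:
  assumes "f holomorphic_on UNIV"
  shows "(LINT t:{0..1}|lborel. f (exp (2 * of_real pi * \<i> * of_real t))) = f 0"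
proof -
  let ?e = "\<lambda>t. exp (2 * of_real pi * \<i> * of_real t)"
  have "((\<lambda>u. f u / (u - 0)) has_contour_integral (2 * of_real pi * \<i> * f 0)) (circlepath 0 1)"
    by (rule Cauchy_integral_circlepath_simple) (use assms holomorphic_on_subset in auto)
  then have "((\<lambda>t. f (?e t) / ?e t * (2 * of_real pi * \<i> * ?e t)) has_integral (2 * of_real pi * \<i> * f 0)) {0..1}"
    by (simp only: has_contour_integral vector_derivative_circlepath) (simp add: circlepath mult_ac)
  then have "((\<lambda>t. (1 / (2 * of_real pi * \<i>)) * (f (?e t) / ?e t * (2 * of_real pi * \<i> * ?e t))) has_integral
      (1 / (2 * of_real pi * \<i>)) * (2 * of_real pi * \<i> * f 0)) {0..1}"
    by (rule has_integral_mult_right)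
  then have "((\<lambda>t. f (?e t)) has_integral f 0) {0..1}"
    by (simp add: mult_ac)
  moreover have "continuous_on UNIV f"
    using assms by (rule holomorphic_on_imp_continuous_on)
  then have "continuous_on {0..1} (\<lambda>t. f (?e t))"
    by (rule continuous_on_compose2) (auto intro!: continuous_intros)
  then have "set_integrable lborel {0..1} (\<lambda>t. f (?e t))"
    unfolding set_integrable_def by (intro borel_integrable_compact) auto
  ultimately show ?thesis
    by (simp only: set_borel_integral_eq_integral(2) integral_unique)
qed

lemma Gaussian_mean_value:
  fixes G :: "complex^'n \<Rightarrow> complex"
  assumes G: "entire_holomorphic G"
    and int: "integrable lborel (\<lambda>z. G z * of_real (exp (- pi * (norm z)\<^sup>2)))"
  shows "(\<integral>z. G z * of_real (exp (- pi * (norm z)\<^sup>2)) \<partial>lborel) = G 0"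
proof -
  let ?e = "\<lambda>t::real. exp (2 * complex_of_real pi * \<i> * of_real t)"
  let ?g = "\<lambda>z::complex^'n. complex_of_real (exp (- pi * (norm z)\<^sup>2))"
  let ?f = "\<lambda>t z. indicator {0..1::real} t *\<^sub>R (G (?e t *s z) * ?g z)"
  have norm_e: "cmod (?e t) = 1" for t
    by (simp add: norm_exp_eq_Re)
  have Gm [measurable]: "G \<in> borel_measurable borel"
    using G by (rule entire_holomorphic_measurable)
  have cont: "continuous_on UNIV (\<lambda>p::real \<times> (complex^'n). G (?e (fst p) *s snd p))"
    by (rule continuous_on_compose2[OF entire_holomorphic_continuous_on[OF G, of UNIV]])
      (auto simp: vector_scalar_mult_def intro!: continuous_intros)
  have [measurable]: "(\<lambda>p::real \<times> (complex^'n). G (?e (fst p) *s snd p)) \<in> borel_measurable borel"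
    using cont by (rule borel_measurable_continuous_onI)
  have [measurable]: "(\<lambda>p::real \<times> (complex^'n). G (?e (fst p) *s snd p)) \<in> borel_measurable (borel \<Otimes>\<^sub>M borel)"
    by (subst borel_prod) measurable
  have g_rot: "?g (?e t *s z) = ?g z" for t z
    by (simp add: norm_vec_scale norm_e)
  \<comment> \<open>Multiplication by a unimodular scalar is a linear isometry, so it preserves
    Lebesgue measure as well as the Gaussian weight.\<close>
  have rot_int: "integrable lborel (\<lambda>z. G (?e t *s z) * ?g z)"
    and rot_eq: "(\<integral>z. G (?e t *s z) * ?g z \<partial>lborel) = (\<integral>z. G z * ?g z \<partial>lborel)"
    and rot_norm: "(\<integral>z. norm (G (?e t *s z) * ?g z) \<partial>lborel) = (\<integral>z. norm (G z * ?g z) \<partial>lborel)" for t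
  proof -
    note iso = integrable_isometry_iff[of "(*s) (?e t)", OF linear_vec_scale]
    have n: "norm (?e t *s z) = norm z" for z :: "complex^'n"
      by (simp add: norm_vec_scale norm_e)
    show "integrable lborel (\<lambda>z. G (?e t *s z) * ?g z)"
      using iso(1)[of "\<lambda>z. G z * ?g z"] int n g_rot by simp
    show "(\<integral>z. G (?e t *s z) * ?g z \<partial>lborel) = (\<integral>z. G z * ?g z \<partial>lborel)"
      using iso(2)[of "\<lambda>z. G z * ?g z"] n g_rot by simp
    show "(\<integral>z. norm (G (?e t *s z) * ?g z) \<partial>lborel) = (\<integral>z. norm (G z * ?g z) \<partial>lborel)"
      using iso(2)[of "\<lambda>z. norm (G z * ?g z)"] n g_rot by simp
  qed
  \<comment> \<open>The integral of the modulus over z is the same for every rotation, so the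
    iterated integral over the unit interval is finite and Fubini applies.\<close>
  have "integrable (lborel \<Otimes>\<^sub>M lborel) (\<lambda>(t, z). ?f t z)"
  proof (rule lborel_pair.Fubini_integrable)
    show "(\<lambda>(t, z). ?f t z) \<in> borel_measurable (lborel \<Otimes>\<^sub>M lborel)"
      unfolding case_prod_beta by measurable
    have "(\<lambda>t. \<integral>z. norm (case (t, z) of (t, z) \<Rightarrow> ?f t z) \<partial>lborel) =
       (\<lambda>t. indicator {0..1} t *\<^sub>R (\<integral>z. norm (G z * ?g z) \<partial>lborel))"
      using rot_norm by (auto simp: fun_eq_iff split: split_indicator)
    then show "integrable lborel (\<lambda>t. \<integral>z. norm (case (t, z) of (t, z) \<Rightarrow> ?f t z) \<partial>lborel)"
      by simp
    show "AE t in lborel. integrable lborel (\<lambda>z. case (t, z) of (t, z) \<Rightarrow> ?f t z)"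
      using rot_int by auto
  qed
  then have "(\<integral>z. (\<integral>t. ?f t z \<partial>lborel) \<partial>lborel) = (\<integral>t. (\<integral>z. ?f t z \<partial>lborel) \<partial>lborel)"
    by (rule lborel_pair.Fubini_integral)
  also have "(\<integral>t. (\<integral>z. ?f t z \<partial>lborel) \<partial>lborel) =
      (\<integral>t. indicator {0..1::real} t *\<^sub>R (\<integral>z. G z * ?g z \<partial>lborel) \<partial>lborel)"
    by (simp only: integral_scaleR_right rot_eq)
  also have "\<dots> = (\<integral>z. G z * ?g z \<partial>lborel)"
    by simp
  also have "(\<integral>t. ?f t z \<partial>lborel) = G 0 * ?g z" for z
  proof -
    have "(\<integral>t. ?f t z \<partial>lborel) = (LINT t:{0..1}|lborel. G (?e t *s z)) * ?g z"
      unfolding set_lebesgue_integral_def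
      by (simp only: mult_scaleR_left[symmetric] integral_mult_left_zero)
    also have "\<dots> = G 0 * ?g z"
      using holomorphic_circle_average[OF entire_holomorphic_restrict_line[OF G, of z]] by simp
    finally show ?thesis .
  qed
  then have "(\<integral>z. (\<integral>t. ?f t z \<partial>lborel) \<partial>lborel) = (\<integral>z. G 0 * ?g z \<partial>lborel)"
    by simp
  also have "\<dots> = G 0"
    using integral_Gaussian_pi[where 'a = "complex^'n"]
    by (simp only: integral_mult_right_zero integral_complex_of_real) simp
  finally show ?thesis
    by simp
qed

subsection \<open>Embedding into the square integrable functions\<close>

definition sb_l2 :: "(complex^'n \<Rightarrow> complex) \<Rightarrow> (complex^'n) l2" where
  "sb_l2 F = abs_l2 (\<lambda>z. F z * of_real (exp (- (pi / 2) * (norm z)\<^sup>2)))"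

lemma exp_half_square: "exp (- (pi / 2) * r) * exp (- (pi / 2) * r) = exp (- pi * r)"
  by (simp flip: exp_add)

lemma cmod_Gaussian_weight_power2:
  "(cmod (a * of_real (exp (- (pi / 2) * r))))\<^sup>2 = (cmod a)\<^sup>2 * exp (- pi * r)"
  by (simp add: norm_mult power_mult_distrib power2_eq_square[of "exp _"] exp_half_square[simplified])

lemma segal_bargmann_entire: "F \<in> segal_bargmann \<Longrightarrow> entire_holomorphic F"
  by (simp add: segal_bargmann_def)

lemma square_integrable_segal_bargmann:
  assumes "F \<in> segal_bargmann"
  shows "square_integrable (\<lambda>z. F z * of_real (exp (- (pi / 2) * (norm z)\<^sup>2)))"
proof -
  have [measurable]: "F \<in> borel_measurable borel"
    using assms by (intro entire_holomorphic_measurable segal_bargmann_entire)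
  show ?thesis
    unfolding square_integrable_def cmod_Gaussian_weight_power2
    using assms by (auto simp: segal_bargmann_def)
qed

lemma segal_bargmannI:
  assumes "entire_holomorphic F"
    and "square_integrable (\<lambda>z. F z * of_real (exp (- (pi / 2) * (norm z)\<^sup>2)))"
  shows "F \<in> segal_bargmann"
  using assms unfolding square_integrable_def cmod_Gaussian_weight_power2 by (simp add: segal_bargmann_def)

lemma segal_bargmann_integrand:
  "cnj (F z) * G z * of_real (exp (- pi * (norm z)\<^sup>2)) =
     cnj (F z * of_real (exp (- (pi / 2) * (norm z)\<^sup>2))) * (G z * of_real (exp (- (pi / 2) * (norm z)\<^sup>2)))"
  by (subst exp_half_square[symmetric]) (simp add: mult_ac)

lemma segal_bargmann_cinner_sb_l2:
  assumes "F \<in> segal_bargmann" "G \<in> segal_bargmann"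
  shows "segal_bargmann_cinner F G = l2_cinner (sb_l2 F) (sb_l2 G)"
  using assms by (simp only: segal_bargmann_cinner_def segal_bargmann_integrand sb_l2_def abs_l2_cinner
      square_integrable_segal_bargmann)

lemma segal_bargmann_cinner_integrable:
  assumes "F \<in> segal_bargmann" "G \<in> segal_bargmann"
  shows "integrable lborel (\<lambda>z. cnj (F z) * G z * of_real (exp (- pi * (norm z)\<^sup>2)))"
  unfolding segal_bargmann_integrand
  by (rule integrable_cnj_mult[OF assms[THEN square_integrable_segal_bargmann]])

lemma segal_bargmann_add:
  assumes "F \<in> segal_bargmann" "G \<in> segal_bargmann"
  shows "(\<lambda>z. F z + G z) \<in> segal_bargmann"
  using square_integrable_add[OF assms[THEN square_integrable_segal_bargmann]]
  by (intro segal_bargmannI[OF entire_holomorphic_add[OF assms[THEN segal_bargmann_entire]]])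
    (simp only: distrib_right)

lemma segal_bargmann_scale:
  assumes "F \<in> segal_bargmann"
  shows "(\<lambda>z. c * F z) \<in> segal_bargmann"
  using square_integrable_scale[OF assms[THEN square_integrable_segal_bargmann], of c]
  by (intro segal_bargmannI[OF entire_holomorphic_mult[OF entire_holomorphic_const
          assms[THEN segal_bargmann_entire]]]) (simp only: mult.assoc)

lemma sb_l2_add:
  assumes "F \<in> segal_bargmann" "G \<in> segal_bargmann"
  shows "sb_l2 (\<lambda>z. F z + G z) = sb_l2 F + sb_l2 G"
  using assms[THEN square_integrable_segal_bargmann] by (simp add: sb_l2_def abs_l2_add distrib_right)

lemma sb_l2_scale:
  assumes "F \<in> segal_bargmann"
  shows "sb_l2 (\<lambda>z. c * F z) = c *\<^sub>C sb_l2 F"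
  using assms[THEN square_integrable_segal_bargmann] by (simp add: sb_l2_def abs_l2_scaleC mult.assoc)

lemma segal_bargmann_exp_bound:
  assumes "entire_holomorphic F" and F: "\<And>z. cmod (F z) \<le> K * exp (C * norm z)"
  shows "F \<in> segal_bargmann"
proof -
  have [measurable]: "F \<in> borel_measurable borel"
    using assms(1) by (rule entire_holomorphic_measurable)
  have "integrable lborel (\<lambda>z::complex^'a. (cmod (F z))\<^sup>2 * exp (- pi * (norm z)\<^sup>2))"
  proof (rule Bochner_Integration.integrable_bound)
    show "integrable lborel (\<lambda>z::complex^'a. K\<^sup>2 * exp ((2 * C) * norm z - pi * (norm z)\<^sup>2))"
      by (intro integrable_mult_right integrable_exp_linear_Gaussian) simp
    have "(cmod (F z))\<^sup>2 * exp (- pi * (norm z)\<^sup>2) \<le> K\<^sup>2 * exp ((2 * C) * norm z - pi * (norm z)\<^sup>2)" for z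
    proof -
      have "(cmod (F z))\<^sup>2 * exp (- pi * (norm z)\<^sup>2) \<le> (K * exp (C * norm z))\<^sup>2 * exp (- pi * (norm z)\<^sup>2)"
        using F[of z] by (intro mult_right_mono power_mono) auto
      also have "\<dots> = K\<^sup>2 * exp ((2 * C) * norm z - pi * (norm z)\<^sup>2)"
        by (simp add: power_mult_distrib exp_diff exp_minus field_simps flip: exp_double)
      finally show ?thesis .
    qed
    then show "AE z::complex^'a in lborel. norm ((cmod (F z))\<^sup>2 * exp (- pi * (norm z)\<^sup>2))
      \<le> norm (K\<^sup>2 * exp ((2 * C) * norm z - pi * (norm z)\<^sup>2))"
      by (intro AE_I2) (auto simp: abs_mult)
  qed measurable
  with assms(1) show ?thesis
    by (simp add: segal_bargmann_def)
qed

definition reproducing_kernel :: "complex^'n \<Rightarrow> complex^'n \<Rightarrow> complex" where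
  "reproducing_kernel w z = exp (of_real pi * vec_cinner w z)"

lemma reproducing_kernel_segal_bargmann: "reproducing_kernel w \<in> segal_bargmann"
proof (rule segal_bargmann_exp_bound)
  show "entire_holomorphic (reproducing_kernel w)"
    unfolding reproducing_kernel_def
    by (intro entire_holomorphic_exp entire_holomorphic_mult entire_holomorphic_const entire_holomorphic_vec_cinner)
  show "cmod (reproducing_kernel w z) \<le> 1 * exp ((pi * norm w) * norm z)" for z
    using order_trans[OF complex_Re_le_cmod vec_cinner_Cauchy_Schwarz[of w z]]
    by (simp add: reproducing_kernel_def mult.assoc)
qed

lemma integral_translate:
  fixes f :: "'a::euclidean_space \<Rightarrow> 'b::{banach, second_countable_topology}"
  assumes f: "f \<in> borel_measurable borel"
  shows "(\<integral>x. f (x + t) \<partial>lborel) = (\<integral>x. f x \<partial>lborel)"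
    and "integrable lborel (\<lambda>x. f (x + t)) \<longleftrightarrow> integrable lborel f"
proof -
  note d = lborel_distr_plus[of t]
  show "(\<integral>x. f (x + t) \<partial>lborel) = (\<integral>x. f x \<partial>lborel)"
    by (subst (2) d[symmetric], subst integral_distr) (use f in \<open>auto simp: add.commute\<close>)
  show "integrable lborel (\<lambda>x. f (x + t)) \<longleftrightarrow> integrable lborel f"
    by (subst (2) d[symmetric], subst integrable_distr_eq) (use f in \<open>auto simp: add.commute\<close>)
qed

text \<open>After the translation z \<mapsto> z + w, the conjugated kernel times the weight becomes
  exp(-\<pi> <w,z>) exp(-\<pi>|z|^2): all antiholomorphic terms cancel. What multiplies the centred
  Gaussian is the entire function \<open>G\<close>, and its mean value G 0 is F w.\<close>

lemma segal_bargmann_reproducing: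
  assumes F: "F \<in> segal_bargmann"
  shows "segal_bargmann_cinner (reproducing_kernel w) F = F w"
proof -
  define H where "H z = cnj (reproducing_kernel w z) * F z * of_real (exp (- pi * (norm z)\<^sup>2))" for z
  define G where "G z = F (z + w) * exp (- of_real pi * vec_cinner w z)" for z
  have Hint: "integrable lborel H"
    unfolding H_def by (rule segal_bargmann_cinner_integrable[OF reproducing_kernel_segal_bargmann F])
  then have Hm: "H \<in> borel_measurable borel"
    by auto
  have HG: "H (z + w) = G z * of_real (exp (- pi * (norm z)\<^sup>2))" for z
  proof -
    have n: "complex_of_real (exp (- pi * (norm x)\<^sup>2)) = exp (- of_real pi * vec_cinner x x)" for x :: "complex^'a"
      by (simp only: vec_cinner_self of_real_mult[symmetric] of_real_minus[symmetric] exp_of_real)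
    show ?thesis
      unfolding H_def G_def n reproducing_kernel_def exp_cnj
      by (simp only: mult.left_commute[of _ "F _"] mult.assoc exp_add[symmetric] complex_cnj_mult complex_cnj_add
          complex_cnj_complex_of_real vec_cinner_commute[symmetric] vec_cinner_add_left vec_cinner_add_right)
        (simp add: algebra_simps)
  qed
  have "entire_holomorphic (\<lambda>z. F (mat 1 *v z + w))"
    by (rule entire_holomorphic_compose_affine[OF segal_bargmann_entire[OF F]])
  then have G: "entire_holomorphic G"
    unfolding G_def
    by (intro entire_holomorphic_exp entire_holomorphic_mult entire_holomorphic_const entire_holomorphic_vec_cinner)
      simp
  have "(\<integral>z. H z \<partial>lborel) = (\<integral>z. G z * of_real (exp (- pi * (norm z)\<^sup>2)) \<partial>lborel)"
    using integral_translate(1)[OF Hm, of w] by (simp only: HG)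
  also have "\<dots> = G 0"
    using integral_translate(2)[OF Hm, of w] Hint
    by (intro Gaussian_mean_value[OF G]) (simp only: HG)
  finally show ?thesis
    by (simp add: segal_bargmann_cinner_def H_def G_def)
qed

section \<open>Unitarity of the Bargmann transform\<close>

lemma has_derivative_quadratic_bound:
  fixes f :: "'a::real_normed_vector \<Rightarrow> 'b::real_normed_vector"
  assumes D: "bounded_linear D"
    and le: "\<And>h. norm h \<le> 1 \<Longrightarrow> norm (f (z + h) - f z - D h) \<le> M * (norm h)\<^sup>2"
  shows "(f has_derivative D) (at z)"
  unfolding has_derivative_iff_norm
proof (rule conjI[OF D], rule Lim_null_comparison)
  show "\<forall>\<^sub>F y in at z. norm (norm (f y - f z - D (y - z)) / norm (y - z)) \<le> M * norm (y - z)"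
    unfolding eventually_at
  proof (intro exI[of _ 1] conjI ballI impI)
    fix y assume y: "y \<noteq> z \<and> dist y z < 1"
    then have "norm (f y - f z - D (y - z)) \<le> M * (norm (y - z))\<^sup>2"
      using le[of "y - z"] by (simp add: dist_norm)
    then show "norm (norm (f y - f z - D (y - z)) / norm (y - z)) \<le> M * norm (y - z)"
      using y by (simp add: divide_le_eq power2_eq_square mult.assoc)
  qed simp
  have "((\<lambda>y. M * norm (y - z)) \<longlongrightarrow> M * norm (z - z)) (at z)"
    by (intro tendsto_intros)
  then show "((\<lambda>y. M * norm (y - z)) \<longlongrightarrow> 0) (at z)"
    by simp
qed

lemma cmod_exp_minus_linear_le: "cmod (exp a - 1 - a) \<le> (cmod a)\<^sup>2 * exp (cmod a)" for a :: complex
  using Taylor_exp_field[of a 1] by (simp add: power2_eq_square diff_diff_eq mult.commute)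

definition real_complex_pairing :: "real^'n \<Rightarrow> complex^'n \<Rightarrow> complex" where
  "real_complex_pairing y z = (\<Sum>j\<in>UNIV. of_real (y $ j) * z $ j)"

lemma real_complex_pairing_eq: "real_complex_pairing y z = vec_cinner (\<chi> j. of_real (y $ j)) z"
  by (simp add: real_complex_pairing_def vec_cinner_def)

lemma norm_of_real_vec: "norm ((\<chi> j. of_real (y $ j)) :: complex^'n) = norm y"
  by (simp add: norm_vec_def)

lemma cmod_real_complex_pairing_le: "cmod (real_complex_pairing y z) \<le> norm y * norm z"
  using vec_cinner_Cauchy_Schwarz[of "\<chi> j. of_real (y $ j)" z]
  by (simp add: real_complex_pairing_eq norm_of_real_vec)

lemma real_complex_pairing_measurable [measurable]:
  "(\<lambda>y. real_complex_pairing y z) \<in> borel_measurable borel"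
  unfolding real_complex_pairing_def by (intro borel_measurable_continuous_onI continuous_intros)

text \<open>Differentiation under the integral sign. The remainder is quadratic in \<open>h\<close>
  with an integrable coefficient, because exp a - 1 - a is bounded by |a|^2 exp |a| and
  \<open>g\<close> is integrable against every exponential weight.\<close>

lemma entire_holomorphic_Laplace:
  fixes g :: "real^'n \<Rightarrow> complex"
  assumes g [measurable]: "g \<in> borel_measurable borel"
    and int: "\<And>C. integrable lborel (\<lambda>y. cmod (g y) * exp (C * norm y))"
  shows "entire_holomorphic (\<lambda>z. \<integral>y. g y * exp (of_real c * real_complex_pairing y z) \<partial>lborel)"
proof -
  let ?l = "\<lambda>y z. of_real c * real_complex_pairing y z"
  have l_le: "cmod (?l y z) \<le> \<bar>c\<bar> * norm z * norm y" for y z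
    using mult_left_mono[OF cmod_real_complex_pairing_le[of y z], of "\<bar>c\<bar>"]
    by (simp add: norm_mult mult_ac)
  have l_add: "?l y (z + h) = ?l y z + ?l y h" and l_scale: "?l y (a *s z) = a * ?l y z" for y z h a
    by (simp_all add: real_complex_pairing_eq vec_cinner_add_right vec_cinner_scale_right distrib_left)
  have exp_le: "cmod (exp (?l y z)) \<le> exp (\<bar>c\<bar> * norm z * norm y)" for y z
    using l_le[of y z] complex_Re_le_cmod[of "?l y z"] unfolding norm_exp_eq_Re exp_le_cancel_iff
    by linarith
  have int0: "integrable lborel (\<lambda>y. g y * exp (?l y z))" for z
    by (rule Bochner_Integration.integrable_bound[OF int[of "\<bar>c\<bar> * norm z"]])
      (auto simp: norm_mult intro!: mult_left_mono exp_le[of _ z, simplified])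
  have int1: "integrable lborel (\<lambda>y. g y * exp (?l y z) * ?l y h)" for z h
  proof (rule Bochner_Integration.integrable_bound)
    show "integrable lborel (\<lambda>y. cmod (g y) * exp ((\<bar>c\<bar> * norm z + \<bar>c\<bar> * norm h) * norm y))"
      by (rule int)
    have "cmod (g y * exp (?l y z) * ?l y h) \<le> cmod (g y) * exp ((\<bar>c\<bar> * norm z + \<bar>c\<bar> * norm h) * norm y)" for y
    proof -
      have "cmod (?l y h) \<le> exp (\<bar>c\<bar> * norm h * norm y)"
        using l_le[of y h] exp_ge_add_one_self[of "\<bar>c\<bar> * norm h * norm y"] by linarith
      then have "cmod (exp (?l y z)) * cmod (?l y h) \<le> exp (\<bar>c\<bar> * norm z * norm y) * exp (\<bar>c\<bar> * norm h * norm y)"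
        by (intro mult_mono exp_le) auto
      also have "\<dots> = exp ((\<bar>c\<bar> * norm z + \<bar>c\<bar> * norm h) * norm y)"
        by (simp add: distrib_right exp_add)
      finally show ?thesis
        by (simp add: norm_mult mult.assoc mult_left_mono)
    qed
    then show "AE y in lborel. norm (g y * exp (?l y z) * ?l y h)
      \<le> norm (cmod (g y) * exp ((\<bar>c\<bar> * norm z + \<bar>c\<bar> * norm h) * norm y))"
      by (intro AE_I2) (simp add: abs_mult)
  qed measurable
  let ?J = "\<lambda>z. \<integral>y. g y * exp (?l y z) \<partial>lborel"
  let ?D = "\<lambda>z h. \<integral>y. g y * exp (?l y z) * ?l y h \<partial>lborel"
  have D_scale: "?D z (a *s h) = a * ?D z h" for z a h
    by (simp only: l_scale mult.left_commute[of _ a] integral_mult_right_zero)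
  have D_lin: "linear (?D z)" for z
  proof (rule linearI)
    show "?D z (h1 + h2) = ?D z h1 + ?D z h2" for h1 h2
      unfolding l_add distrib_left[of "_ * _"] by (rule Bochner_Integration.integral_add[OF int1 int1])
    show "?D z (r *\<^sub>R h) = r *\<^sub>R ?D z h" for r h
      by (simp only: scaleR_vec_scale D_scale scaleR_conv_of_real)
  qed
  have "(?J has_derivative ?D z) (at z)" for z
  proof (rule has_derivative_quadratic_bound)
    show "bounded_linear (?D z)"
      using D_lin by (simp add: linear_conv_bounded_linear)
    \<comment> \<open>The three summands bound, in this order, the factor exp of
      \<open>?l y z\<close>, the square (|c| |y|)^2 \<le> exp (2 |c| |y|), and the exponential in
      the remainder estimate for norm h \<le> 1.\<close>
    define C where "C = \<bar>c\<bar> * norm z + 2 * \<bar>c\<bar> + \<bar>c\<bar>"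
    show "norm (?J (z + h) - ?J z - ?D z h) \<le> (\<integral>y. cmod (g y) * exp (C * norm y) \<partial>lborel) * (norm h)\<^sup>2"
      if h: "norm h \<le> 1" for h
    proof -
      have "?J (z + h) - ?J z - ?D z h =
        (\<integral>y. g y * exp (?l y (z + h)) - g y * exp (?l y z) - g y * exp (?l y z) * ?l y h \<partial>lborel)"
        by (simp only: Bochner_Integration.integral_diff[OF int0 int0]
            Bochner_Integration.integral_diff[OF Bochner_Integration.integrable_diff[OF int0 int0] int1])
      also have "norm \<dots> \<le> (\<integral>y. cmod (g y) * exp (C * norm y) * (norm h)\<^sup>2 \<partial>lborel)"
      proof (rule Bochner_Integration.integral_norm_bound_integral)
        show "integrable lborel (\<lambda>y. g y * exp (?l y (z + h)) - g y * exp (?l y z) - g y * exp (?l y z) * ?l y h)"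
          by (intro Bochner_Integration.integrable_diff int0 int1)
        show "integrable lborel (\<lambda>y. cmod (g y) * exp (C * norm y) * (norm h)\<^sup>2)"
          by (intro integrable_mult_left int)
        show "norm (g y * exp (?l y (z + h)) - g y * exp (?l y z) - g y * exp (?l y z) * ?l y h)
          \<le> cmod (g y) * exp (C * norm y) * (norm h)\<^sup>2" for y
        proof -
          have le: "cmod (?l y h) \<le> \<bar>c\<bar> * norm y * norm h"
            using l_le[of y h] by (simp add: mult_ac)
          also have "\<dots> \<le> \<bar>c\<bar> * norm y"
            using h by (simp add: mult_left_le)
          finally have le1: "cmod (?l y h) \<le> \<bar>c\<bar> * norm y" .
          have "\<bar>c\<bar> * norm y \<le> exp (\<bar>c\<bar> * norm y)"
            using exp_ge_add_one_self[of "\<bar>c\<bar> * norm y"] by linarith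
          then have "(\<bar>c\<bar> * norm y)\<^sup>2 \<le> (exp (\<bar>c\<bar> * norm y))\<^sup>2"
            by (intro power_mono) auto
          then have sq: "(\<bar>c\<bar> * norm y)\<^sup>2 \<le> exp (2 * \<bar>c\<bar> * norm y)"
            by (simp add: exp_double[symmetric] mult.assoc)
          have "(cmod (?l y h))\<^sup>2 * exp (cmod (?l y h)) \<le> ((\<bar>c\<bar> * norm y)\<^sup>2 * (norm h)\<^sup>2) * exp (\<bar>c\<bar> * norm y)"
            unfolding power_mult_distrib[symmetric]
            using le le1 by (intro mult_mono power_mono) auto
          also have "\<dots> \<le> (exp (2 * \<bar>c\<bar> * norm y) * (norm h)\<^sup>2) * exp (\<bar>c\<bar> * norm y)"
            using sq by (intro mult_right_mono) auto
          finally have q: "(cmod (?l y h))\<^sup>2 * exp (cmod (?l y h))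
             \<le> exp (2 * \<bar>c\<bar> * norm y) * exp (\<bar>c\<bar> * norm y) * (norm h)\<^sup>2"
            by (simp only: mult_ac)
          have "g y * exp (?l y (z + h)) - g y * exp (?l y z) - g y * exp (?l y z) * ?l y h =
              g y * exp (?l y z) * (exp (?l y h) - 1 - ?l y h)"
            unfolding l_add exp_add by (simp add: algebra_simps)
          also have "cmod \<dots> \<le> cmod (g y) * exp (\<bar>c\<bar> * norm z * norm y) *
              (exp (2 * \<bar>c\<bar> * norm y) * exp (\<bar>c\<bar> * norm y) * (norm h)\<^sup>2)"
            unfolding norm_mult[of "g y * _"] norm_mult[of "g y"]
            using order_trans[OF cmod_exp_minus_linear_le q]
            by (intro mult_mono mult_left_mono exp_le) auto
          also have "\<dots> = cmod (g y) * exp (C * norm y) * (norm h)\<^sup>2"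
          proof -
            have "exp (C * norm y) =
              exp (\<bar>c\<bar> * norm z * norm y) * (exp (2 * \<bar>c\<bar> * norm y) * exp (\<bar>c\<bar> * norm y))"
              by (simp add: C_def exp_add[symmetric] algebra_simps)
            then show ?thesis
              by (simp only: mult_ac)
          qed
          finally show ?thesis .
        qed
      qed
      also have "\<dots> = (\<integral>y. cmod (g y) * exp (C * norm y) \<partial>lborel) * (norm h)\<^sup>2"
        by (rule integral_mult_left_zero)
      finally show ?thesis .
    qed
  qed
  then show ?thesis
    by (rule entire_holomorphicI) (rule D_scale)
qed

lemma square_integrable_exp_Gaussian:
  "square_integrable (\<lambda>y::real^'n. complex_of_real (exp (C * norm y - (norm y)\<^sup>2 / 2)))"
proof -
  have "(exp (C * r - r\<^sup>2 / 2))\<^sup>2 = exp ((2 * C) * r - 1 * r\<^sup>2)" for r :: real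
    by (simp add: exp_double[symmetric] algebra_simps)
  then show ?thesis
    using integrable_exp_linear_Gaussian[of 1 "2 * C", where 'a = "real^'n"]
    by (simp add: square_integrable_def)
qed

lemma vec_cinner_axis: "vec_cinner (axis j 1) z = z $ j" "vec_cinner z (axis j 1) = cnj (z $ j)"
  by (simp_all add: vec_cinner_def axis_def if_distrib[of cnj] if_distrib[of "\<lambda>c. c * _"]
      if_distrib[of "\<lambda>c. _ * c"] cong: if_cong)

text \<open>The factor exp(-|y|^2/2) of the kernel is attached to \<open>f\<close>. Against any
  exponential the result is a product of two square integrable functions, so a Laplace integral
  times an entire factor remains.\<close>

lemma bargmann_entire: "entire_holomorphic (bargmann u)" for u :: "(real^'n) l2"
proof -
  obtain f where f: "square_integrable f" and u: "u = abs_l2 f"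
    by (rule l2_cases)
  have [measurable]: "f \<in> borel_measurable borel"
    using f by (simp add: square_integrable_def)
  define g where "g y = f y * of_real (exp (- (norm y)\<^sup>2 / 2))" for y
  have gm: "g \<in> borel_measurable borel"
    unfolding g_def by measurable
  have "integrable lborel (\<lambda>y. cmod (g y) * exp (C * norm y))" for C
  proof -
    have "integrable lborel (\<lambda>y. cnj (cnj (f y)) * complex_of_real (exp (C * norm y - (norm y)\<^sup>2 / 2)))"
      by (intro integrable_cnj_mult square_integrable_cnj f square_integrable_exp_Gaussian)
    then have "integrable lborel (\<lambda>y. cmod (f y * complex_of_real (exp (C * norm y - (norm y)\<^sup>2 / 2))))"
      by (intro integrable_norm) simp
    moreover have "cmod (f y * complex_of_real (exp (C * norm y - (norm y)\<^sup>2 / 2))) = cmod (g y) * exp (C * norm y)" for y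
      unfolding g_def norm_mult norm_of_real abs_exp_cancel mult.assoc exp_add[symmetric]
      by (simp add: algebra_simps)
    ultimately show ?thesis
      by simp
  qed
  from entire_holomorphic_Laplace[OF gm this]
  have J: "entire_holomorphic (\<lambda>z. \<integral>y. g y * exp (of_real (sqrt (2 * pi)) * real_complex_pairing y z) \<partial>lborel)" .
  have S: "entire_holomorphic (\<lambda>z::complex^'n. \<Sum>j\<in>UNIV. (z $ j)\<^sup>2)"
  proof (intro entire_holomorphic_sum entire_holomorphic_power)
    show "entire_holomorphic (\<lambda>z::complex^'n. z $ j)" for j
      using entire_holomorphic_vec_cinner[of "axis j 1"]
      by (simp add: vec_cinner_axis[abs_def])
  qed
  have "bargmann u z = of_real (pi powr (- real CARD('n) / 4)) * (exp (- of_real (pi / 2) * (\<Sum>j\<in>UNIV. (z $ j)\<^sup>2)) *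
     (\<integral>y. g y * exp (of_real (sqrt (2 * pi)) * real_complex_pairing y z) \<partial>lborel))" for z
  proof -
    have "f y * bargmann_kernel z y = exp (- of_real (pi / 2) * (\<Sum>j\<in>UNIV. (z $ j)\<^sup>2)) *
       (g y * exp (of_real (sqrt (2 * pi)) * real_complex_pairing y z))" for y
    proof -
      have e: "complex_of_real (exp (- (norm y)\<^sup>2 / 2)) = exp (- 1 / 2 * of_real (\<Sum>j\<in>UNIV. (y $ j)\<^sup>2))"
        by (simp add: norm_vec_power2 exp_of_real[symmetric] del: exp_of_real)
      show ?thesis
        unfolding bargmann_kernel_def g_def e real_complex_pairing_def
        by (simp only: mult.left_commute[of _ "f y"] mult.assoc exp_add[symmetric])
          (simp add: algebra_simps)
    qed
    then show ?thesis
      using f by (simp only: u bargmann_abs_l2 integral_mult_right_zero)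
  qed
  then have "bargmann u = (\<lambda>z. of_real (pi powr (- real CARD('n) / 4)) * (exp (- of_real (pi / 2) * (\<Sum>j\<in>UNIV. (z $ j)\<^sup>2)) *
     (\<integral>y. g y * exp (of_real (sqrt (2 * pi)) * real_complex_pairing y z) \<partial>lborel)))"
    by (rule ext)
  then show ?thesis
    by (simp only:) (intro entire_holomorphic_mult entire_holomorphic_const entire_holomorphic_exp J S)
qed

lemma bargmann_coherent_state_eq: "bargmann (coherent_state w) = reproducing_kernel w"
  by (rule ext) (simp add: bargmann_coherent_state reproducing_kernel_def)

lemma bargmann_add_fun: "bargmann (u + v) = (\<lambda>z. bargmann u z + bargmann v z)"
  by (rule ext) (rule bargmann_add)

lemma bargmann_scaleC_fun: "bargmann (c *\<^sub>C u) = (\<lambda>z. c * bargmann u z)"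
  by (rule ext) (rule bargmann_scaleC)

lemma bargmann_zero_fun: "bargmann 0 = (\<lambda>z. 0)"
  by (rule ext) (rule bargmann_zero)

section \<open>Isometry and surjectivity of the Bargmann transform\<close>

lemma zero_in_segal_bargmann: "(\<lambda>z. 0) \<in> segal_bargmann"
  by (simp add: segal_bargmann_def entire_holomorphic_const)

lemma bargmann_coherent_span_segal_bargmann:
  assumes "v \<in> coherent_span"
  shows "bargmann v \<in> segal_bargmann"
  using assms unfolding coherent_span_def
proof (induction rule: span_induct_alt)
  case base
  show ?case
    by (simp add: bargmann_zero_fun zero_in_segal_bargmann)
next
  case (step c x y)
  then obtain a w where x: "x = a *\<^sub>C coherent_state w"
    by auto
  show ?case
    unfolding scaleR_scaleC x bargmann_add_fun bargmann_scaleC_fun bargmann_coherent_state_eq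
    using step by (intro segal_bargmann_add segal_bargmann_scale reproducing_kernel_segal_bargmann)
qed

text \<open>Against a coherent state both products are the conjugated value of the transform of
  \<open>u\<close>: one by the reproducing property, the other because the state represents
  evaluation. The condition on \<open>u\<close> holds within the span at first, and for every
  \<open>u\<close> once \<open>bargmann_segal_bargmann\<close> is available.\<close>

lemma bargmann_coherent_span_cinner:
  assumes v: "v \<in> coherent_span" and u: "bargmann u \<in> segal_bargmann"
  shows "l2_cinner (sb_l2 (bargmann u)) (sb_l2 (bargmann v)) = l2_cinner u v"
proof -
  have "bargmann v \<in> segal_bargmann \<and> l2_cinner (sb_l2 (bargmann u)) (sb_l2 (bargmann v)) = l2_cinner u v"
    using v unfolding coherent_span_def
  proof (induction rule: span_induct_alt)
    case base
    have "sb_l2 (bargmann 0) = 0 *\<^sub>C sb_l2 (bargmann u)"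
      unfolding sb_l2_scale[OF u, symmetric] by (rule arg_cong[where f = sb_l2], rule ext) (simp add: bargmann_zero)
    then show ?case
      by (simp add: bargmann_zero_fun zero_in_segal_bargmann)
  next
    case (step c x y)
    then obtain a w where x: "x = a *\<^sub>C coherent_state w"
      by auto
    have y: "bargmann y \<in> segal_bargmann"
      using step(2) by blast
    have K: "l2_cinner (sb_l2 (bargmann u)) (sb_l2 (reproducing_kernel w)) = l2_cinner u (coherent_state w)"
    proof -
      have "l2_cinner (sb_l2 (reproducing_kernel w)) (sb_l2 (bargmann u)) = l2_cinner (coherent_state w) u"
        using segal_bargmann_reproducing[OF u, of w]
        by (simp add: segal_bargmann_cinner_sb_l2 u reproducing_kernel_segal_bargmann l2_cinner_coherent_state)
      then show ?thesis
        by (metis l2_cinner_commute)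
  qed
  show ?case
    unfolding scaleR_scaleC x bargmann_add_fun bargmann_scaleC_fun bargmann_coherent_state_eq
    using step y K
    by (simp add: sb_l2_add sb_l2_scale segal_bargmann_scale segal_bargmann_add
        reproducing_kernel_segal_bargmann l2_cinner_add_right l2_cinner_scaleC_right)
  qed
  then show ?thesis
    by blast
qed

lemma bargmann_coherent_span_norm:
  "v \<in> coherent_span \<Longrightarrow> norm (sb_l2 (bargmann v)) = norm v"
  by (intro l2_cinner_self_eqD bargmann_coherent_span_cinner bargmann_coherent_span_segal_bargmann)

lemma coherent_span_sequence:
  obtains X where "\<And>n. X n \<in> coherent_span" "X \<longlonglongrightarrow> u"
  using closure_coherent_span closure_sequential[of u coherent_span] by blast

text \<open>Evaluation at z is continuous in \<open>u\<close>, so the transforms of approximants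
  from the span converge pointwise, and Fatou's lemma turns their isometry into an inequality. This
  is what puts the transform of an arbitrary \<open>u\<close> into the Segal-Bargmann space.\<close>

lemma bargmann_Fatou:
  fixes u :: "(real^'n) l2"
  shows "(\<integral>\<^sup>+z. ennreal ((cmod (bargmann u z * of_real (exp (- (pi / 2) * (norm z)\<^sup>2))))\<^sup>2) \<partial>lborel)
    \<le> ennreal ((norm u)\<^sup>2)"
proof -
  let ?W = "\<lambda>u (z::complex^'n). (cmod (bargmann u z * of_real (exp (- (pi / 2) * (norm z)\<^sup>2))))\<^sup>2"
  obtain X where X: "\<And>n. X n \<in> coherent_span" and lim: "X \<longlonglongrightarrow> u"
    using coherent_span_sequence[of u] by blast
  have [measurable]: "bargmann v \<in> borel_measurable borel" for v :: "(real^'n) l2"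
    by (rule entire_holomorphic_measurable[OF bargmann_entire])
  have "(\<lambda>n. ennreal (?W (X n) z)) \<longlonglongrightarrow> ennreal (?W u z)" for z
  proof -
    have "(\<lambda>n. bargmann (X n) z) \<longlonglongrightarrow> bargmann u z"
      unfolding l2_cinner_coherent_state[symmetric]
      using bounded_linear.tendsto[OF bounded_linear_l2_cinner_right lim] .
    then show ?thesis
      by (intro tendsto_intros)
  qed
  then have "(\<integral>\<^sup>+z. ennreal (?W u z) \<partial>lborel) = (\<integral>\<^sup>+z. liminf (\<lambda>n. ennreal (?W (X n) z)) \<partial>lborel)"
    by (intro nn_integral_cong lim_imp_Liminf[symmetric]) auto
  also have "\<dots> \<le> liminf (\<lambda>n. \<integral>\<^sup>+z. ennreal (?W (X n) z) \<partial>lborel)"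
    by (rule nn_integral_liminf) measurable
  also have "(\<lambda>n. \<integral>\<^sup>+z. ennreal (?W (X n) z) \<partial>lborel) = (\<lambda>n. ennreal ((norm (X n))\<^sup>2))"
  proof
    fix n
    have "square_integrable (\<lambda>z. bargmann (X n) z * of_real (exp (- (pi / 2) * (norm z)\<^sup>2)))"
      by (intro square_integrable_segal_bargmann bargmann_coherent_span_segal_bargmann X)
    then show "(\<integral>\<^sup>+z. ennreal (?W (X n) z) \<partial>lborel) = ennreal ((norm (X n))\<^sup>2)"
      using bargmann_coherent_span_norm[OF X, of n] by (simp only: nn_integral_abs_l2 sb_l2_def)
  qed
  also have "liminf (\<lambda>n. ennreal ((norm (X n))\<^sup>2)) = ennreal ((norm u)\<^sup>2)"
    by (intro lim_imp_Liminf tendsto_intros lim) auto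
  finally show ?thesis .
qed

lemma bargmann_segal_bargmann: "bargmann u \<in> segal_bargmann" for u :: "(real^'n) l2"
proof (rule segal_bargmannI[OF bargmann_entire square_integrableI_bounded])
  have [measurable]: "bargmann u \<in> borel_measurable borel"
    by (rule entire_holomorphic_measurable[OF bargmann_entire])
  show "(\<lambda>z. bargmann u z * of_real (exp (- (pi / 2) * (norm z)\<^sup>2))) \<in> borel_measurable lborel"
    by measurable
  show "(\<integral>\<^sup>+z. ennreal ((cmod (bargmann u z * of_real (exp (- (pi / 2) * (norm z)\<^sup>2))))\<^sup>2) \<partial>lborel) < \<infinity>"
    by (rule le_less_trans[OF bargmann_Fatou]) simp
qed

lemma norm_sb_l2_bargmann_le: "norm (sb_l2 (bargmann u)) \<le> norm u"
proof -
  have "ennreal ((norm (sb_l2 (bargmann u)))\<^sup>2) \<le> ennreal ((norm u)\<^sup>2)"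
    using bargmann_Fatou[of u]
    by (simp only: nn_integral_abs_l2[OF square_integrable_segal_bargmann[OF bargmann_segal_bargmann]] sb_l2_def)
  then have "(norm (sb_l2 (bargmann u)))\<^sup>2 \<le> (norm u)\<^sup>2"
    by simp
  then show ?thesis
    by (rule power2_le_imp_le) simp
qed

lemma sb_l2_bargmann_add: "sb_l2 (bargmann (u + v)) = sb_l2 (bargmann u) + sb_l2 (bargmann v)"
  unfolding bargmann_add_fun by (rule sb_l2_add[OF bargmann_segal_bargmann bargmann_segal_bargmann])

lemma sb_l2_bargmann_scaleC: "sb_l2 (bargmann (c *\<^sub>C u)) = c *\<^sub>C sb_l2 (bargmann u)"
  unfolding bargmann_scaleC_fun by (rule sb_l2_scale[OF bargmann_segal_bargmann])

lemma bounded_linear_sb_l2_bargmann: "bounded_linear (\<lambda>u. sb_l2 (bargmann u))"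
  by (rule bounded_linear_intro[where K = 1])
    (simp_all add: sb_l2_bargmann_add scaleR_scaleC sb_l2_bargmann_scaleC norm_sb_l2_bargmann_le)

text \<open>Both sides are continuous in \<open>v\<close> and agree on a dense set; the inequality
  from Fatou's lemma supplies the continuity of the left one.\<close>

lemma sb_l2_bargmann_cinner:
  "l2_cinner (sb_l2 (bargmann u)) (sb_l2 (bargmann v)) = l2_cinner u v" for u v :: "(real^'n) l2"
proof -
  have "closed {v. l2_cinner (sb_l2 (bargmann u)) (sb_l2 (bargmann v)) = l2_cinner u v}"
    by (intro closed_Collect_eq linear_continuous_on bounded_linear_l2_cinner_right
        bounded_linear_compose[OF bounded_linear_l2_cinner_right bounded_linear_sb_l2_bargmann])
  moreover have "coherent_span \<subseteq> {v. l2_cinner (sb_l2 (bargmann u)) (sb_l2 (bargmann v)) = l2_cinner u v}"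
    using bargmann_coherent_span_cinner[OF _ bargmann_segal_bargmann] by blast
  ultimately have "closure coherent_span \<subseteq> {v. l2_cinner (sb_l2 (bargmann u)) (sb_l2 (bargmann v)) = l2_cinner u v}"
    by (rule closure_minimal[rotated])
  then show ?thesis
    unfolding closure_coherent_span by blast
qed

lemma segal_bargmann_cinner_bargmann:
  "segal_bargmann_cinner (bargmann u) (bargmann v) = l2_cinner u v"
  by (simp add: segal_bargmann_cinner_sb_l2 bargmann_segal_bargmann sb_l2_bargmann_cinner)

lemma norm_sb_l2_bargmann: "norm (sb_l2 (bargmann u)) = norm u"
  by (rule l2_cinner_self_eqD) (rule sb_l2_bargmann_cinner)

text \<open>The range is closed, being an isometric image of a complete space, so F can be projected
  onto it. The residual is orthogonal to all transforms, in particular to the reproducing kernels,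
  and this says that its values vanish.\<close>

lemma bargmann_surj:
  fixes F :: "complex^'n \<Rightarrow> complex"
  assumes F: "F \<in> segal_bargmann"
  obtains u where "bargmann u = F"
proof -
  let ?E = "\<lambda>u. sb_l2 (bargmann u) :: (complex^'n) l2"
  have "closed (range ?E)"
    by (rule complete_imp_closed, rule complete_isometric_image[of 1])
      (simp_all add: bounded_linear_sb_l2_bargmann norm_sb_l2_bargmann complete_UNIV)
  moreover have "subspace (range ?E)"
    by (rule linear_subspace_image[OF bounded_linear.linear[OF bounded_linear_sb_l2_bargmann] subspace_UNIV])
  ultimately obtain p where p: "p \<in> range ?E" and orth: "\<And>y. y \<in> range ?E \<Longrightarrow> inner (sb_l2 F - p) y = 0"
    using orthogonal_projection_exists[of "range ?E" "sb_l2 F"] by blast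
  obtain u where u: "p = ?E u"
    using p by blast
  have Re0: "Re (l2_cinner (?E v) (sb_l2 F - ?E u)) = 0" for v
    using orth[of "?E v"] unfolding u by (metis inner_l2_def inner_commute rangeI)
  have zero: "l2_cinner (?E v) (sb_l2 F - ?E u) = 0" for v
    using Re0[of v] Re0[of "\<i> *\<^sub>C v"]
    by (simp add: sb_l2_bargmann_scaleC l2_cinner_scaleC_left complex_eq_iff)
  have "F w = bargmann u w" for w
  proof -
    have "segal_bargmann_cinner (reproducing_kernel w) F = segal_bargmann_cinner (reproducing_kernel w) (bargmann u)"
      using zero[of "coherent_state w"]
      by (simp add: bargmann_coherent_state_eq l2_cinner_diff_right segal_bargmann_cinner_sb_l2
          reproducing_kernel_segal_bargmann F bargmann_segal_bargmann)
    then show ?thesis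
      by (simp add: segal_bargmann_reproducing F bargmann_segal_bargmann)
  qed
  then have "bargmann u = F"
    by (intro ext) simp
  then show ?thesis
    by (rule that)
qed

lemma bargmann_adjoint_bargmann: "bargmann_adjoint (bargmann u) = u"
proof -
  have "bargmann_adjoint (bargmann u) = (THE v. \<forall>w. l2_cinner v w = l2_cinner u w)"
    by (simp add: bargmann_adjoint_def bargmann_segal_bargmann segal_bargmann_cinner_bargmann)
  also have "\<dots> = u"
    by (rule the_equality) (auto intro: l2_cinner_cancel_left)
  finally show ?thesis .
qed

lemma bargmann_bargmann_adjoint: "F \<in> segal_bargmann \<Longrightarrow> bargmann (bargmann_adjoint F) = F"
  using bargmann_surj[of F] bargmann_adjoint_bargmann by metis

lemma bargmann_inject: "bargmann u = bargmann v \<Longrightarrow> u = v"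
  by (metis bargmann_adjoint_bargmann)

section \<open>Unitary matrices\<close>

lemma vec_cinner_matrix: "vec_cinner (A *v x) y = vec_cinner x (map_matrix cnj (transpose A) *v y)"
proof -
  have "vec_cinner (A *v x) y = (\<Sum>i\<in>UNIV. \<Sum>j\<in>UNIV. cnj (A $ i $ j) * cnj (x $ j) * y $ i)"
    by (simp add: vec_cinner_def matrix_vector_mult_def sum_distrib_right)
  also have "\<dots> = (\<Sum>j\<in>UNIV. \<Sum>i\<in>UNIV. cnj (A $ i $ j) * cnj (x $ j) * y $ i)"
    by (rule sum.swap)
  also have "\<dots> = vec_cinner x (map_matrix cnj (transpose A) *v y)"
    by (simp add: vec_cinner_def matrix_vector_mult_def transpose_def sum_distrib_left mult_ac)
  finally show ?thesis .
qed

lemma matrix_inv_eqI: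
  fixes A :: "complex^'n^'n"
  assumes "B ** A = mat 1" "A ** B = mat 1"
  shows "matrix_inv A = B"
proof -
  have "A ** matrix_inv A = mat 1 \<and> matrix_inv A ** A = mat 1"
    unfolding matrix_inv_def
    by (rule someI[where P = "\<lambda>A'. A ** A' = mat 1 \<and> A' ** A = mat 1" and x = B])
      (simp add: assms)
  then have "matrix_inv A = (B ** A) ** matrix_inv A"
    by (simp add: assms matrix_mul_lid)
  also have "\<dots> = B"
    using \<open>A ** matrix_inv A = mat 1 \<and> matrix_inv A ** A = mat 1\<close>
    by (simp add: matrix_mul_assoc[symmetric] matrix_mul_rid)
  finally show ?thesis .
qed

lemma unitary_matrix_inv: "unitary_matrix g \<Longrightarrow> matrix_inv g = map_matrix cnj (transpose g)"
  unfolding unitary_matrix_def by (intro matrix_inv_eqI) auto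

lemma unitary_matrix_inv_cancel:
  assumes "unitary_matrix g"
  shows "matrix_inv g *v (g *v z) = z" "g *v (matrix_inv g *v z) = z"
  using assms by (auto simp: unitary_matrix_inv unitary_matrix_def matrix_vector_mul_assoc)

lemma unitary_vec_cinner_inv:
  "unitary_matrix g \<Longrightarrow> vec_cinner v (matrix_inv g *v z) = vec_cinner (g *v v) z"
  by (simp add: vec_cinner_matrix unitary_matrix_inv)

lemma unitary_norm:
  assumes "unitary_matrix g"
  shows "norm (g *v z) = norm z"
proof -
  have "vec_cinner (g *v z) (g *v z) = vec_cinner z z"
    by (simp add: unitary_vec_cinner_inv[symmetric] assms unitary_matrix_inv_cancel)
  then show ?thesis
    by (simp only: vec_cinner_self of_real_eq_iff) (simp add: power2_eq_iff_nonneg)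
qed

lemma unitary_norm_inv:
  assumes "unitary_matrix g"
  shows "norm (matrix_inv g *v z) = norm z"
  using unitary_norm[OF assms, of "matrix_inv g *v z"] by (simp add: assms unitary_matrix_inv_cancel)

lemma det_map_matrix_cnj: "det (map_matrix cnj A) = cnj (det A)"
  by (simp add: det_def)

lemma unitary_cmod_det:
  assumes "unitary_matrix g"
  shows "cmod (det g) = 1"
proof -
  have "cnj (det g) * det g = det (map_matrix cnj (transpose g) ** g)"
    by (simp add: det_mul det_map_matrix_cnj det_transpose)
  also have "\<dots> = 1"
    using assms by (simp add: unitary_matrix_def)
  finally have "(cmod (det g))\<^sup>2 = 1"
    by (metis complex_norm_square mult.commute of_real_eq_1_iff)
  then show ?thesis
    by (simp add: power2_eq_1_iff) (metis norm_ge_zero not_one_le_zero neg_0_le_iff_le)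
qed

lemma unitary_eigenvalue:
  assumes g: "unitary_matrix g" and v: "matrix_eigenvector g \<kappa> v"
  shows "cmod \<kappa> = 1" "matrix_inv g *v v = cnj \<kappa> *s v"
proof -
  have v0: "v \<noteq> 0" and gv: "g *v v = \<kappa> *s v"
    using v by (auto simp: matrix_eigenvector_def)
  show n: "cmod \<kappa> = 1"
    using unitary_norm[OF g, of v] v0 by (simp add: gv norm_vec_scale)
  have "\<kappa> *s (matrix_inv g *v v) = v"
    using unitary_matrix_inv_cancel(1)[OF g, of v] by (simp add: gv vector_scalar_commute)
  then have "cnj \<kappa> *s v = (cnj \<kappa> * \<kappa>) *s (matrix_inv g *v v)"
    by (metis vector_smult_assoc)
  also have "cnj \<kappa> * \<kappa> = 1"
    using n complex_norm_square[of \<kappa>] by (simp add: mult.commute)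
  finally show "matrix_inv g *v v = cnj \<kappa> *s v"
    by simp
qed

subsection \<open>Existence of eigenvectors\<close>

text \<open>The first CARD('n) + 1 terms are too many to be independent.
  \<open>vec.dependent\<close> speaks of sets, so a repeated term is treated separately, by the
  relation with coefficients 1 and -1.\<close>

lemma linear_relation_exists:
  fixes u :: "nat \<Rightarrow> complex^'n"
  obtains c N where "\<exists>i\<le>N. c i \<noteq> 0" "(\<Sum>i\<le>N. c i *s u i) = 0"
proof (cases "inj_on u {..CARD('n)}")
  case True
  have "vec.dependent (u ` {..CARD('n)})"
  proof (rule ccontr)
    assume "\<not> vec.dependent (u ` {..CARD('n)})"
    then have "card (u ` {..CARD('n)}) \<le> vec.dim (u ` {..CARD('n)})"
      using vec.independent_bound_general by blast
    also have "\<dots> \<le> CARD('n)"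
      by (rule dim_subset_UNIV_cart_gen)
    finally show False
      using card_image[OF True] by simp
  qed
  then obtain b where b: "\<exists>v\<in>u ` {..CARD('n)}. b v \<noteq> 0" "(\<Sum>v\<in>u ` {..CARD('n)}. b v *s v) = 0"
    by (auto simp: vec.dependent_finite)
  then have "(\<Sum>i\<le>CARD('n). b (u i) *s u i) = 0"
    by (simp add: sum.reindex[OF True])
  with b(1) that[of "CARD('n)" "\<lambda>i. b (u i)"] show ?thesis
    by auto
next
  case False
  then obtain i j where ij: "i \<le> CARD('n)" "j \<le> CARD('n)" "i \<noteq> j" "u i = u j"
    by (auto simp: inj_on_def)
  define c where "c k = (if k = i then 1 else if k = j then -1 else 0 :: complex)" for k
  have "(\<Sum>k\<le>CARD('n). c k *s u k) = (\<Sum>k\<in>{i, j}. c k *s u k)"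
    using ij by (intro sum.mono_neutral_right) (auto simp: c_def)
  also have "\<dots> = 0"
    using ij by (simp add: c_def vec_eq_iff)
  finally show ?thesis
    using ij by (intro that[of "CARD('n)" c]) (auto simp: c_def)
qed

text \<open>The vector p(A) w, built from the orbit of \<open>w\<close> so that no matrix powers are
  formed.\<close>

definition poly_apply :: "complex poly \<Rightarrow> complex^'n^'n \<Rightarrow> complex^'n \<Rightarrow> complex^'n" where
  "poly_apply p A w = (\<Sum>i\<le>degree p. coeff p i *s (((*v) A ^^ i) w))"

lemma poly_apply_eq_sum:
  assumes "degree p \<le> N"
  shows "poly_apply p A w = (\<Sum>i\<le>N. coeff p i *s (((*v) A ^^ i) w))"
  unfolding poly_apply_def using assms
  by (intro sum.mono_neutral_left) (auto simp: coeff_eq_0)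

lemma matrix_vector_mult_sum: "A *v (\<Sum>i\<in>I. f i) = (\<Sum>i\<in>I. A *v f i)" for A :: "complex^'n^'m"
  by (rule linear_sum[OF linear_matrix_vector])

lemma poly_apply_linear_factor:
  "poly_apply ([:- a, 1:] * r) A w = A *v poly_apply r A w - a *s poly_apply r A w"
proof -
  let ?u = "\<lambda>i. ((*v) A ^^ i) w"
  define N where "N = degree r"
  have "degree ([:- a, 1:] * r) \<le> Suc N"
    using degree_mult_le[of "[:- a, 1:]" r] by (simp add: N_def)
  then have "poly_apply ([:- a, 1:] * r) A w = (\<Sum>i\<le>Suc N. coeff (pCons 0 r) i *s ?u i - (a * coeff r i) *s ?u i)"
    by (subst poly_apply_eq_sum) (auto intro!: sum.cong simp: vec_eq_iff algebra_simps)
  also have "\<dots> = (\<Sum>i\<le>Suc N. coeff (pCons 0 r) i *s ?u i) - (\<Sum>i\<le>Suc N. (a * coeff r i) *s ?u i)"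
    by (rule sum_subtractf)
  also have "(\<Sum>i\<le>Suc N. coeff (pCons 0 r) i *s ?u i) = (\<Sum>i\<le>N. coeff r i *s ?u (Suc i))"
    by (subst sum.atMost_Suc_shift) simp
  also have "\<dots> = A *v poly_apply r A w"
    by (simp add: poly_apply_def N_def matrix_vector_mult_sum vector_scalar_commute)
  also have "(\<Sum>i\<le>Suc N. (a * coeff r i) *s ?u i) = a *s poly_apply r A w"
    by (subst poly_apply_eq_sum[of r "Suc N"]) (auto simp: N_def vec_eq_iff sum_distrib_left mult.assoc)
  finally show ?thesis .
qed

lemma poly_apply_mem:
  assumes W: "vec.subspace W" "\<And>x. x \<in> W \<Longrightarrow> A *v x \<in> W" and w: "w \<in> W"
  shows "poly_apply p A w \<in> W"
proof -
  have "((*v) A ^^ i) w \<in> W" for i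
    by (induction i) (auto simp: w W(2))
  then show ?thesis
    unfolding poly_apply_def using W(1) by (intro vec.subspace_sum vec.subspace_scale)
qed

text \<open>Some nonzero polynomial annihilates \<open>w\<close>. Split off a root a, p = (X - a) r:
  either the smaller polynomial r still annihilates \<open>w\<close>, or r(A) w is an eigenvector
  for a. It lies in \<open>W\<close> because \<open>W\<close> is invariant.\<close>

lemma invariant_subspace_eigenvector:
  fixes A :: "complex^'n^'n"
  assumes W: "vec.subspace W" "\<And>x. x \<in> W \<Longrightarrow> A *v x \<in> W" and w: "w \<in> W" "w \<noteq> 0"
  obtains \<kappa> v where "v \<in> W" "matrix_eigenvector A \<kappa> v"
proof -
  have ex: "\<exists>\<kappa> v. v \<in> W \<and> matrix_eigenvector A \<kappa> v" if "p \<noteq> 0" "poly_apply p A w = 0" for p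
    using that
  proof (induction "degree p" arbitrary: p rule: less_induct)
    case less
    show ?case
    proof (cases "degree p = 0")
      case True
      then obtain c where p: "p = [:c:]"
        by (rule degree_eq_zeroE)
      then show ?thesis
        using less.prems w by (simp add: poly_apply_def)
    next
      case False
      then have "\<not> constant (poly p)"
        by (simp add: constant_degree)
      then obtain a where "poly p a = 0"
        using fundamental_theorem_of_algebra by blast
      then obtain r where p: "p = [:- a, 1:] * r"
        unfolding poly_eq_0_iff_dvd by (auto elim: dvdE)
      have r: "r \<noteq> 0"
        using less.prems(1) p by auto
      have deg: "degree r < degree p"
        using r by (simp add: p degree_mult_eq del: mult_pCons_left)
      show ?thesis
      proof (cases "poly_apply r A w = 0")
        case True
        with less.hyps[OF deg r] show ?thesis .
      next
        case nz: False
        have "A *v poly_apply r A w = a *s poly_apply r A w"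
          using less.prems(2) by (simp only: p poly_apply_linear_factor) simp
        with nz poly_apply_mem[OF W w(1), of r] show ?thesis
          by (auto simp: matrix_eigenvector_def)
      qed
    qed
  qed
  obtain c N where c: "\<exists>i\<le>N. c i \<noteq> 0" "(\<Sum>i\<le>N. c i *s (((*v) A ^^ i) w)) = 0"
    by (rule linear_relation_exists)
  define p where "p = (\<Sum>i\<le>N. monom (c i) i)"
  have cp: "coeff p k = (if k \<le> N then c k else 0)" for k
    by (simp add: p_def coeff_sum sum.delta)
  have "p \<noteq> 0"
    using c(1) cp by (metis coeff_0)
  moreover have "degree p \<le> N"
    by (rule degree_le) (simp add: cp)
  then have "poly_apply p A w = 0"
    using c(2) by (simp add: poly_apply_eq_sum cp)
  ultimately show ?thesis
    using ex that by blast
qed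

text \<open>Real orthogonality controls only the real part of \<open>vec_cinner v w\<close>; since
  \<open>S\<close> is closed under multiplication by \<i>, the imaginary part vanishes as
  well.\<close>

lemma orthogonal_vector_exists:
  fixes S :: "(complex^'n) set"
  assumes S: "vec.subspace S" "S \<noteq> UNIV"
  obtains w where "w \<noteq> 0" "\<And>v. v \<in> S \<Longrightarrow> vec_cinner v w = 0"
proof -
  have sub: "subspace S"
    using S(1) by (auto simp: subspace_def scaleR_vec_scale vec.subspace_def)
  then have "span S \<noteq> UNIV"
    using S(2) by (simp add: span_eq_iff[THEN iffD2])
  then have "dim S < DIM(complex^'n)"
    using dim_eq_full[of S] dim_subset_UNIV[of S] by linarith
  then obtain w where w: "w \<noteq> 0" "\<And>y. y \<in> span S \<Longrightarrow> orthogonal w y"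
    by (rule orthogonal_to_subspace_exists) blast
  have Re0: "Re (vec_cinner v w) = 0" if "v \<in> S" for v
    using w(2)[of v] that span_base[of v S] by (simp add: Re_vec_cinner orthogonal_def inner_commute)
  have "vec_cinner v w = 0" if "v \<in> S" for v
  proof -
    have "\<i> *s v \<in> S"
      using S(1) that by (rule vec.subspace_scale)
    then show ?thesis
      using Re0[OF that] Re0[of "\<i> *s v"] by (simp add: vec_cinner_scale_left complex_eq_iff)
  qed
  with w(1) show ?thesis
    by (rule that)
qed

text \<open>The inverse of g, which is its adjoint, maps each eigenvector to a multiple of itself,
  so the orthogonal complement \<open>W\<close> of all eigenvectors is invariant under g. If
  \<open>W\<close> were nonzero it would contain an eigenvector, which would be orthogonal to
  itself.\<close>

lemma unitary_eigenvectors_span: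
  assumes g: "unitary_matrix g"
  shows "vec.span {v. \<exists>\<kappa>. matrix_eigenvector g \<kappa> v} = UNIV"
proof (rule ccontr)
  let ?E = "{v. \<exists>\<kappa>. matrix_eigenvector g \<kappa> v}"
  assume "vec.span ?E \<noteq> UNIV"
  then obtain w where w: "w \<noteq> 0" "\<And>v. v \<in> vec.span ?E \<Longrightarrow> vec_cinner v w = 0"
    using orthogonal_vector_exists[OF vec.subspace_span] by blast
  define W where "W = {w. \<forall>v\<in>?E. vec_cinner v w = 0}"
  have "vec.subspace W"
    by (auto simp: vec.subspace_def W_def vec_cinner_add_right vec_cinner_scale_right)
  moreover have "g *v x \<in> W" if "x \<in> W" for x
  proof -
    have "vec_cinner v (g *v x) = 0" if "matrix_eigenvector g \<kappa> v" for v \<kappa>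
    proof -
      have "vec_cinner v (g *v x) = vec_cinner (g *v (matrix_inv g *v v)) (g *v x)"
        by (simp add: unitary_matrix_inv_cancel g)
      also have "\<dots> = vec_cinner (cnj \<kappa> *s v) x"
        by (simp only: unitary_vec_cinner_inv[OF g, symmetric] unitary_matrix_inv_cancel[OF g]
            unitary_eigenvalue(2)[OF g that])
      also have "\<dots> = 0"
        using \<open>x \<in> W\<close> that by (auto simp: W_def vec_cinner_scale_left)
      finally show ?thesis .
    qed
    then show ?thesis
      by (auto simp: W_def)
  qed
  moreover have "w \<in> W"
    unfolding W_def using w(2)[OF vec.span_base] by blast
  ultimately obtain \<kappa> v where v: "v \<in> W" "matrix_eigenvector g \<kappa> v"
    using invariant_subspace_eigenvector w(1) by metis
  then have "vec_cinner v v = 0"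
    by (auto simp: W_def)
  with v(2) show False
    by (simp add: vec_cinner_self matrix_eigenvector_def)
qed

lemma matrix_eigenvalue_iff_det:
  fixes g :: "complex^'n^'n"
  shows "(\<exists>v. matrix_eigenvector g x v) \<longleftrightarrow> det (mat x - g) = 0"
proof -
  have m: "(mat x - g) *v v = x *s v - g *v v" for v
  proof -
    have "mat x *v v = x *s v"
      by (simp add: vec_eq_iff matrix_vector_mult_def mat_def if_distrib[of "\<lambda>c. c * _"] cong: if_cong)
    then show ?thesis
      by (simp add: matrix_vector_mult_diff_rdistrib)
  qed
  have "det (mat x - g) = 0 \<longleftrightarrow> \<not> invertible (mat x - g)"
    by (simp add: invertible_det_nz)
  also have "\<dots> \<longleftrightarrow> \<not> (\<forall>v. (mat x - g) *v v = 0 \<longrightarrow> v = 0)"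
    unfolding invertible_left_inverse matrix_left_invertible_ker ..
  also have "\<dots> \<longleftrightarrow> (\<exists>v. matrix_eigenvector g x v)"
    by (simp add: m matrix_eigenvector_def eq_commute[of "x *s _"] conj_commute)
  finally show ?thesis
    by simp
qed

lemma eigenvalues_range:
  fixes g :: "complex^'n^'n"
  assumes "eigenvalues_with_multiplicity g \<theta>"
  shows "(\<exists>v. matrix_eigenvector g x v) \<longleftrightarrow> x \<in> range \<theta>"
  using assms by (auto simp: matrix_eigenvalue_iff_det eigenvalues_with_multiplicity_def)

text \<open>Along the line z + t v every form either is constant and nonzero by induction or
  vanishes at a single t, so a good t exists outside a finite set. The lemma shows that a product of
  linear forms is not the zero function.\<close>

lemma common_nonorthogonal_vector:
  fixes V :: "(complex^'n) set"
  assumes "finite V" "0 \<notin> V"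
  obtains z where "\<And>v. v \<in> V \<Longrightarrow> vec_cinner v z \<noteq> 0"
proof -
  have "\<exists>z. \<forall>v\<in>V. vec_cinner v z \<noteq> 0"
    using assms
  proof (induction V rule: finite_induct)
    case empty
    then show ?case by simp
  next
    case (insert v V)
    then obtain z where z: "\<And>x. x \<in> V \<Longrightarrow> vec_cinner x z \<noteq> 0"
      by auto
    let ?bad = "(\<lambda>x. - vec_cinner x z / vec_cinner x v) ` insert v V"
    have "finite ?bad"
      using insert by simp
    then obtain t where t: "t \<notin> ?bad"
      using ex_new_if_finite infinite_UNIV_char_0 by blast
    have "vec_cinner x (z + t *s v) \<noteq> 0" if x: "x \<in> insert v V" for x
    proof
      assume "vec_cinner x (z + t *s v) = 0"
      then have eq: "vec_cinner x z + t * vec_cinner x v = 0"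
        by (simp add: vec_cinner_add_right vec_cinner_scale_right)
      show False
      proof (cases "vec_cinner x v = 0")
        case True
        have "vec_cinner v v \<noteq> 0"
          using insert by (simp add: vec_cinner_self)
        with True x eq z show False
          by auto
      next
        case False
        then have "t = - vec_cinner x z / vec_cinner x v"
          using eq by (simp add: field_simps add_eq_0_iff)
        with x t show False
          by blast
      qed
    qed
    then show ?case
      by blast
  qed
  with that show ?thesis
    by blast
qed

section \<open>The metaplectic operator of a unitary matrix\<close>

lemma segal_bargmann_compose_isometry:
  fixes A :: "complex^'n^'n"
  assumes F: "F \<in> segal_bargmann" and A: "\<And>z. norm (A *v z) = norm z"
  shows "(\<lambda>z. c * F (A *v z)) \<in> segal_bargmann"
proof -
  have [measurable]: "F \<in> borel_measurable borel"
    by (rule entire_holomorphic_measurable[OF segal_bargmann_entire[OF F]])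
  have "integrable lborel (\<lambda>z. (cmod (F z))\<^sup>2 * exp (- pi * (norm z)\<^sup>2))"
    using F by (simp add: segal_bargmann_def)
  then have "integrable lborel (\<lambda>z. (cmod (F (A *v z)))\<^sup>2 * exp (- pi * (norm (A *v z))\<^sup>2))"
    by (subst integrable_isometry_iff(1)[OF linear_matrix_vector A,
          of "\<lambda>z. (cmod (F z))\<^sup>2 * exp (- pi * (norm z)\<^sup>2)"]) auto
  then have "(\<lambda>z. F (A *v z)) \<in> segal_bargmann"
    using entire_holomorphic_compose_affine[OF segal_bargmann_entire[OF F], of A 0]
    by (simp add: segal_bargmann_def A)
  then show ?thesis
    by (rule segal_bargmann_scale)
qed

lemma segal_bargmann_cinner_compose_isometry:
  fixes A :: "complex^'n^'n"
  assumes F: "F \<in> segal_bargmann" and G: "G \<in> segal_bargmann"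
    and A: "\<And>z. norm (A *v z) = norm z" and c: "cmod c = 1"
  shows "segal_bargmann_cinner (\<lambda>z. c * F (A *v z)) (\<lambda>z. c * G (A *v z)) = segal_bargmann_cinner F G"
proof -
  have [measurable]: "F \<in> borel_measurable borel" "G \<in> borel_measurable borel"
    using F G by (auto intro: entire_holomorphic_measurable segal_bargmann_entire)
  have "cnj c * c = 1"
    using c complex_norm_square[of c] by (simp add: mult.commute)
  then have "cnj (c * x) * (c * y) = cnj x * y" for x y
    by (metis complex_cnj_mult mult.assoc mult.commute mult_1)
  then have "segal_bargmann_cinner (\<lambda>z. c * F (A *v z)) (\<lambda>z. c * G (A *v z)) =
      (\<integral>z. cnj (F (A *v z)) * G (A *v z) * of_real (exp (- pi * (norm (A *v z))\<^sup>2)) \<partial>lborel)"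
    by (simp only: segal_bargmann_cinner_def A)
  also have "\<dots> = segal_bargmann_cinner F G"
    unfolding segal_bargmann_cinner_def
    by (rule integrable_isometry_iff(2)[OF linear_matrix_vector A]) measurable
  finally show ?thesis .
qed

lemma nu_segal_bargmann:
  "unitary_matrix g \<Longrightarrow> F \<in> segal_bargmann \<Longrightarrow> nu s g F \<in> segal_bargmann"
  unfolding nu_def by (rule segal_bargmann_compose_isometry) (auto simp: unitary_norm_inv)

lemma nu_cinner:
  assumes "unitary_matrix g" "cmod s = 1" "F \<in> segal_bargmann" "G \<in> segal_bargmann"
  shows "segal_bargmann_cinner (nu s g F) (nu s g G) = segal_bargmann_cinner F G"
  unfolding nu_def
  by (rule segal_bargmann_cinner_compose_isometry) (use assms in \<open>auto simp: unitary_norm_inv\<close>)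

lemma bargmann_metaplectic:
  "unitary_matrix g \<Longrightarrow> bargmann (metaplectic s g u) = nu s g (bargmann u)"
  by (simp add: metaplectic_def bargmann_bargmann_adjoint nu_segal_bargmann bargmann_segal_bargmann)

lemma metaplectic_unitary_op:
  assumes g: "unitary_matrix g" and s: "cmod s = 1"
  shows "unitary_op (metaplectic s g)"
  unfolding unitary_op_def clinear_op_def
proof (intro conjI allI)
  show "metaplectic s g (u + v) = metaplectic s g u + metaplectic s g v" for u v
    by (rule bargmann_inject) (simp add: bargmann_metaplectic g bargmann_add_fun nu_def distrib_left)
  show "metaplectic s g (c *\<^sub>C u) = c *\<^sub>C metaplectic s g u" for c u
    by (rule bargmann_inject) (simp add: bargmann_metaplectic g bargmann_scaleC_fun nu_def mult.left_commute)
  show "surj (metaplectic s g)"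
    unfolding surj_def
  proof
    fix v :: "(real^'a) l2"
    \<comment> \<open>The inverse of \<open>nu s g\<close> substitutes g and divides by s.\<close>
    have "(\<lambda>z. inverse s * bargmann v (g *v z)) \<in> segal_bargmann"
      by (rule segal_bargmann_compose_isometry) (auto simp: bargmann_segal_bargmann unitary_norm g)
    then obtain u where u: "bargmann u = (\<lambda>z. inverse s * bargmann v (g *v z))"
      by (rule bargmann_surj)
    have "s \<noteq> 0"
      using s by auto
    then have "metaplectic s g u = v"
      by (intro bargmann_inject)
        (auto simp: bargmann_metaplectic g nu_def u unitary_matrix_inv_cancel fun_eq_iff)
    then show "\<exists>u. v = metaplectic s g u"
      by blast
  qed
  show "l2_cinner (metaplectic s g u) (metaplectic s g v) = l2_cinner u v" for u v
    by (simp add: segal_bargmann_cinner_bargmann[symmetric] bargmann_metaplectic g s nu_cinner bargmann_segal_bargmann)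
qed

lemma is_eigenvector_metaplectic:
  assumes g: "unitary_matrix g" and F: "F \<in> segal_bargmann" "F z \<noteq> 0" and nu: "nu s g F = (\<lambda>z. \<kappa> * F z)"
  shows "is_eigenvector (metaplectic s g) \<kappa> (bargmann_adjoint F)"
proof -
  have B: "bargmann (bargmann_adjoint F) = F"
    by (rule bargmann_bargmann_adjoint[OF F(1)])
  have "bargmann_adjoint F \<noteq> 0"
    using B F(2) by (metis bargmann_zero)
  moreover have "metaplectic s g (bargmann_adjoint F) = \<kappa> *\<^sub>C bargmann_adjoint F"
    by (rule bargmann_inject) (simp add: bargmann_metaplectic g bargmann_scaleC_fun B nu)
  ultimately show ?thesis
    by (simp add: is_eigenvector_def)
qed

subsection \<open>Polynomial eigenfunctions\<close>

text \<open>Unlike \<open>segal_bargmann\<close>, this class is closed under products, so membership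
  of polynomials can be shown factor by factor.\<close>

definition exponential_type :: "(complex^'n \<Rightarrow> complex) \<Rightarrow> bool" where
  "exponential_type F \<longleftrightarrow> entire_holomorphic F \<and> (\<exists>K C. \<forall>z. cmod (F z) \<le> K * exp (C * norm z))"

lemma exponential_type_segal_bargmann: "exponential_type F \<Longrightarrow> F \<in> segal_bargmann"
  unfolding exponential_type_def using segal_bargmann_exp_bound by blast

lemma exponential_type_const: "exponential_type (\<lambda>z. c)"
  unfolding exponential_type_def
  by (intro conjI entire_holomorphic_const exI[of _ "cmod c"] exI[of _ 0]) simp

lemma exponential_type_mult:
  assumes "exponential_type F" "exponential_type G"
  shows "exponential_type (\<lambda>z. F z * G z)"
proof -
  obtain K C K' C' where F: "\<And>z. cmod (F z) \<le> K * exp (C * norm z)"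
    and G: "\<And>z. cmod (G z) \<le> K' * exp (C' * norm z)"
    using assms unfolding exponential_type_def by blast
  have "cmod (F z * G z) \<le> (K * K') * exp ((C + C') * norm z)" for z
  proof -
    have "cmod (F z * G z) \<le> (K * exp (C * norm z)) * (K' * exp (C' * norm z))"
      unfolding norm_mult by (intro mult_mono F G order_trans[OF norm_ge_zero F]) auto
    also have "\<dots> = (K * K') * exp ((C + C') * norm z)"
      unfolding distrib_right exp_add by (simp only: mult_ac)
    finally show ?thesis .
  qed
  with assms entire_holomorphic_mult[of F G] show ?thesis
    unfolding exponential_type_def by blast
qed

lemma exponential_type_vec_cinner: "exponential_type (vec_cinner v)"
  unfolding exponential_type_def
proof (intro conjI entire_holomorphic_vec_cinner exI allI)
  show "cmod (vec_cinner v z) \<le> norm v * exp (1 * norm z)" for z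
  proof (rule order_trans[OF vec_cinner_Cauchy_Schwarz])
    have "norm z \<le> exp (norm z)"
      using exp_ge_add_one_self[of "norm z"] by linarith
    then show "norm v * norm z \<le> norm v * exp (1 * norm z)"
      by (simp add: mult_left_mono)
  qed
qed

lemma exponential_type_power: "exponential_type F \<Longrightarrow> exponential_type (\<lambda>z. F z ^ n)"
  by (induction n) (auto intro: exponential_type_const exponential_type_mult)

lemma exponential_type_prod:
  "(\<And>i. i \<in> I \<Longrightarrow> exponential_type (F i)) \<Longrightarrow> exponential_type (\<lambda>z. \<Prod>i\<in>I. F i z)"
  by (induction I rule: infinite_finite_induct) (auto intro: exponential_type_const exponential_type_mult)

lemma unitary_eigenvector_cinner:
  assumes g: "unitary_matrix g" and v: "matrix_eigenvector g \<kappa> v"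
  shows "vec_cinner v (matrix_inv g *v z) = cnj \<kappa> * vec_cinner v z"
  using v by (simp add: unitary_vec_cinner_inv[OF g] matrix_eigenvector_def vec_cinner_scale_left)

text \<open>The linear form of \<open>v k\<close> is scaled by cnj (\<theta> k) under the
  substitution. The \<open>v k\<close> may coincide: for the point spectrum they are chosen index by
  index, without regard to multiplicities.\<close>

lemma polynomial_eigenvector:
  fixes v :: "'n::finite \<Rightarrow> complex^'n"
  assumes g: "unitary_matrix g" and v: "\<And>k. matrix_eigenvector g (\<theta> k) (v k)"
  shows "is_eigenvector (metaplectic s g) (s * (\<Prod>j\<in>UNIV. cnj (\<theta> j) ^ n j))
    (bargmann_adjoint (\<lambda>z. \<Prod>k\<in>UNIV. vec_cinner (v k) z ^ n k))"
proof -
  have "0 \<notin> range v"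
    using v unfolding matrix_eigenvector_def by (metis rangeE)
  then obtain z where z: "\<And>x. x \<in> range v \<Longrightarrow> vec_cinner x z \<noteq> 0"
    using common_nonorthogonal_vector[of "range v"] by auto
  show ?thesis
  proof (rule is_eigenvector_metaplectic[OF g])
    show "(\<lambda>z. \<Prod>k\<in>UNIV. vec_cinner (v k) z ^ n k) \<in> segal_bargmann"
      by (intro exponential_type_segal_bargmann exponential_type_prod exponential_type_power
          exponential_type_vec_cinner)
    show "(\<Prod>k\<in>UNIV. vec_cinner (v k) z ^ n k) \<noteq> 0"
      using z by simp
    show "nu s g (\<lambda>z. \<Prod>k\<in>UNIV. vec_cinner (v k) z ^ n k) =
      (\<lambda>z. s * (\<Prod>j\<in>UNIV. cnj (\<theta> j) ^ n j) * (\<Prod>k\<in>UNIV. vec_cinner (v k) z ^ n k))"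
      by (simp add: nu_def unitary_eigenvector_cinner[OF g v] power_mult_distrib prod.distrib mult.assoc)
  qed
qed

subsection \<open>Completeness of the polynomial eigenfunctions\<close>

text \<open>A list of factors rather than a tuple of exponents, so that single factors can be
  exchanged by multilinearity.\<close>

definition linear_form_product :: "(complex^'n) list \<Rightarrow> complex^'n \<Rightarrow> complex" where
  "linear_form_product L z = (\<Prod>v\<leftarrow>L. vec_cinner v z)"

lemma linear_form_product_simps:
  "linear_form_product [] z = 1"
  "linear_form_product (v # L) z = vec_cinner v z * linear_form_product L z"
  "linear_form_product (L @ M) z = linear_form_product L z * linear_form_product M z"
  by (simp_all add: linear_form_product_def)

lemma exponential_type_linear_form_product: "exponential_type (linear_form_product L)"
proof (induction L)
  case Nil
  then show ?case
    using exponential_type_const[of 1] by (simp add: linear_form_product_simps[abs_def])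
next
  case (Cons v L)
  then show ?case
    using exponential_type_mult[OF exponential_type_vec_cinner] by (simp add: linear_form_product_simps[abs_def])
qed

lemma linear_form_product_segal_bargmann: "linear_form_product L \<in> segal_bargmann"
  by (rule exponential_type_segal_bargmann[OF exponential_type_linear_form_product])

lemma segal_bargmann_cinner_add_left:
  assumes "F \<in> segal_bargmann" "G \<in> segal_bargmann" "H \<in> segal_bargmann"
  shows "segal_bargmann_cinner (\<lambda>z. F z + G z) H = segal_bargmann_cinner F H + segal_bargmann_cinner G H"
  using assms by (simp add: segal_bargmann_cinner_sb_l2 segal_bargmann_add sb_l2_add l2_cinner_add_left)

lemma segal_bargmann_cinner_scale_left:
  "segal_bargmann_cinner (\<lambda>z. c * F z) H = cnj c * segal_bargmann_cinner F H"
  by (simp add: segal_bargmann_cinner_def mult.assoc)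

lemma segal_bargmann_cinner_scale_right:
  "segal_bargmann_cinner F (\<lambda>z. c * H z) = c * segal_bargmann_cinner F H"
  by (simp add: segal_bargmann_cinner_def mult.assoc mult.left_commute[of _ c])

text \<open>The product depends additively and conjugate-homogeneously on each vector. Expanding the
  head of \<open>M\<close> in the spanning set \<open>E\<close> moves one factor at a time into
  \<open>L\<close>, whose entries already lie in \<open>E\<close>.\<close>

lemma orthogonal_to_linear_form_products:
  fixes E :: "(complex^'n) set"
  assumes F: "F \<in> segal_bargmann" and E: "vec.span E = UNIV"
    and orth: "\<And>L. set L \<subseteq> E \<Longrightarrow> segal_bargmann_cinner (linear_form_product L) F = 0"
  shows "set L \<subseteq> E \<Longrightarrow> segal_bargmann_cinner (linear_form_product (L @ M)) F = 0"
proof (induction M arbitrary: L)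
  case Nil
  then show ?case
    by (simp add: orth)
next
  case (Cons w M)
  have "w \<in> vec.span E"
    by (simp add: E)
  then have "\<forall>L. set L \<subseteq> E \<longrightarrow> segal_bargmann_cinner (linear_form_product (L @ w # M)) F = 0"
  proof (induction rule: vec.span_induct_alt)
    case base
    show ?case
      by (simp add: linear_form_product_simps segal_bargmann_cinner_def)
  next
    case (step c x y)
    show ?case
    proof (intro allI impI)
      fix L assume L: "set L \<subseteq> E"
      have "linear_form_product (L @ (c *s x + y) # M) =
        (\<lambda>z. cnj c * linear_form_product ((x # L) @ M) z + linear_form_product (L @ y # M) z)"
        by (rule ext) (simp add: linear_form_product_simps vec_cinner_add_left vec_cinner_scale_left algebra_simps)
      then show "segal_bargmann_cinner (linear_form_product (L @ (c *s x + y) # M)) F = 0"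
        using Cons.IH[of "x # L"] step L
        by (simp only: segal_bargmann_cinner_add_left[OF segal_bargmann_scale[OF linear_form_product_segal_bargmann]
              linear_form_product_segal_bargmann F] segal_bargmann_cinner_scale_left) simp
    qed
  qed
  with Cons.prems show ?case
    by blast
qed

lemma segal_bargmann_power_orthogonal_imp_zero:
  fixes w :: "complex^'n"
  assumes F: "F \<in> segal_bargmann"
    and orth: "\<And>m. segal_bargmann_cinner (\<lambda>z. vec_cinner w z ^ m) F = 0"
  shows "F w = 0"
proof -
  let ?g = "\<lambda>z::complex^'n. complex_of_real (exp (- pi * (norm z)\<^sup>2))"
  let ?a = "\<lambda>z. of_real pi * vec_cinner w z"
  define S where "S N z = (\<Sum>m<N. ?a z ^ m /\<^sub>R fact m)" for N z
  have P: "(\<lambda>z. vec_cinner w z ^ m) \<in> segal_bargmann" for m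
    by (intro exponential_type_segal_bargmann exponential_type_power exponential_type_vec_cinner)
  have Fm [measurable]: "F \<in> borel_measurable borel"
    by (rule entire_holomorphic_measurable[OF segal_bargmann_entire[OF F]])
  have S: "S N \<in> segal_bargmann \<and> segal_bargmann_cinner (S N) F = 0" for N
  proof (induction N)
    case 0
    have "S 0 = (\<lambda>z. 0)"
      by (simp add: S_def fun_eq_iff)
    then show ?case
      by (simp add: zero_in_segal_bargmann segal_bargmann_cinner_def)
  next
    case (Suc N)
    have "S (Suc N) = (\<lambda>z. S N z + (of_real (pi ^ N / fact N)) * vec_cinner w z ^ N)"
      by (simp add: S_def fun_eq_iff scaleR_conv_of_real power_mult_distrib divide_inverse mult_ac)
    with Suc show ?case
      using segal_bargmann_scale[OF P]
      by (simp only: segal_bargmann_add segal_bargmann_cinner_add_left[OF _ segal_bargmann_scale[OF P] F]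
          segal_bargmann_cinner_scale_left orth) simp
  qed
  have [measurable]: "S N \<in> borel_measurable borel" for N
    using S by (intro entire_holomorphic_measurable segal_bargmann_entire) blast
  have [measurable]: "reproducing_kernel w \<in> borel_measurable borel"
    by (rule entire_holomorphic_measurable[OF segal_bargmann_entire[OF reproducing_kernel_segal_bargmann]])
  let ?b = "\<lambda>z. exp (pi * norm w * norm z)"
  have S_le: "cmod (S N z) \<le> ?b z" for N z
  proof -
    have "cmod (S N z) \<le> (\<Sum>m<N. cmod (?a z) ^ m /\<^sub>R fact m)"
      unfolding S_def by (rule order_trans[OF norm_sum]) (simp add: norm_power)
    also have "\<dots> \<le> (\<Sum>m. cmod (?a z) ^ m /\<^sub>R fact m)"
      by (rule sum_le_suminf[OF summable_exp_generic]) auto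
    also have "\<dots> = exp (cmod (?a z))"
      by (simp add: exp_def)
    also have "\<dots> \<le> ?b z"
      using mult_left_mono[OF vec_cinner_Cauchy_Schwarz[of w z] pi_ge_zero]
      by (simp add: norm_mult mult.assoc)
    finally show ?thesis .
  qed
  \<comment> \<open>The dominating function for the partial sums \<open>S N\<close>. It splits into
    two square integrable factors: F with half of the Gaussian exponent, and the exponential bound
    with the other half.\<close>
  have "integrable lborel (\<lambda>z. cmod (F z) * ?b z * exp (- pi * (norm z)\<^sup>2))"
  proof -
    let ?h = "\<lambda>z::complex^'n. complex_of_real (exp (pi * norm w * norm z - pi / 2 * (norm z)\<^sup>2))"
    have "square_integrable ?h"
    proof -
      have "(exp (pi * norm w * r - pi / 2 * r\<^sup>2))\<^sup>2 = exp ((2 * pi * norm w) * r - pi * r\<^sup>2)" for r :: real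
        by (simp add: exp_double[symmetric] algebra_simps)
      then show ?thesis
        using integrable_exp_linear_Gaussian[of pi "2 * pi * norm w", where 'a = "complex^'n"]
        by (simp add: square_integrable_def)
    qed
    from integrable_norm[OF integrable_cnj_mult[OF square_integrable_segal_bargmann[OF F] this]]
    show ?thesis
    proof (rule Bochner_Integration.integrable_cong[THEN iffD1, rotated -1])
      fix z :: "complex^'n"
      have e: "exp (- (pi / 2) * r) * exp (x - pi / 2 * r) = exp x * exp (- pi * r)" for x r :: real
        by (simp flip: exp_add)
      show "norm (cnj (F z * complex_of_real (exp (- (pi / 2) * (norm z)\<^sup>2))) * ?h z) =
        cmod (F z) * ?b z * exp (- pi * (norm z)\<^sup>2)"
        unfolding norm_mult complex_mod_cnj norm_of_real abs_exp_cancel mult.assoc e ..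
    qed simp
  qed
  then have "(\<lambda>N. \<integral>z. cnj (S N z) * F z * ?g z \<partial>lborel) \<longlonglongrightarrow>
      (\<integral>z. cnj (reproducing_kernel w z) * F z * ?g z \<partial>lborel)"
  proof (rule integral_dominated_convergence[rotated 2])
    show "AE z in lborel. (\<lambda>N. cnj (S N z) * F z * ?g z) \<longlonglongrightarrow> cnj (reproducing_kernel w z) * F z * ?g z"
    proof (rule AE_I2)
      fix z
      have "(\<lambda>N. S N z) \<longlonglongrightarrow> reproducing_kernel w z"
        using exp_converges[of "?a z"] by (simp add: S_def sums_def reproducing_kernel_def)
      then show "(\<lambda>N. cnj (S N z) * F z * ?g z) \<longlonglongrightarrow> cnj (reproducing_kernel w z) * F z * ?g z"
        by (intro tendsto_intros)
    qed
    show "AE z in lborel. norm (cnj (S N z) * F z * ?g z) \<le> cmod (F z) * ?b z * exp (- pi * (norm z)\<^sup>2)" for N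
      using mult_right_mono[OF mult_right_mono[OF S_le[of N]]]
      by (intro AE_I2) (simp add: norm_mult mult.commute[of "cmod (F _)"])
  qed measurable
  then have "(\<lambda>N. segal_bargmann_cinner (S N) F) \<longlonglongrightarrow> segal_bargmann_cinner (reproducing_kernel w) F"
    by (simp only: segal_bargmann_cinner_def)
  then have "segal_bargmann_cinner (reproducing_kernel w) F = 0"
    using S by (simp add: LIMSEQ_const_iff)
  then show ?thesis
    by (simp add: segal_bargmann_reproducing F)
qed

lemma orthogonal_to_linear_form_products_imp_zero:
  fixes E :: "(complex^'n) set"
  assumes F: "F \<in> segal_bargmann" and E: "vec.span E = UNIV"
    and orth: "\<And>L. set L \<subseteq> E \<Longrightarrow> segal_bargmann_cinner (linear_form_product L) F = 0"
  shows "F w = 0"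
proof (rule segal_bargmann_power_orthogonal_imp_zero[OF F])
  fix m
  have "linear_form_product ([] @ replicate m w) = (\<lambda>z. vec_cinner w z ^ m)"
    by (rule ext, induction m) (simp_all add: linear_form_product_simps)
  then show "segal_bargmann_cinner (\<lambda>z. vec_cinner w z ^ m) F = 0"
    using orthogonal_to_linear_form_products[OF F E orth, of "[]" "replicate m w"] by simp
qed

section \<open>The monoid of eigenvalue products and the point spectrum\<close>

definition eigenvalue_products :: "('n \<Rightarrow> complex) \<Rightarrow> complex set" where
  "eigenvalue_products \<theta> = {\<Prod>j\<in>UNIV. cnj (\<theta> j) ^ n j | n :: 'n \<Rightarrow> nat. True}"

lemma eigenvalue_products_one: "1 \<in> eigenvalue_products \<theta>"
  unfolding eigenvalue_products_def by (rule CollectI, rule exI[of _ "\<lambda>_. 0"]) simp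

lemma eigenvalue_products_mult:
  assumes "x \<in> eigenvalue_products \<theta>" "y \<in> eigenvalue_products \<theta>"
  shows "x * y \<in> eigenvalue_products \<theta>"
proof -
  obtain m n where "x = (\<Prod>j\<in>UNIV. cnj (\<theta> j) ^ m j)" "y = (\<Prod>j\<in>UNIV. cnj (\<theta> j) ^ n j)"
    using assms by (auto simp: eigenvalue_products_def)
  then have "x * y = (\<Prod>j\<in>UNIV. cnj (\<theta> j) ^ (m j + n j))"
    by (simp add: power_add prod.distrib)
  then show ?thesis
    unfolding eigenvalue_products_def by (intro CollectI exI[of _ "\<lambda>j. m j + n j"]) simp
qed

lemma eigenvalue_products_base: "cnj (\<theta> k) \<in> eigenvalue_products \<theta>"
  for \<theta> :: "'n::finite \<Rightarrow> complex"
proof -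
  have "cnj (\<theta> k) = (\<Prod>j\<in>UNIV. cnj (\<theta> j) ^ (if j = k then 1 else 0))"
    by (simp add: if_distrib[of "\<lambda>m. _ ^ m"] cong: if_cong)
  then show ?thesis
    unfolding eigenvalue_products_def by (intro CollectI exI[of _ "\<lambda>j. if j = k then 1 else 0"]) simp
qed

lemma eigenvalue_products_power: "x \<in> eigenvalue_products \<theta> \<Longrightarrow> x ^ n \<in> eigenvalue_products \<theta>"
  by (induction n) (auto intro: eigenvalue_products_one eigenvalue_products_mult)

lemma linear_form_product_nu:
  assumes g: "unitary_matrix g" and \<theta>: "eigenvalues_with_multiplicity g \<theta>"
    and L: "set L \<subseteq> {v. \<exists>\<kappa>. matrix_eigenvector g \<kappa> v}"
  obtains x where "x \<in> eigenvalue_products \<theta>" "cmod x = 1"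
    "nu s g (linear_form_product L) = (\<lambda>z. (s * x) * linear_form_product L z)"
proof -
  have "\<exists>x\<in>eigenvalue_products \<theta>. cmod x = 1 \<and>
    (\<forall>z. linear_form_product L (matrix_inv g *v z) = x * linear_form_product L z)"
    using L
  proof (induction L)
    case Nil
    show ?case
      by (rule bexI[OF _ eigenvalue_products_one]) (simp add: linear_form_product_simps)
  next
    case (Cons v L)
    then obtain x where x: "x \<in> eigenvalue_products \<theta>" "cmod x = 1"
      "\<And>z. linear_form_product L (matrix_inv g *v z) = x * linear_form_product L z"
      by auto
    obtain \<kappa> where \<kappa>: "matrix_eigenvector g \<kappa> v"
      using Cons.prems by auto
    then obtain k where k: "\<kappa> = \<theta> k"
      using eigenvalues_range[OF \<theta>, of \<kappa>] by blast
    show ?case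
    proof (intro bexI conjI allI)
      show "cnj \<kappa> * x \<in> eigenvalue_products \<theta>"
        unfolding k by (rule eigenvalue_products_mult[OF eigenvalue_products_base x(1)])
      show "cmod (cnj \<kappa> * x) = 1"
        by (simp add: norm_mult x unitary_eigenvalue(1)[OF g \<kappa>])
      show "linear_form_product (v # L) (matrix_inv g *v z) = cnj \<kappa> * x * linear_form_product (v # L) z" for z
        by (simp add: linear_form_product_simps x unitary_eigenvector_cinner[OF g \<kappa>] mult_ac)
    qed
  qed
  then show ?thesis
    using that by (auto simp: nu_def fun_eq_iff mult.assoc)
qed

lemma metaplectic_point_spectrum:
  fixes g :: "complex^'n^'n"
  assumes g: "unitary_matrix g" and s: "cmod s = 1" and \<theta>: "eigenvalues_with_multiplicity g \<theta>"
  shows "point_spectrum (metaplectic s g) = (*) s ` eigenvalue_products \<theta>"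
proof (intro equalityI subsetI)
  fix \<kappa> assume "\<kappa> \<in> (*) s ` eigenvalue_products \<theta>"
  then obtain n where n: "\<kappa> = s * (\<Prod>j\<in>UNIV. cnj (\<theta> j) ^ n j)"
    by (auto simp: eigenvalue_products_def)
  have "\<forall>j. \<exists>v. matrix_eigenvector g (\<theta> j) v"
    using eigenvalues_range[OF \<theta>] by blast
  then obtain v where v: "\<And>j. matrix_eigenvector g (\<theta> j) (v j)"
    by metis
  from polynomial_eigenvector[where \<theta> = \<theta>, OF g v, of s n] show "\<kappa> \<in> point_spectrum (metaplectic s g)"
    unfolding n point_spectrum_def by blast
next
  fix \<kappa> assume "\<kappa> \<in> point_spectrum (metaplectic s g)"
  then obtain u where u: "u \<noteq> 0" "metaplectic s g u = \<kappa> *\<^sub>C u"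
    by (auto simp: point_spectrum_def is_eigenvector_def)
  define F where "F = bargmann u"
  have F: "F \<in> segal_bargmann"
    by (simp add: F_def bargmann_segal_bargmann)
  have nuF: "nu s g F = (\<lambda>z. \<kappa> * F z)"
    using arg_cong[OF u(2), of bargmann] by (simp add: bargmann_metaplectic g F_def bargmann_scaleC_fun)
  show "\<kappa> \<in> (*) s ` eigenvalue_products \<theta>"
  proof (rule ccontr)
    assume not: "\<kappa> \<notin> (*) s ` eigenvalue_products \<theta>"
    have "segal_bargmann_cinner (linear_form_product L) F = 0"
      if L: "set L \<subseteq> {v. \<exists>\<kappa>. matrix_eigenvector g \<kappa> v}" for L
    proof -
      obtain x where x: "x \<in> eigenvalue_products \<theta>" "cmod x = 1"
        "nu s g (linear_form_product L) = (\<lambda>z. (s * x) * linear_form_product L z)"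
        using linear_form_product_nu[OF g \<theta> L] by blast
      \<comment> \<open>Eigenfunctions of a unitary map for different eigenvalues are orthogonal:
        the product is multiplied by cnj (s x) \<kappa>, and since |s x| = 1 this factor is 1 only
        for \<kappa> = s x.\<close>
      have "segal_bargmann_cinner (linear_form_product L) F =
        cnj (s * x) * (\<kappa> * segal_bargmann_cinner (linear_form_product L) F)"
        using nu_cinner[OF g s linear_form_product_segal_bargmann F, of L]
        by (simp only: x nuF segal_bargmann_cinner_scale_left segal_bargmann_cinner_scale_right)
      moreover have "cnj (s * x) * \<kappa> \<noteq> 1"
      proof
        assume "cnj (s * x) * \<kappa> = 1"
        moreover have "s * x * cnj (s * x) = 1"
          using complex_norm_square[of "s * x"] s x(2) by (simp add: norm_mult)
        ultimately have "\<kappa> = s * x"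
          by (metis mult.assoc mult.commute mult_1)
        with not x(1) show False
          by blast
      qed
      ultimately show ?thesis
        by (metis mult.assoc mult_cancel_right1)
    qed
    then have "F w = 0" for w
      by (rule orthogonal_to_linear_form_products_imp_zero[OF F unitary_eigenvectors_span[OF g]])
    then have "u = 0"
      unfolding F_def by (rule bargmann_eq_0_imp)
    with u(1) show False ..
  qed
qed

section \<open>Spectra of unitary operators\<close>

lemma clinear_op_add: "clinear_op T \<Longrightarrow> T (u + v) = T u + T v"
  by (simp add: clinear_op_def)

lemma clinear_op_scaleC: "clinear_op T \<Longrightarrow> T (c *\<^sub>C u) = c *\<^sub>C T u"
  by (simp add: clinear_op_def)

lemma clinear_op_diff: "clinear_op T \<Longrightarrow> T (u - v) = T u - T v"
  by (simp add: minus_l2_def clinear_op_add clinear_op_scaleC)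

lemma unitary_op_clinear: "unitary_op T \<Longrightarrow> clinear_op T"
  by (simp add: unitary_op_def)

lemma unitary_op_norm: "unitary_op T \<Longrightarrow> norm (T u) = norm u"
  by (rule l2_cinner_self_eqD) (simp add: unitary_op_def)

lemma bounded_linear_clinear_op:
  assumes "clinear_op T" "\<And>u. norm (T u) \<le> norm u * K"
  shows "bounded_linear T"
  by (rule bounded_linear_intro[where K = K])
    (use assms in \<open>auto simp: clinear_op_add clinear_op_scaleC scaleR_scaleC\<close>)

text \<open>The lower bound makes solutions unique, so the solution operator \<open>R\<close>
  inherits linearity from \<open>T\<close>, and it bounds \<open>R\<close> by 1 / c.\<close>

lemma resolvent_set_bounded_below:
  assumes T: "clinear_op T" and surj: "\<And>f. \<exists>u. T u - \<kappa> *\<^sub>C u = f"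
    and c: "c > 0" "\<And>u. c * norm u \<le> norm (T u - \<kappa> *\<^sub>C u)"
  shows "\<kappa> \<in> resolvent_set T"
proof -
  obtain R where R: "\<And>f. T (R f) - \<kappa> *\<^sub>C R f = f"
    using surj by metis
  have inj: "u = v" if "T u - \<kappa> *\<^sub>C u = T v - \<kappa> *\<^sub>C v" for u v
  proof -
    have "T (u - v) - \<kappa> *\<^sub>C (u - v) = 0"
      using that by (simp add: clinear_op_diff[OF T] scaleC_diff_right algebra_simps)
    then have "c * norm (u - v) \<le> 0"
      using c(2)[of "u - v"] by simp
    then show ?thesis
      using c(1) by (simp add: mult_le_0_iff)
  qed
  have clin: "clinear_op R"
    unfolding clinear_op_def
  proof (intro conjI allI)
    show "R (f + h) = R f + R h" for f h
    proof (rule inj)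
      have "T (R f + R h) - \<kappa> *\<^sub>C (R f + R h) = (T (R f) - \<kappa> *\<^sub>C R f) + (T (R h) - \<kappa> *\<^sub>C R h)"
        by (simp add: clinear_op_add[OF T] scaleC_add_right)
      then show "T (R (f + h)) - \<kappa> *\<^sub>C R (f + h) = T (R f + R h) - \<kappa> *\<^sub>C (R f + R h)"
        by (simp only: R)
    qed
    show "R (a *\<^sub>C f) = a *\<^sub>C R f" for a f
    proof (rule inj)
      have "T (a *\<^sub>C R f) - \<kappa> *\<^sub>C (a *\<^sub>C R f) = a *\<^sub>C (T (R f) - \<kappa> *\<^sub>C R f)"
        by (simp add: clinear_op_scaleC[OF T] scaleC_diff_right mult.commute)
      then show "T (R (a *\<^sub>C f)) - \<kappa> *\<^sub>C R (a *\<^sub>C f) = T (a *\<^sub>C R f) - \<kappa> *\<^sub>C (a *\<^sub>C R f)"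
        by (simp only: R)
    qed
  qed
  moreover have "bounded_linear R"
  proof (rule bounded_linear_clinear_op[OF clin])
    show "norm (R f) \<le> norm f * (1 / c)" for f
      using c(2)[of "R f"] c(1) by (simp add: R field_simps)
  qed
  moreover have "R (T u - \<kappa> *\<^sub>C u) = u" for u
    by (rule inj) (rule R)
  ultimately show ?thesis
    unfolding resolvent_set_def using R by blast
qed

text \<open>Off the circle, T u - \<kappa> u = f is a fixed point equation for a contraction: u =
  T'(f + \<kappa> u) with \<open>T'\<close> a right inverse of T if |\<kappa>| < 1, and u = (T u -
  f) / \<kappa> if |\<kappa>| > 1. The reverse triangle inequality supplies the lower bound |1 -
  |\<kappa>||.\<close>

lemma unitary_spectrum_subset_sphere:
  fixes T :: "'a::euclidean_space l2 \<Rightarrow> 'a l2"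
  assumes T: "unitary_op T"
  shows "spectrum T \<subseteq> sphere 0 1"
proof
  fix \<kappa> assume "\<kappa> \<in> spectrum T"
  then have not: "\<kappa> \<notin> resolvent_set T"
    by (simp add: spectrum_def)
  note lin = unitary_op_clinear[OF T]
  have nT: "norm (T u - T v) = norm (u - v)" for u v
    using unitary_op_norm[OF T, of "u - v"] by (simp add: clinear_op_diff[OF lin])
  show "\<kappa> \<in> sphere 0 1"
  proof (rule ccontr)
    assume "\<kappa> \<notin> sphere 0 1"
    then have \<kappa>: "cmod \<kappa> \<noteq> 1"
      by (simp add: dist_norm)
    have "\<exists>u. T u - \<kappa> *\<^sub>C u = f" for f
    proof (cases "cmod \<kappa> < 1")
      case True
      have "\<forall>y. \<exists>x. T x = y"
        using T unfolding unitary_op_def by (metis surjD)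
      then obtain T' where T': "\<And>y. T (T' y) = y"
        by metis
      have "dist (T' (f + \<kappa> *\<^sub>C u)) (T' (f + \<kappa> *\<^sub>C v)) \<le> cmod \<kappa> * dist u v" for u v
        using nT[of "T' (f + \<kappa> *\<^sub>C u)" "T' (f + \<kappa> *\<^sub>C v)"]
        by (simp add: T' dist_norm scaleC_diff_right[symmetric])
      then obtain u where "T' (f + \<kappa> *\<^sub>C u) = u"
        using banach_fix_type[of "cmod \<kappa>" "\<lambda>u. T' (f + \<kappa> *\<^sub>C u)"] True by auto
      then have "T u = f + \<kappa> *\<^sub>C u"
        using T' by metis
      then show ?thesis
        by (intro exI[of _ u]) simp
    next
      case False
      with \<kappa> have \<kappa>1: "cmod \<kappa> > 1"
        by simp
      have "dist (inverse \<kappa> *\<^sub>C (T u - f)) (inverse \<kappa> *\<^sub>C (T v - f)) \<le> inverse (cmod \<kappa>) * dist u v" for u v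
        using nT[of u v] by (simp add: dist_norm scaleC_diff_right[symmetric] norm_inverse)
      moreover have "inverse (cmod \<kappa>) < 1"
        using \<kappa>1 by (simp add: inverse_less_1_iff)
      ultimately obtain u where u: "inverse \<kappa> *\<^sub>C (T u - f) = u"
        using banach_fix_type[of "inverse (cmod \<kappa>)" "\<lambda>u. inverse \<kappa> *\<^sub>C (T u - f)"] by auto
      have "\<kappa> \<noteq> 0"
        using \<kappa>1 by auto
      then have "\<kappa> *\<^sub>C u = T u - f"
        using arg_cong[OF u, of "(*\<^sub>C) \<kappa>"] by simp
      then show ?thesis
        by (intro exI[of _ u]) simp
    qed
    moreover have "\<bar>1 - cmod \<kappa>\<bar> * norm u \<le> norm (T u - \<kappa> *\<^sub>C u)" for u
    proof -
      have "\<bar>norm (T u) - norm (\<kappa> *\<^sub>C u)\<bar> \<le> norm (T u - \<kappa> *\<^sub>C u)"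
        by (rule norm_triangle_ineq3)
      also have "norm (T u) - norm (\<kappa> *\<^sub>C u) = (1 - cmod \<kappa>) * norm u"
        by (simp add: unitary_op_norm[OF T] algebra_simps)
      finally show ?thesis
        by (simp add: abs_mult)
    qed
    moreover have "\<bar>1 - cmod \<kappa>\<bar> > 0"
      using \<kappa> by simp
    ultimately have "\<kappa> \<in> resolvent_set T"
      using resolvent_set_bounded_below[OF lin] by blast
    with not show False ..
  qed
qed

text \<open>An eigenvector for \<mu> is an approximate eigenvector for any nearby \<kappa>: a
  resolvent at \<kappa> with bound K would force |\<mu> - \<kappa>| \<ge> 1 / K.\<close>

lemma closure_point_spectrum_subset: "closure (point_spectrum T) \<subseteq> spectrum T"
proof
  fix \<kappa> assume \<kappa>: "\<kappa> \<in> closure (point_spectrum T)"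
  show "\<kappa> \<in> spectrum T"
  proof (rule ccontr)
    assume "\<kappa> \<notin> spectrum T"
    then obtain R where R: "bounded_linear R" "\<And>u. R (T u - \<kappa> *\<^sub>C u) = u"
      by (auto simp: spectrum_def resolvent_set_def)
    obtain K where K: "K > 0" "\<And>u. norm (R u) \<le> norm u * K"
      using bounded_linear.pos_bounded[OF R(1)] by blast
    then obtain \<mu> where \<mu>: "\<mu> \<in> point_spectrum T" "dist \<mu> \<kappa> < 1 / K"
      using \<kappa> unfolding closure_approachable by (metis divide_pos_pos zero_less_one)
    then obtain u where u: "u \<noteq> 0" "T u = \<mu> *\<^sub>C u"
      by (auto simp: point_spectrum_def is_eigenvector_def)
    have "norm u = norm (R ((\<mu> - \<kappa>) *\<^sub>C u))"
      using R(2)[of u] by (simp add: u scaleC_diff_left)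
    also have "\<dots> \<le> cmod (\<mu> - \<kappa>) * norm u * K"
      using K(2)[of "(\<mu> - \<kappa>) *\<^sub>C u"] by simp
    also have "\<dots> < 1 / K * norm u * K"
      using \<mu>(2) u(1) K(1) by (intro mult_strict_right_mono) (auto simp: dist_norm)
    finally show False
      using K(1) by simp
  qed
qed

lemma point_spectrum_subset_spectrum: "point_spectrum T \<subseteq> spectrum T"
  using closure_subset closure_point_spectrum_subset by (rule order_trans)

text \<open>T^r - \<kappa>^r factors through T - \<kappa>, the cofactor S being the sum of
  \<kappa>^(r-1-i) T^i over i < r. Passing from r to r + 1 replaces S by \<kappa> S + T^r. Both
  orders of the factors are recorded because a resolvent inverts from both sides.\<close>

lemma geometric_sum_operator:
  assumes T: "unitary_op T"
  shows "\<exists>S K. clinear_op S \<and> (\<forall>u. norm (S u) \<le> norm u * K) \<and>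
    (\<forall>u. T (S u) - \<kappa> *\<^sub>C S u = (T ^^ r) u - \<kappa> ^ r *\<^sub>C u) \<and>
    (\<forall>u. S (T u - \<kappa> *\<^sub>C u) = (T ^^ r) u - \<kappa> ^ r *\<^sub>C u)"
proof (induction r)
  case 0
  have "T 0 = 0"
    using clinear_op_scaleC[OF unitary_op_clinear[OF T], of 0 0] by simp
  then show ?case
    by (intro exI[of _ "\<lambda>u. 0"] exI[of _ 0]) (simp add: clinear_op_def)
next
  case (Suc r)
  note lin = unitary_op_clinear[OF T]
  obtain S K where S: "clinear_op S" "\<And>u. norm (S u) \<le> norm u * K"
    "\<And>u. T (S u) - \<kappa> *\<^sub>C S u = (T ^^ r) u - \<kappa> ^ r *\<^sub>C u"
    "\<And>u. S (T u - \<kappa> *\<^sub>C u) = (T ^^ r) u - \<kappa> ^ r *\<^sub>C u"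
    using Suc by blast
  have pow_lin: "clinear_op (T ^^ i)" for i
    by (induction i) (auto simp: clinear_op_def clinear_op_add[OF lin] clinear_op_scaleC[OF lin])
  have pow_norm: "norm ((T ^^ i) u) = norm u" for i u
    by (induction i) (auto simp: unitary_op_norm[OF T])
  have S': "T (S u) = (T ^^ r) u - \<kappa> ^ r *\<^sub>C u + \<kappa> *\<^sub>C S u" for u
    using S(3)[of u] by (simp add: algebra_simps)
  let ?S = "\<lambda>u. \<kappa> *\<^sub>C S u + (T ^^ r) u"
  show ?case
  proof (intro exI conjI allI)
    show "clinear_op ?S"
      using S(1) pow_lin[of r] by (simp add: clinear_op_def scaleC_add_right mult.commute)
    show "norm (?S u) \<le> norm u * (cmod \<kappa> * K + 1)" for u
    proof -
      have "norm (?S u) \<le> cmod \<kappa> * norm (S u) + norm u"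
        using norm_triangle_ineq[of "\<kappa> *\<^sub>C S u" "(T ^^ r) u"] by (simp add: pow_norm)
      also have "\<dots> \<le> cmod \<kappa> * (norm u * K) + norm u"
        using S(2) by (intro add_right_mono mult_left_mono) auto
      finally show ?thesis
        by (simp add: algebra_simps)
    qed
    show "T (?S u) - \<kappa> *\<^sub>C ?S u = (T ^^ Suc r) u - \<kappa> ^ Suc r *\<^sub>C u" for u
      by (simp add: clinear_op_add[OF lin] clinear_op_scaleC[OF lin] S' scaleC_add_right scaleC_diff_right)
    show "?S (T u - \<kappa> *\<^sub>C u) = (T ^^ Suc r) u - \<kappa> ^ Suc r *\<^sub>C u" for u
      by (simp add: S(4) clinear_op_diff[OF pow_lin] clinear_op_scaleC[OF pow_lin] scaleC_diff_right
          funpow_swap1)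
  qed
qed

text \<open>If \<kappa>^r differs from c, the geometric sum divided by c - \<kappa>^r is a bounded
  two-sided inverse of T - \<kappa>.\<close>

lemma spectrum_of_root:
  assumes T: "unitary_op T" and c: "\<And>u. (T ^^ r) u = c *\<^sub>C u"
  shows "spectrum T \<subseteq> {\<kappa>. \<kappa> ^ r = c}"
proof (rule subsetI, rule CollectI, rule ccontr)
  fix \<kappa> assume \<kappa>: "\<kappa> \<in> spectrum T" "\<kappa> ^ r \<noteq> c"
  note lin = unitary_op_clinear[OF T]
  obtain S K where S: "clinear_op S" "\<And>u. norm (S u) \<le> norm u * K"
    "\<And>u. T (S u) - \<kappa> *\<^sub>C S u = (c - \<kappa> ^ r) *\<^sub>C u"
    "\<And>u. S (T u - \<kappa> *\<^sub>C u) = (c - \<kappa> ^ r) *\<^sub>C u"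
    using geometric_sum_operator[OF T, of \<kappa> r] by (auto simp: c scaleC_diff_left)
  let ?a = "inverse (c - \<kappa> ^ r)"
  have a: "?a * (c - \<kappa> ^ r) = 1"
    using \<kappa>(2) by simp
  have clin: "clinear_op (\<lambda>u. ?a *\<^sub>C S u)"
    using S(1) by (simp add: clinear_op_def scaleC_add_right mult.commute)
  moreover have "bounded_linear (\<lambda>u. ?a *\<^sub>C S u)"
  proof (rule bounded_linear_clinear_op[OF clin])
    show "norm (?a *\<^sub>C S u) \<le> norm u * (cmod ?a * K)" for u
      using mult_left_mono[OF S(2)[of u], of "cmod ?a"] by (simp add: mult_ac)
  qed
  moreover have "?a *\<^sub>C S (T u - \<kappa> *\<^sub>C u) = u" for u
    by (simp only: S(4) scaleC_scaleC a scaleC_one)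
  moreover have "T (?a *\<^sub>C S u) - \<kappa> *\<^sub>C (?a *\<^sub>C S u) = u" for u
  proof -
    have "T (?a *\<^sub>C S u) - \<kappa> *\<^sub>C (?a *\<^sub>C S u) = ?a *\<^sub>C (T (S u) - \<kappa> *\<^sub>C S u)"
      by (simp add: clinear_op_scaleC[OF lin] scaleC_diff_right mult.commute)
    then show ?thesis
      by (simp only: S(3) scaleC_scaleC a scaleC_one)
  qed
  ultimately have "\<kappa> \<in> resolvent_set T"
    unfolding resolvent_set_def by blast
  with \<kappa>(1) show False
    by (simp add: spectrum_def)
qed

section \<open>Roots of unity\<close>

text \<open>The exponent \<open>N\<close> makes \<open>P\<close> finite and keeps 0 out of it. With
  r = card P every element is an r-th root of unity, and there are exactly r of these, so the
  inclusion is an equality.\<close>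

lemma finite_mult_closed_eq_roots_unity:
  fixes P :: "complex set"
  assumes one: "1 \<in> P" and mult: "\<And>x y. x \<in> P \<Longrightarrow> y \<in> P \<Longrightarrow> x * y \<in> P"
    and N: "N > 0" "\<And>x. x \<in> P \<Longrightarrow> x ^ N = 1"
  obtains r where "r > 0" "P = {z. z ^ r = 1}"
proof -
  have fin_roots: "finite {z::complex. z ^ n = 1}" and card_roots: "card {z::complex. z ^ n = 1} = n"
    if "n > 0" for n
    using card_roots_unity_eq[OF that] that by (auto intro: card_ge_0_finite)
  have fin: "finite P"
    using N(2) by (intro finite_subset[OF _ fin_roots[OF N(1)]]) auto
  have nz: "x \<noteq> 0" if "x \<in> P" for x
    using N(2)[OF that] N(1) by (auto simp: power_0_left)
  define r where "r = card P"
  have r: "r > 0"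
    using fin one by (auto simp: r_def card_gt_0_iff)
  have "x ^ r = 1" if x: "x \<in> P" for x
  proof -
    \<comment> \<open>Multiplication by \<open>x\<close> permutes \<open>P\<close>; compare the products of all elements.\<close>
    have inj: "inj_on ((*) x) P"
      using nz[OF x] by (auto simp: inj_on_def)
    have "(*) x ` P = P"
      using endo_inj_surj[OF fin _ inj] mult[OF x] by auto
    then have "\<Prod>P = (\<Prod>y\<in>P. x * y)"
      using prod.reindex[OF inj, of "\<lambda>y. y"] by simp
    also have "\<dots> = x ^ r * \<Prod>P"
      by (simp add: prod.distrib r_def)
    finally show ?thesis
      using nz fin by simp
  qed
  then have "P \<subseteq> {z. z ^ r = 1}"
    by auto
  then have "P = {z. z ^ r = 1}"
    by (rule card_subset_eq[OF fin_roots[OF r]]) (simp only: card_roots[OF r] r_def[symmetric])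
  with r show ?thesis
    by (rule that)
qed

text \<open>The m-th power of exp (2 pi i / q), with an integer exponent so that products and
  conjugates turn into sums and negatives.\<close>

definition unit_root :: "nat \<Rightarrow> int \<Rightarrow> complex" where
  "unit_root q m = exp (2 * of_real pi * \<i> * of_int m / of_nat q)"

lemma unit_root_add: "unit_root q (m + n) = unit_root q m * unit_root q n"
  by (simp add: unit_root_def exp_add[symmetric] distrib_left add_divide_distrib)

lemma unit_root_zero [simp]: "unit_root q 0 = 1"
  by (simp add: unit_root_def)

lemma unit_root_power: "unit_root q m ^ n = unit_root q (int n * m)"
  by (induction n) (simp_all add: unit_root_add distrib_right)

lemma unit_root_sum: "(\<Prod>j\<in>J. unit_root q (f j)) = unit_root q (\<Sum>j\<in>J. f j)"
  by (induction J rule: infinite_finite_induct) (simp_all add: unit_root_add)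

lemma unit_root_multiple: "q > 0 \<Longrightarrow> unit_root q (int q * m) = 1"
  by (simp add: unit_root_def exp_eq_1)

lemma cnj_unit_root: "cnj (unit_root q m) = unit_root q (- m)"
  by (simp add: unit_root_def exp_cnj)

text \<open>Over the common denominator q each \<theta> j is the power \<open>a j\<close> of exp (2
  pi i / q). The products form a monoid of q-th roots of unity, hence a group, so Bezout
  coefficients of either sign are available and the power p = gcd |a j| generates it. The second
  claim asserts the order r without expressing it through p and q.\<close>

lemma eigenvalue_products_roots_of_unity:
  fixes \<theta> :: "'n::finite \<Rightarrow> complex"
  assumes \<theta>: "\<And>j. qs j > 0 \<and> \<theta> j = exp (2 * of_real pi * \<i> * of_int (ps j) / of_nat (qs j))"
    and q: "q = Lcm (range qs)" and p: "p = Gcd (range (\<lambda>j. q * nat \<bar>ps j\<bar> div qs j))"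
  shows "eigenvalue_products \<theta> = {exp (2 * of_real pi * \<i> * of_nat n * of_nat p / of_nat q) | n::nat. n > 0}"
    and "\<exists>r>0. eigenvalue_products \<theta> = {z. z ^ r = 1}"
proof -
  have "0 \<notin> range qs"
    using \<theta> by (metis less_irrefl rangeE)
  then have q0: "q > 0"
    by (simp add: q Lcm_0_iff_nat neq0_conv[symmetric] del: neq0_conv)
  define a where "a j = ps j * int (q div qs j)" for j
  have qs: "q = qs j * (q div qs j)" for j
    using dvd_Lcm[of "qs j" "range qs"] by (simp add: q)
  have \<theta>a: "\<theta> j = unit_root q (a j)" for j
  proof -
    have m: "q div qs j \<noteq> 0"
      using qs[of j] q0 by (metis mult_0_right less_irrefl)
    have "complex_of_int (ps j) / of_nat (qs j) = of_int (a j) / of_nat q"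
    proof -
      have "complex_of_nat q = of_nat (qs j) * of_nat (q div qs j)"
        using arg_cong[OF qs[of j], of complex_of_nat] by (simp only: of_nat_mult)
      then show ?thesis
        using m \<theta>[of j] by (simp add: a_def)
    qed
    then show ?thesis
      using \<theta>[of j] by (simp add: unit_root_def times_divide_eq_right[symmetric] del: times_divide_eq_right)
  qed
  have abs_a: "q * nat \<bar>ps j\<bar> div qs j = nat \<bar>a j\<bar>" for j
  proof -
    have "q * nat \<bar>ps j\<bar> = qs j * ((q div qs j) * nat \<bar>ps j\<bar>)"
      using qs[of j] by (metis mult.assoc)
    then have "q * nat \<bar>ps j\<bar> div qs j = (q div qs j) * nat \<bar>ps j\<bar>"
      using \<theta>[of j] by (metis nonzero_mult_div_cancel_left less_irrefl)
    then show ?thesis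
      by (simp add: a_def abs_mult nat_mult_distrib mult.commute)
  qed
  have pa: "int p dvd a j" for j
  proof -
    have "p dvd nat \<bar>a j\<bar>"
      unfolding p by (rule Gcd_dvd) (auto simp: abs_a)
    then show ?thesis
      by (simp add: int_dvd_int_iff[symmetric])
  qed
  let ?P = "eigenvalue_products \<theta>"
  have base: "unit_root q (- a j) \<in> ?P" for j
    using eigenvalue_products_base[of \<theta> j] by (simp add: \<theta>a cnj_unit_root)
  have P: "\<exists>m. x = unit_root q (int p * m)" if "x \<in> ?P" for x
  proof -
    obtain n where "x = (\<Prod>j\<in>UNIV. cnj (\<theta> j) ^ n j)"
      using \<open>x \<in> ?P\<close> by (auto simp: eigenvalue_products_def)
    then have x: "x = unit_root q (\<Sum>j\<in>UNIV. int (n j) * - a j)"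
      by (simp only: \<theta>a cnj_unit_root unit_root_power unit_root_sum)
    have "int p dvd (\<Sum>j\<in>UNIV. int (n j) * - a j)"
      using pa by (intro dvd_sum) (simp add: dvd_mult)
    then show ?thesis
      unfolding x by (metis dvdE)
  qed
  \<comment> \<open>The products have nonnegative exponents only; the inverse of a q-th root of
    unity is its power q - 1.\<close>
  have neg: "unit_root q (- m) \<in> ?P" if "unit_root q m \<in> ?P" for m
  proof -
    have "- m = int q * (- m) + int (q - 1) * m"
      using q0 by (simp add: of_nat_diff algebra_simps)
    then have "unit_root q (- m) = unit_root q m ^ (q - 1)"
      by (metis unit_root_add unit_root_multiple[OF q0] mult_1 unit_root_power)
    then show ?thesis
      using eigenvalue_products_power[OF that] by simp
  qed
  have mul: "unit_root q (k * m) \<in> ?P" if "unit_root q m \<in> ?P" for k m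
  proof (cases "k \<ge> 0")
    case True
    then show ?thesis
      using eigenvalue_products_power[OF that, of "nat k"] by (simp add: unit_root_power)
  next
    case False
    then show ?thesis
      using eigenvalue_products_power[OF neg[OF that], of "nat (- k)"] by (simp add: unit_root_power)
  qed
  \<comment> \<open>Bezout, one element at a time. The empty set has Gcd 0, which corresponds to the
    product 1.\<close>
  have "unit_root q (int (Gcd A)) \<in> ?P" if "finite A" "\<forall>x\<in>A. unit_root q (int x) \<in> ?P" for A
    using that
  proof (induction A rule: finite_induct)
    case empty
    then show ?case
      by (simp add: eigenvalue_products_one)
  next
    case (insert x A)
    obtain u v where "u * int x + v * int (Gcd A) = gcd (int x) (int (Gcd A))"
      using bezout_int by blast
    then have "int (Gcd (insert x A)) = u * int x + v * int (Gcd A)"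
      by (simp add: gcd_int_int_eq)
    with insert show ?case
      by (simp add: unit_root_add mul eigenvalue_products_mult)
  qed
  moreover have "unit_root q (int (nat \<bar>a j\<bar>)) \<in> ?P" for j
    using base[of j] neg[OF base[of j]] by (cases "a j \<ge> 0") auto
  ultimately have p_in: "unit_root q (int p) \<in> ?P"
    unfolding p abs_a by auto
  have ur: "exp (2 * of_real pi * \<i> * of_nat n * of_nat p / of_nat q) = unit_root q (int p * int n)" for n
    by (simp add: unit_root_def mult_ac)
  show "?P = {exp (2 * of_real pi * \<i> * of_nat n * of_nat p / of_nat q) | n::nat. n > 0}"
    unfolding ur
  proof (intro equalityI subsetI)
    fix x assume "x \<in> ?P"
    then obtain m where m: "x = unit_root q (int p * m)"
      using P by blast
    \<comment> \<open>The residue of m modulo q, shifted by q: the claim requires n > 0, while the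
      root depends on n only modulo q.\<close>
    define n where "n = nat (m mod int q) + q"
    have n: "int n = m + int q * (1 - m div int q)"
    proof -
      have "int n = m mod int q + int q"
        using q0 by (simp add: n_def)
      then show ?thesis
        by (simp add: minus_div_mult_eq_mod[symmetric] algebra_simps)
    qed
    have "unit_root q (int p * int n) = x * unit_root q (int q * (int p * (1 - m div int q)))"
      unfolding n m by (subst unit_root_add[symmetric]) (simp add: algebra_simps)
    then have "x = unit_root q (int p * int n)"
      by (simp add: unit_root_multiple q0)
    moreover have "n > 0"
      using q0 by (simp add: n_def)
    ultimately show "x \<in> {unit_root q (int p * int n) | n. n > 0}"
      by blast
  next
    fix x assume "x \<in> {unit_root q (int p * int n) | n. n > 0}"
    then obtain n where "x = unit_root q (int n * int p)"
      by (auto simp: mult.commute)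
    with mul[OF p_in] show "x \<in> ?P"
      by simp
  qed
  have "x ^ q = 1" if "x \<in> ?P" for x
    using P[OF that] by (auto simp: unit_root_power unit_root_multiple q0)
  then obtain r where "r > 0" "?P = {z. z ^ r = 1}"
    using finite_mult_closed_eq_roots_unity[of ?P q] eigenvalue_products_one eigenvalue_products_mult q0
    by metis
  then show "\<exists>r>0. ?P = {z. z ^ r = 1}"
    by blast
qed

lemma roots_unity_subset_sphere:
  assumes "r > 0"
  shows "{z. z ^ r = 1} \<subseteq> sphere (0::complex) 1"
proof
  fix z :: complex assume "z \<in> {z. z ^ r = 1}"
  then have "cmod z ^ r = 1 ^ r"
    by (simp flip: norm_power)
  then have "cmod z = 1"
    by (rule power_eq_imp_eq_base) (use assms in auto)
  then show "z \<in> sphere 0 1"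
    by (simp add: dist_norm)
qed

lemma finite_roots_unity: "r > 0 \<Longrightarrow> finite {z::complex. z ^ r = 1}"
  using card_roots_unity_eq[of r] by (auto intro: card_ge_0_finite)

text \<open>The circle contains all n-th roots of unity, also for an n exceeding its supposed number
  of points.\<close>

lemma infinite_circle: "infinite (sphere (0::complex) 1)"
proof
  assume fin: "finite (sphere (0::complex) 1)"
  let ?n = "Suc (card (sphere (0::complex) 1))"
  have "card {z::complex. z ^ ?n = 1} \<le> card (sphere (0::complex) 1)"
    by (rule card_mono[OF fin roots_unity_subset_sphere]) simp
  then show False
    by (subst (asm) card_roots_unity_eq) auto
qed

lemma circle_group_subgroup:
  assumes r: "r > 0"
  shows "subgroup {z. z ^ r = 1} circle_group"
proof -
  have group: "group circle_group"
  proof (rule groupI)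
    fix x assume "x \<in> carrier circle_group"
    then have "cmod x = 1"
      by (simp add: circle_group_def dist_norm)
    moreover from this have "x \<noteq> 0"
      by auto
    ultimately have "inverse x \<in> carrier circle_group" "inverse x \<otimes>\<^bsub>circle_group\<^esub> x = \<one>\<^bsub>circle_group\<^esub>"
      by (auto simp: circle_group_def dist_norm norm_inverse)
    then show "\<exists>y\<in>carrier circle_group. y \<otimes>\<^bsub>circle_group\<^esub> x = \<one>\<^bsub>circle_group\<^esub>"
      by blast
  qed (auto simp: circle_group_def dist_norm norm_mult)
  show ?thesis
  proof (rule group.subgroupI[OF group])
    show "{z. z ^ r = 1} \<subseteq> carrier circle_group"
      using roots_unity_subset_sphere[OF r] by (simp add: circle_group_def)
    show "{z. z ^ r = 1} \<noteq> ({} :: complex set)"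
      by (auto intro: exI[of _ 1])
    fix a :: complex assume a: "a \<in> {z. z ^ r = 1}"
    then have "cmod a = 1"
      using roots_unity_subset_sphere[OF r] by (auto simp: dist_norm)
    moreover from this have "a \<noteq> 0"
      by auto
    ultimately have "inv\<^bsub>circle_group\<^esub> a = inverse a"
      by (intro group.inv_equality[OF group]) (auto simp: circle_group_def dist_norm norm_inverse)
    then show "inv\<^bsub>circle_group\<^esub> a \<in> {z. z ^ r = 1}"
      using a by (simp add: power_inverse)
  qed (auto simp: circle_group_def power_mult_distrib)
qed

section \<open>The spectrum of the metaplectic operator\<close>

lemma bargmann_metaplectic_power:
  assumes g: "unitary_matrix g"
  shows "bargmann ((metaplectic s g ^^ r) u) z = s ^ r * bargmann u (((*v) (matrix_inv g) ^^ r) z)"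
proof (induction r arbitrary: z)
  case (Suc r)
  then show ?case
    by (simp add: bargmann_metaplectic g nu_def) (simp add: funpow_swap1)
qed simp

text \<open>The inverse acts on an eigenvector as multiplication by cnj \<kappa>, whose r-th power
  is 1, and the eigenvectors span.\<close>

lemma matrix_inv_power_eq_id:
  assumes g: "unitary_matrix g" and r: "\<And>\<kappa> v. matrix_eigenvector g \<kappa> v \<Longrightarrow> \<kappa> ^ r = 1"
  shows "((*v) (matrix_inv g) ^^ r) z = z"
proof -
  let ?f = "(*v) (matrix_inv g)"
  have lin: "(?f ^^ n) (c *s x + y) = c *s (?f ^^ n) x + (?f ^^ n) y" for n c x y
    by (induction n) (simp_all add: matrix_vector_right_distrib vector_scalar_commute)
  have "z \<in> vec.span {v. \<exists>\<kappa>. matrix_eigenvector g \<kappa> v}"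
    by (simp add: unitary_eigenvectors_span[OF g])
  then show ?thesis
  proof (induction rule: vec.span_induct_alt)
    case base
    \<comment> \<open>The coefficient -1 in \<open>lin\<close> shows that the iterate fixes
      0.\<close>
    show ?case
      using lin[of r 0 0 0] lin[of r "-1" 0 0] by simp
  next
    case (step c x y)
    then obtain \<kappa> where \<kappa>: "matrix_eigenvector g \<kappa> x"
      by blast
    have "(?f ^^ n) x = cnj \<kappa> ^ n *s x" for n
      by (induction n) (simp_all add: vector_scalar_commute unitary_eigenvalue(2)[OF g \<kappa>] mult.commute)
    moreover have "cnj \<kappa> ^ r = 1"
      using r[OF \<kappa>] by (metis complex_cnj_power complex_cnj_one)
    ultimately show ?case
      using step by (simp add: lin)
  qed
qed

lemma metaplectic_spectrum_finite:
  fixes g :: "complex^'n^'n"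
  assumes g: "unitary_matrix g" and s: "cmod s = 1" and \<theta>: "eigenvalues_with_multiplicity g \<theta>"
    and P: "eigenvalue_products \<theta> = {z. z ^ r = 1}"
  shows "spectrum (metaplectic s g) = (*) s ` eigenvalue_products \<theta>"
proof
  have "\<kappa> ^ r = 1" if v: "matrix_eigenvector g \<kappa> v" for \<kappa> v
  proof -
    obtain j where "\<kappa> = \<theta> j"
      using eigenvalues_range[OF \<theta>, of \<kappa>] v by blast
    then have "cnj \<kappa> ^ r = 1"
      using eigenvalue_products_base[of \<theta> j] P by auto
    then show ?thesis
      by (metis complex_cnj_power complex_cnj_one complex_cnj_cnj)
  qed
  \<comment> \<open>After r substitutions the argument is back at z, and only the scalar s^r is
    left.\<close>
  then have "(metaplectic s g ^^ r) u = s ^ r *\<^sub>C u" for u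
    by (intro bargmann_inject ext)
      (simp add: bargmann_metaplectic_power g bargmann_scaleC matrix_inv_power_eq_id[OF g])
  then have "spectrum (metaplectic s g) \<subseteq> {\<kappa>. \<kappa> ^ r = s ^ r}"
    by (rule spectrum_of_root[OF metaplectic_unitary_op[OF g s]])
  also have "\<dots> \<subseteq> (*) s ` {z. z ^ r = 1}"
  proof
    fix \<kappa> assume \<kappa>: "\<kappa> \<in> {\<kappa>. \<kappa> ^ r = s ^ r}"
    have "s \<noteq> 0"
      using s by auto
    then have "(\<kappa> / s) ^ r = 1" "\<kappa> = s * (\<kappa> / s)"
      using \<kappa> by (auto simp: power_divide)
    then show "\<kappa> \<in> (*) s ` {z. z ^ r = 1}"
      by blast
  qed
  finally show "spectrum (metaplectic s g) \<subseteq> (*) s ` eigenvalue_products \<theta>"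
    by (simp add: P)
  show "(*) s ` eigenvalue_products \<theta> \<subseteq> spectrum (metaplectic s g)"
    using point_spectrum_subset_spectrum metaplectic_point_spectrum[OF g s \<theta>] by metis
qed

lemma eigenvalue_products_dense:
  fixes \<theta> :: "'n::finite \<Rightarrow> complex"
  assumes \<alpha>: "\<alpha> \<notin> \<rat>" and k: "\<theta> k = exp (2 * of_real pi * \<i> * of_real \<alpha>)"
  shows "sphere 0 1 \<subseteq> closure (eigenvalue_products \<theta>)"
proof
  fix y :: complex assume "y \<in> sphere 0 1"
  then have "cmod y = 1"
    by (simp add: dist_norm)
  moreover from this have "y \<noteq> 0"
    by auto
  ultimately have "y = exp (\<i> * of_real (Arg y))"
    using Arg_eq[of y] by simp
  define \<beta> where "\<beta> = Arg y / (2 * pi)"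
  let ?e = "\<lambda>x::real. exp (2 * of_real pi * \<i> * of_real x)"
  have y: "y = ?e \<beta>"
    using \<open>y = exp (\<i> * of_real (Arg y))\<close> by (simp add: \<beta>_def mult_ac)
  show "y \<in> closure (eigenvalue_products \<theta>)"
    unfolding closure_approachable
  proof (intro allI impI)
    fix \<epsilon> :: real assume "\<epsilon> > 0"
    have "isCont ?e \<beta>"
      by (intro continuous_intros)
    then obtain \<delta> where \<delta>: "\<delta> > 0" "\<And>x. dist x \<beta> < \<delta> \<Longrightarrow> dist (?e x) (?e \<beta>) < \<epsilon>"
      using \<open>\<epsilon> > 0\<close> unfolding continuous_at_eps_delta by blast
    \<comment> \<open>The conjugate eigenvalue has angle -\<alpha>. The density theorem supplies a
      positive multiplier n, which makes its power a member of \<open>eigenvalue_products\<close>;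
      the integer h counts full turns and disappears in the exponential.\<close>
    have "- \<alpha> \<notin> \<rat>"
      using \<alpha> by simp
    then obtain h n where n: "n > 0" "\<bar>of_int n * (- \<alpha>) - of_int h - \<beta>\<bar> < \<delta>"
      using \<delta>(1) by (rule sequence_of_fractional_parts_is_dense)
    have "?e (of_int n * (- \<alpha>) - of_int h) = cnj (\<theta> k) ^ nat n"
    proof -
      have "?e (of_int n * (- \<alpha>) - of_int h) = ?e (real (nat n) * (- \<alpha>)) * ?e (- of_int h)"
      proof -
        have "of_int n * (- \<alpha>) - of_int h = real (nat n) * (- \<alpha>) + (- of_int h)"
          using n(1) by simp
        then show ?thesis
          by (simp only: of_real_add distrib_left exp_add)
      qed
      also have "?e (- of_int h) = 1"
        by (auto simp: exp_eq_1 intro!: exI[of _ "- h"])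
      also have "?e (real (nat n) * (- \<alpha>)) = cnj (\<theta> k) ^ nat n"
        by (simp add: k exp_cnj exp_of_nat_mult[symmetric] mult_ac)
      finally show ?thesis
        by simp
    qed
    then have "?e (of_int n * (- \<alpha>) - of_int h) \<in> eigenvalue_products \<theta>"
      using eigenvalue_products_power[OF eigenvalue_products_base] by simp
    moreover have "dist (?e (of_int n * (- \<alpha>) - of_int h)) y < \<epsilon>"
      unfolding y using n(2) by (intro \<delta>(2)) (simp add: dist_real_def)
    ultimately show "\<exists>x\<in>eigenvalue_products \<theta>. dist x y < \<epsilon>"
      by blast
  qed
qed

lemma closure_scaled:
  fixes s :: complex
  assumes s: "cmod s = 1" and P: "sphere 0 1 \<subseteq> closure P"
  shows "sphere 0 1 \<subseteq> closure ((*) s ` P)"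
proof
  fix y :: complex assume y: "y \<in> sphere 0 1"
  have s0: "s \<noteq> 0"
    using s by auto
  have "y / s \<in> closure P"
    using P y s by (auto simp: dist_norm norm_divide)
  then obtain X where X: "\<And>n. X n \<in> P" "X \<longlonglongrightarrow> y / s"
    unfolding closure_sequential by blast
  have "(\<lambda>n. s * X n) \<longlonglongrightarrow> s * (y / s)"
    by (intro tendsto_intros X)
  then show "y \<in> closure ((*) s ` P)"
    unfolding closure_sequential using X(1) s0 by (intro exI[of _ "\<lambda>n. s * X n"]) auto
qed

lemma irrational_rotation_iff_spectrum:
  fixes g :: "complex^'n^'n"
  assumes g: "unitary_matrix g" and s: "cmod s = 1" and \<theta>: "eigenvalues_with_multiplicity g \<theta>"
  shows "has_irrational_rotation_eigenvalue g \<longleftrightarrow> spectrum (metaplectic s g) = sphere 0 1"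
proof
  assume "has_irrational_rotation_eigenvalue g"
  then obtain \<alpha> v where \<alpha>: "\<alpha> \<notin> \<rat>" and v: "matrix_eigenvector g (exp (2 * of_real pi * \<i> * of_real \<alpha>)) v"
    by (auto simp: has_irrational_rotation_eigenvalue_def)
  then obtain k where k: "\<theta> k = exp (2 * of_real pi * \<i> * of_real \<alpha>)"
    using eigenvalues_range[OF \<theta>, of "exp (2 * of_real pi * \<i> * of_real \<alpha>)"] by fastforce
  have "sphere 0 1 \<subseteq> closure (point_spectrum (metaplectic s g))"
    unfolding metaplectic_point_spectrum[OF g s \<theta>]
    by (rule closure_scaled[OF s eigenvalue_products_dense[where \<theta> = \<theta> and k = k, OF \<alpha> k]])
  also have "\<dots> \<subseteq> spectrum (metaplectic s g)"
    by (rule closure_point_spectrum_subset)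
  finally show "spectrum (metaplectic s g) = sphere 0 1"
    using unitary_spectrum_subset_sphere[OF metaplectic_unitary_op[OF g s]] by blast
next
  assume S: "spectrum (metaplectic s g) = sphere 0 1"
  show "has_irrational_rotation_eigenvalue g"
  proof (rule ccontr)
    \<comment> \<open>All angles are then rational, so the spectrum is a rotated finite group of
      roots of unity, whereas the circle is infinite.\<close>
    assume rat: "\<not> has_irrational_rotation_eigenvalue g"
    have "\<exists>(p::int) (q::nat). q > 0 \<and> \<theta> j = exp (2 * of_real pi * \<i> * of_int p / of_nat q)" for j
    proof -
      obtain v where v: "matrix_eigenvector g (\<theta> j) v"
        using eigenvalues_range[OF \<theta>, of "\<theta> j"] by blast
      define \<alpha> where "\<alpha> = Arg (\<theta> j) / (2 * pi)"
      have "cmod (\<theta> j) = 1"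
        by (rule unitary_eigenvalue(1)[OF g v])
      moreover from this have "\<theta> j \<noteq> 0"
        by auto
      ultimately have "\<theta> j = exp (\<i> * of_real (Arg (\<theta> j)))"
        using Arg_eq[of "\<theta> j"] by simp
      also have "\<dots> = exp (2 * of_real pi * \<i> * of_real \<alpha>)"
        by (simp add: \<alpha>_def mult_ac)
      finally have \<theta>\<alpha>: "\<theta> j = exp (2 * of_real pi * \<i> * of_real \<alpha>)" .
      then have "\<alpha> \<in> \<rat>"
        using rat v unfolding has_irrational_rotation_eigenvalue_def by metis
      then obtain p :: int and q :: nat where "q \<noteq> 0" "\<alpha> = of_int p / real q"
        unfolding Rats_eq_int_div_nat by auto
      then show ?thesis
        using \<theta>\<alpha> by (intro exI[of _ p] exI[of _ q]) simp
    qed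
    then obtain ps :: "'n \<Rightarrow> int" and qs :: "'n \<Rightarrow> nat"
      where "\<And>j. qs j > 0 \<and> \<theta> j = exp (2 * of_real pi * \<i> * of_int (ps j) / of_nat (qs j))"
      by metis
    from eigenvalue_products_roots_of_unity(2)[of qs \<theta> ps, OF this refl refl]
    obtain r where r: "r > 0" "eigenvalue_products \<theta> = {z. z ^ r = 1}"
      by blast
    have "finite (spectrum (metaplectic s g))"
      unfolding metaplectic_spectrum_finite[OF g s \<theta> r(2)] r(2) by (intro finite_imageI finite_roots_unity r)
    with S infinite_circle show False
      by simp
  qed
qed

lemma cmod_sqrt_inverse_det:
  assumes "unitary_matrix g" "s\<^sup>2 = inverse (det g)"
  shows "cmod s = 1"
proof -
  have "(cmod s)\<^sup>2 = 1\<^sup>2"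
    using arg_cong[OF assms(2), of cmod] unitary_cmod_det[OF assms(1)] by (simp add: norm_power norm_inverse)
  then show ?thesis
    by (rule power2_eq_imp_eq) auto
qed

theorem theorem1p2:
  fixes g :: "complex^'n^'n" and \<theta> :: "'n \<Rightarrow> complex" and s :: complex
  assumes "unitary_matrix g"
    and "eigenvalues_with_multiplicity g \<theta>"
    and "s\<^sup>2 = inverse (det g)"
  shows "unitary_op (metaplectic s g)
    \<and> point_spectrum (metaplectic s g) =
        {s * (\<Prod>j\<in>UNIV. cnj (\<theta> j) ^ n j) | n :: 'n \<Rightarrow> nat. True}
    \<and> (\<forall>(v :: 'n \<Rightarrow> complex^'n) (n :: 'n \<Rightarrow> nat).
        is_basis v \<and> (\<forall>j. g *v v j = \<theta> j *s v j) \<longrightarrow>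
        is_eigenvector (metaplectic s g) (s * (\<Prod>j\<in>UNIV. cnj (\<theta> j) ^ n j))
          (bargmann_adjoint
            (\<lambda>z. \<Prod>k\<in>UNIV. (\<Sum>j\<in>UNIV. vec_cinner (v k) (axis j 1) * z $ j) ^ n k)))
    \<and> (has_irrational_rotation_eigenvalue g \<longleftrightarrow> spectrum (metaplectic s g) = sphere 0 1)
    \<and> (\<forall>(ps :: 'n \<Rightarrow> int) (qs :: 'n \<Rightarrow> nat) (p :: nat) (q :: nat).
        (\<forall>j. qs j > 0 \<and> \<theta> j = exp (2 * of_real pi * \<i> * of_int (ps j) / of_nat (qs j))) \<and>
        q = Lcm (range qs) \<and> p = Gcd (range (\<lambda>j. q * nat \<bar>ps j\<bar> div qs j)) \<longrightarrow>
        point_spectrum (metaplectic s g) = spectrum (metaplectic s g) \<and>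
        spectrum (metaplectic s g) =
          {s * exp (2 * of_real pi * \<i> * of_nat n * of_nat p / of_nat q) | n :: nat. n > 0} \<and>
        (\<exists>c\<in>sphere 0 1. \<exists>H. subgroup H circle_group \<and> finite H \<and>
          spectrum (metaplectic s g) = (\<lambda>h. c * h) ` H))"
proof (intro conjI allI impI)
  note g = assms(1) and \<theta> = assms(2)
  have s: "cmod s = 1"
    by (rule cmod_sqrt_inverse_det[OF assms(1,3)])
  show "unitary_op (metaplectic s g)"
    by (rule metaplectic_unitary_op[OF g s])
  show "point_spectrum (metaplectic s g) = {s * (\<Prod>j\<in>UNIV. cnj (\<theta> j) ^ n j) | n. True}"
    unfolding metaplectic_point_spectrum[OF g s \<theta>] eigenvalue_products_def by blast
  show "has_irrational_rotation_eigenvalue g \<longleftrightarrow> spectrum (metaplectic s g) = sphere 0 1"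
    by (rule irrational_rotation_iff_spectrum[OF g s \<theta>])
  show "is_eigenvector (metaplectic s g) (s * (\<Prod>j\<in>UNIV. cnj (\<theta> j) ^ n j))
      (bargmann_adjoint (\<lambda>z. \<Prod>k\<in>UNIV. (\<Sum>j\<in>UNIV. vec_cinner (v k) (axis j 1) * z $ j) ^ n k))"
    if v: "is_basis v \<and> (\<forall>j. g *v v j = \<theta> j *s v j)" for v :: "'n \<Rightarrow> complex^'n" and n
  proof -
    have "v k \<noteq> 0" for k
      using v vec.dependent_zero[of "range v"] unfolding is_basis_def by (metis rangeI)
    then have "matrix_eigenvector g (\<theta> k) (v k)" for k
      using v by (simp add: matrix_eigenvector_def)
    \<comment> \<open>The coordinate sum in the statement is \<open>vec_cinner (v k) z\<close>,
      because the product with \<open>axis j 1\<close> is the conjugate of the j-th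
      coordinate.\<close>
    from polynomial_eigenvector[where \<theta> = \<theta>, OF g this, of s n] show ?thesis
      by (simp add: vec_cinner_axis vec_cinner_def[of "v _"])
  qed
  fix ps :: "'n \<Rightarrow> int" and qs :: "'n \<Rightarrow> nat" and p q :: nat
  assume asm: "(\<forall>j. qs j > 0 \<and> \<theta> j = exp (2 * of_real pi * \<i> * of_int (ps j) / of_nat (qs j))) \<and>
        q = Lcm (range qs) \<and> p = Gcd (range (\<lambda>j. q * nat \<bar>ps j\<bar> div qs j))"
  note P = eigenvalue_products_roots_of_unity[of qs \<theta> ps q p]
  obtain r where r: "r > 0" "eigenvalue_products \<theta> = {z. z ^ r = 1}"
    using P(2) asm by blast
  note spec = metaplectic_spectrum_finite[OF g s \<theta> r(2)]
  show "point_spectrum (metaplectic s g) = spectrum (metaplectic s g)"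
    by (simp only: spec metaplectic_point_spectrum[OF g s \<theta>])
  have eq: "eigenvalue_products \<theta> = {exp (2 * of_real pi * \<i> * of_nat n * of_nat p / of_nat q) | n::nat. n > 0}"
    using P(1) asm by blast
  show "spectrum (metaplectic s g) =
      {s * exp (2 * of_real pi * \<i> * of_nat n * of_nat p / of_nat q) | n :: nat. n > 0}"
    unfolding spec eq by blast
  \<comment> \<open>The rotation is by \<open>s\<close>, and the subgroup consists of the r-th roots
    of unity.\<close>
  show "\<exists>c\<in>sphere 0 1. \<exists>H. subgroup H circle_group \<and> finite H \<and>
      spectrum (metaplectic s g) = (\<lambda>h. c * h) ` H"
    using s circle_group_subgroup[OF r(1)] finite_roots_unity[OF r(1)]
    by (intro bexI[of _ s] exI[of _ "{z. z ^ r = 1}"]) (auto simp: spec r(2) dist_norm)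
qed

end
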